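(* Let $\mathcal{W}\subset\mathbb{R}^2=\mathbb{C}$ be a Jordan measurable set which is star-shaped with respect to the origin and contains a neighbourhood of the origin, and let $r\ge 1$ be such that $-\mathcal{W}\subset r\mathcal{W}$. Let $P=\{\pi_1,\ldots,\pi_n\}$ be the (finite) set of all $\pi\in\mathbb{P}$ with $|\sigma(\pi)|\le r$. Let $k_0\le 0$, $K$ and $m_1,\ldots,m_n\ge 1$ be integers, and put $$M=\Big(\{\pi_1^{m_1},\ldots,\pi_n^{m_n}\}\cup\Big\{\lambda^k\prod_{i=1}^n\pi_i^{k_i}\ \Big|\ k_0\le k\le K,\ -m_i<k_i<m_i\Big\}\Big)\cap\mathbb{R}_{>1}.$$ Suppose that $(\mathbb{P}\setminus P)\cup M$ is a set of occlusion quotients for $\mathcal{A}_\mathcal{W}$. For a subset $M_0\subset M$, let $\Pi_{M_0}\in\mathbb{Z}[\sqrt2]$ denote a least common multiple of the numerators of the elements of $M_0$, and let $\mathcal{W}_{M_0}=\mathcal{W}\cap\bigcap_{c\in M_0}\sigma(c)\mathcal{W}$. Then $$\theta(\widehat{\mathcal{A}_\mathcal{W}})=\left(4\,\zeta_{\mathbb{Q}(\sqrt2)}(2)\prod_{\pi\in P}\left(1-\frac{1}{N(\pi)^2}\right)\right)^{-1}\sum_{M_0\subset M}\frac{(-1)^{\#M_0}\,\mathrm{vol}(\mathcal{W}_{M_0})}{N(\Pi_{M_0})^2}.$$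
   Context: Identify $\mathbb{C}$ with $\mathbb{R}^2$. For a locally finite set $\mathcal{P}\subset\mathbb{R}^d$, the set of visible points is $\widehat{\mathcal{P}}=\{x\in\mathcal{P}\mid tx\notin\mathcal{P}\ \forall t\in(0,1)\}$. $\mathcal{P}$ has density $\theta(\mathcal{P})$ if $\lim_{T\to\infty}\#(\mathcal{P}\cap TD)/\mathrm{vol}(TD)=\theta(\mathcal{P})$ for every Jordan measurable $D\subset\mathbb{R}^d$ with $\mathrm{vol}(D)>0$. A set $C\subset\mathbb{R}_{>1}$ is a set of occlusion quotients for $\mathcal{P}$ if for each $x\in\mathcal{P}\setminus\widehat{\mathcal{P}}$ there is $c\in C$ with $x/c\in\mathcal{P}$. (Jordan measurable: bounded with boundary of Lebesgue measure zero. Star-shaped with respect to the origin: nonempty, and $tx\in\mathcal{W}$ for all $x\in\mathcal{W}$, $t\in[0,1]$.) Let $\zeta=e^{2\pi i/8}$; the ring of integers of $\mathbb{Q}(\zeta)\cap\mathbb{R}=\mathbb{Q}(\sqrt2)$ is $\mathbb{Z}[\sqrt2]$ (a Euclidean domain), with fundamental unit $\lambda=1+\sqrt2$. Let $\sigma$ be the automorphism of $\mathbb{Q}(\zeta)$ with $\sigma(\zeta)=\zeta^3$; it restricts to the nontrivial automorphism of $\mathbb{Q}(\sqrt2)$. Put $N(x)=x\sigma(x)$ for $x\in\mathbb{Q}(\sqrt2)$. Let $\mathbb{P}=\{\pi\in\mathbb{Z}[\sqrt2]\mid\pi\text{ prime},\ 1<\pi<\lambda\}$. For bounded $\mathcal{W}\subset\mathbb{C}$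 let $\mathcal{A}_\mathcal{W}=\{x\in\mathbb{Z}[\zeta]\mid\sigma(x)\in\mathcal{W}\}$. A numerator of $c\in\mathbb{Q}(\sqrt2)\setminus\{0\}$ is an element $a$ where $c=a/b$ with $a,b\in\mathbb{Z}[\sqrt2]$ relatively prime (unique up to units). For $M_0=\emptyset$, $\Pi_{M_0}=1$ and $\mathcal{W}_{M_0}=\mathcal{W}$. $\zeta_{\mathbb{Q}(\sqrt2)}$ is the Dedekind zeta function. *)

theory Defs
  imports "HOL-Analysis.Analysis" "HOL-Algebra.Ring_Divisibility"
begin

section \<open>Point sets in Euclidean space\<close>

definition visible :: "'a::real_vector set \<Rightarrow> 'a set" where
  "visible S = {x \<in> S. \<forall>t. 0 < t \<and> t < 1 \<longrightarrow> t *\<^sub>R x \<notin> S}"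

definition jordan_measurable :: "'a::euclidean_space set \<Rightarrow> bool" where
  "jordan_measurable D \<longleftrightarrow> bounded D \<and> negligible (frontier D)"

text \<open>Meant for locally finite \<open>S\<close> (and subsets of such), so that each \<open>S \<inter> TD\<close> is finite; see
  \<open>finite_A_win\<close> below. Volumes are taken with respect to \<^const>\<open>lebesgue\<close> because a Jordan
  measurable set need not be Borel.\<close>

definition has_density :: "'a::euclidean_space set \<Rightarrow> real \<Rightarrow> bool" where
  "has_density S \<theta> \<longleftrightarrow>
    (\<forall>D. jordan_measurable D \<and> measure lebesgue D > 0 \<longrightarrow>
      ((\<lambda>T::real. real (card (S \<inter> (\<lambda>x. T *\<^sub>R x) ` D)) / measure lebesgue ((\<lambda>x. T *\<^sub>R x) ` D))
        \<longlongrightarrow> \<theta>) at_top)"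

definition occlusion_quotients :: "real set \<Rightarrow> 'a::real_vector set \<Rightarrow> bool" where
  "occlusion_quotients C S \<longleftrightarrow> C \<subseteq> {1<..} \<and> (\<forall>x \<in> S - visible S. \<exists>c\<in>C. x /\<^sub>R c \<in> S)"

definition star_shaped_origin :: "'a::real_vector set \<Rightarrow> bool" where
  "star_shaped_origin W \<longleftrightarrow> W \<noteq> {} \<and> (\<forall>x\<in>W. \<forall>t\<in>{0..1}. t *\<^sub>R x \<in> W)"


section \<open>Rings, least common multiples and Dedekind zeta functions\<close>

definition induced_ring :: "'a::comm_ring_1 set \<Rightarrow> 'a ring" where
  "induced_ring A = \<lparr>carrier = A, mult = (*), one = 1, zero = 0, add = (+)\<rparr>"

text \<open>The version of \<^const>\<open>islcm\<close> for arbitrary sets of elements.\<close>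

definition is_lcm_of :: "('a, 'b) monoid_scheme \<Rightarrow> 'a \<Rightarrow> 'a set \<Rightarrow> bool" where
  "is_lcm_of G l A \<longleftrightarrow> l \<in> carrier G \<and> (\<forall>a\<in>A. a divides\<^bsub>G\<^esub> l) \<and>
    (\<forall>y\<in>carrier G. (\<forall>a\<in>A. a divides\<^bsub>G\<^esub> y) \<longrightarrow> l divides\<^bsub>G\<^esub> y)"

definition relatively_prime :: "('a, 'b) monoid_scheme \<Rightarrow> 'a \<Rightarrow> 'a \<Rightarrow> bool" where
  "relatively_prime G a b \<longleftrightarrow>
    (\<forall>d\<in>carrier G. d divides\<^bsub>G\<^esub> a \<and> d divides\<^bsub>G\<^esub> b \<longrightarrow> d \<in> Units G)"

text \<open>The Dedekind zeta function of a number field with ring of integers \<open>R\<close>, at real \<open>s > 1\<close>: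
  the sum of the \<open>s\<close>-th inverse powers of the absolute norms of the nonzero ideals.\<close>

definition dedekind_zeta :: "('a, 'b) ring_scheme \<Rightarrow> real \<Rightarrow> real" where
  "dedekind_zeta R s =
    (\<Sum>\<^sub>\<infinity>I\<in>{I. ideal I R \<and> I \<noteq> {\<zero>\<^bsub>R\<^esub>}}. 1 / real (card (carrier (R Quot I))) powr s)"


section \<open>The eighth cyclotomic field\<close>

definition zeta8 :: complex where
  "zeta8 = exp (2 * of_real pi * \<i> / 8)"

definition Qzeta8 :: "complex set" where
  "Qzeta8 = {of_rat a + of_rat b * zeta8 + of_rat c * zeta8 ^ 2 + of_rat d * zeta8 ^ 3 |a b c d. True}"

definition Zzeta8 :: "complex set" where
  "Zzeta8 = {of_int a + of_int b * zeta8 + of_int c * zeta8 ^ 2 + of_int d * zeta8 ^ 3 |a b c d. True}"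

definition Zsqrt2 :: "real set" where
  "Zsqrt2 = {of_int a + of_int b * sqrt 2 |a b. True}"

text \<open>The field automorphism with \<open>\<sigma>(\<zeta>) = \<zeta>\<^sup>3\<close>, as a function with unspecified values outside of
  \<open>\<rat>(\<zeta>)\<close>; existence, uniqueness and an explicit formula are shown below.\<close>

definition is_sigma :: "(complex \<Rightarrow> complex) \<Rightarrow> bool" where
  "is_sigma s \<longleftrightarrow> s \<in> ring_iso (induced_ring Qzeta8) (induced_ring Qzeta8) \<and>
    s \<in> extensional Qzeta8 \<and> s zeta8 = zeta8 ^ 3"

definition sigma8 :: "complex \<Rightarrow> complex" where
  "sigma8 = (THE s. is_sigma s)"

text \<open>\<open>\<sigma>\<close> maps \<open>\<rat>(\<surd>2)\<close> to itself, so taking the real part loses nothing (see \<open>sigma_Qsqrt2\<close>).\<close>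

definition nrm :: "real \<Rightarrow> real" where
  "nrm x = x * Re (sigma8 (of_real x))"

definition fund_unit :: real where
  "fund_unit = 1 + sqrt 2"

definition PP :: "real set" where
  "PP = {p \<in> Zsqrt2. ring_prime\<^bsub>induced_ring Zsqrt2\<^esub> p \<and> 1 < p \<and> p < fund_unit}"

definition is_numerator :: "real \<Rightarrow> real \<Rightarrow> bool" where
  "is_numerator c a \<longleftrightarrow> a \<in> Zsqrt2 \<and>
    (\<exists>b\<in>Zsqrt2. b \<noteq> 0 \<and> c = a / b \<and> relatively_prime (induced_ring Zsqrt2) a b)"

definition A_win :: "complex set \<Rightarrow> complex set" where
  "A_win W = {x \<in> Zzeta8. sigma8 x \<in> W}"

definition win_inter :: "complex set \<Rightarrow> real set \<Rightarrow> complex set" where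
  "win_inter W M0 = W \<inter> (\<Inter>c\<in>M0. (\<lambda>w. sigma8 (of_real c) * w) ` W)"


subsection \<open>Existence and uniqueness of \<open>\<sigma>\<close>\<close>

definition q8 :: "rat \<Rightarrow> rat \<Rightarrow> rat \<Rightarrow> rat \<Rightarrow> complex" where
  "q8 a b c d = of_rat a + of_rat b * zeta8 + of_rat c * zeta8 ^ 2 + of_rat d * zeta8 ^ 3"

lemma zeta8_eq: "zeta8 = Complex (sqrt 2 / 2) (sqrt 2 / 2)"
proof -
  have "zeta8 = cis (pi / 4)"
    by (simp add: zeta8_def cis_conv_exp field_simps)
  then show ?thesis
    by (simp add: cis.ctr cos_45 sin_45)
qed

lemma zeta8_2: "zeta8 ^ 2 = \<i>"
  by (simp add: zeta8_eq power2_eq_square complex_eq_iff)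

lemma zeta8_3: "zeta8 ^ 3 = Complex (- sqrt 2 / 2) (sqrt 2 / 2)"
proof -
  have "zeta8 ^ 3 = zeta8 ^ 2 * zeta8" by (simp add: power3_eq_cube power2_eq_square)
  then show ?thesis unfolding zeta8_2 unfolding zeta8_eq by (simp add: complex_eq_iff)
qed

lemma Re_of_rat [simp]: "Re (of_rat a) = of_rat a" and Im_of_rat [simp]: "Im (of_rat a) = 0"
proof -
  have "(of_rat a :: complex) = of_real (of_rat a)"
    by (cases a) (simp add: of_rat_rat)
  then show "Re (of_rat a) = of_rat a" "Im (of_rat a) = 0"
    by (metis Re_complex_of_real, metis Im_complex_of_real)
qed

lemma q8_eq: "q8 a b c d = Complex (of_rat a + of_rat (b - d) * (sqrt 2 / 2))
    (of_rat c + of_rat (b + d) * (sqrt 2 / 2))"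
  unfolding q8_def zeta8_3 zeta8_2 unfolding zeta8_eq
  by (simp add: complex_eq_iff of_rat_add of_rat_diff field_simps)

lemma sqrt2_irrational: "sqrt 2 \<notin> \<rat>"
proof
  assume "sqrt 2 \<in> \<rat>"
  then obtain p q :: nat where q: "q \<noteq> 0" "\<bar>sqrt 2\<bar> = real p / real q" "coprime p q"
    by (rule Rats_abs_nat_div_natE)
  then have "real p = sqrt 2 * real q" by (simp add: field_simps)
  then have "(real p)\<^sup>2 = 2 * (real q)\<^sup>2" by (simp add: power_mult_distrib)
  then have eq: "p\<^sup>2 = 2 * q\<^sup>2"
    by (metis of_nat_eq_iff of_nat_mult of_nat_numeral of_nat_power)
  then have "even (p\<^sup>2)" by simp
  then have p: "even p" by simp
  then obtain k where "p = 2 * k" by blast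
  with eq have "q\<^sup>2 = 2 * k\<^sup>2" by (simp add: power_mult_distrib)
  then have "even (q\<^sup>2)" by simp
  then have "even q" by simp
  with p q(3) show False using coprime_common_divisor_nat[of p q 2] by simp
qed

lemma sqrt2_indep:
  assumes "(of_rat a :: real) + of_rat b * sqrt 2 = 0"
  shows "a = 0" "b = 0"
proof -
  show b: "b = 0"
  proof (rule ccontr)
    assume "b \<noteq> 0"
    then have "sqrt 2 = - of_rat a / of_rat b" using assms by (simp add: field_simps)
    also have "\<dots> \<in> \<rat>" by simp
    finally show False using sqrt2_irrational by blast
  qed
  show "a = 0" using assms b by simp
qed

lemma q8_diff: "q8 a b c d - q8 a' b' c' d' = q8 (a - a') (b - b') (c - c') (d - d')"
  by (simp add: q8_def of_rat_diff algebra_simps)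

lemma q8_add: "q8 a b c d + q8 a' b' c' d' = q8 (a + a') (b + b') (c + c') (d + d')"
  by (simp add: q8_def of_rat_add algebra_simps)

lemma q8_zero:
  assumes "q8 a b c d = 0"
  shows "a = 0 \<and> b = 0 \<and> c = 0 \<and> d = 0"
proof -
  have "of_rat a + of_rat ((b - d) / 2) * sqrt 2 = 0" "of_rat c + of_rat ((b + d) / 2) * sqrt 2 = 0"
    using assms unfolding q8_eq by (simp_all add: complex_eq_iff of_rat_divide)
  from sqrt2_indep[OF this(1)] sqrt2_indep[OF this(2)] show ?thesis by auto
qed

lemma q8_inject: "q8 a b c d = q8 a' b' c' d' \<longleftrightarrow> a = a' \<and> b = b' \<and> c = c' \<and> d = d'"
  using q8_zero[of "a - a'" "b - b'" "c - c'" "d - d'"] q8_diff[of a b c d a' b' c' d'] by auto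

lemma q8_mult: "q8 a b c d * q8 a' b' c' d' =
  q8 (a * a' - b * d' - c * c' - d * b') (a * b' + b * a' - c * d' - d * c')
     (a * c' + b * b' + c * a' - d * d') (a * d' + b * c' + c * b' + d * a')"
proof -
  have z4: "zeta8 ^ 4 = -1"
  proof -
    have "zeta8 ^ 4 = (zeta8 ^ 2) ^ 2" by simp
    then show ?thesis unfolding zeta8_2 by simp
  qed
  have z5: "zeta8 ^ 5 = - zeta8" and z6: "zeta8 ^ 6 = - (zeta8 ^ 2)"
    using power_add[of zeta8 4 1] power_add[of zeta8 4 2] z4 by simp_all
  have "q8 a b c d * q8 a' b' c' d' =
    of_rat (a * a') + of_rat (a * b' + b * a') * zeta8 + of_rat (a * c' + b * b' + c * a') * zeta8 ^ 2
    + of_rat (a * d' + b * c' + c * b' + d * a') * zeta8 ^ 3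
    + of_rat (b * d' + c * c' + d * b') * zeta8 ^ 4 + of_rat (c * d' + d * c') * zeta8 ^ 5
    + of_rat (d * d') * zeta8 ^ 6"
    unfolding q8_def of_rat_add of_rat_mult
    by (simp add: algebra_simps eval_nat_numeral)
  also have "\<dots> = q8 (a * a' - b * d' - c * c' - d * b') (a * b' + b * a' - c * d' - d * c')
     (a * c' + b * b' + c * a' - d * d') (a * d' + b * c' + c * b' + d * a')"
    unfolding z4 z5 z6 q8_def of_rat_add of_rat_mult of_rat_diff by (simp add: algebra_simps)
  finally show ?thesis .
qed

lemma Qzeta8_q8: "Qzeta8 = {q8 a b c d |a b c d. True}"
  by (simp add: Qzeta8_def q8_def)

lemma q8_in [simp]: "q8 a b c d \<in> Qzeta8"
  by (auto simp: Qzeta8_q8)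

lemma zeta8_q8: "zeta8 = q8 0 1 0 0" and zeta8_3_q8: "zeta8 ^ 3 = q8 0 0 0 1"
  and one_q8: "1 = q8 1 0 0 0"
  by (simp_all add: q8_def)

lemma is_sigma_q8:
  assumes "is_sigma s"
  shows "s (q8 a b c d) = q8 a d (- c) b"
proof -
  have add: "s (x + y) = s x + s y" and mult: "s (x * y) = s x * s y"
    if "x \<in> Qzeta8" "y \<in> Qzeta8" for x y
    using assms that by (auto simp: is_sigma_def ring_iso_def ring_hom_def induced_ring_def)
  have one: "s 1 = 1" and z: "s zeta8 = zeta8 ^ 3"
    using assms by (auto simp: is_sigma_def ring_iso_def ring_hom_def induced_ring_def)
  have inQ: "of_rat x \<in> Qzeta8" for x
    using q8_in[of x 0 0 0] by (simp add: q8_def)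
  have inQn: "of_nat n \<in> Qzeta8" for n using inQ[of "of_nat n"] by simp
  have inQi: "of_int n \<in> Qzeta8" for n using inQ[of "of_int n"] by simp
  have zero: "s 0 = 0" using add[of 0 0] inQ[of 0] by simp
  have nat: "s (of_nat n) = of_nat n" for n
  proof (induction n)
    case (Suc n)
    then show ?case using add[of 1 "of_nat n"] inQ[of 1] inQn[of n] one by simp
  qed (use zero in simp)
  have int: "s (of_int n) = of_int n" for n
  proof (cases "n \<ge> 0")
    case True
    then show ?thesis using nat[of "nat n"] by simp
  next
    case False
    then have "s (of_int n + of_int (- n)) = s (of_int n) + s (of_int (- n))"
      by (intro add inQi)
    moreover have "s (of_int (- n)) = of_int (- n)" using nat[of "nat (- n)"] False by simp
    moreover have "s (of_int n + of_int (- n)) = 0" using zero by simp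
    ultimately have "s (of_int n) + of_int (- n) = 0" by metis
    then show ?thesis by simp
  qed
  have rat: "s (of_rat x) = of_rat x" for x
  proof -
    obtain p q where pq: "quotient_of x = (p, q)" by fastforce
    then have q: "q > 0" by (rule quotient_of_denom_pos)
    have x: "x = of_int p / of_int q" using pq by (rule quotient_of_div)
    have p: "(of_int p :: complex) = of_int q * of_rat x"
      using q by (simp add: x of_rat_divide)
    then have "s (of_int p) = s (of_int q) * s (of_rat x)"
      using mult[OF inQi[of q] inQ[of x]] by simp
    then have "of_int p = of_int q * s (of_rat x)" by (simp add: int)
    with p q show ?thesis by simp
  qed
  have zp: "zeta8 ^ 2 \<in> Qzeta8" "zeta8 ^ 3 \<in> Qzeta8" "zeta8 \<in> Qzeta8"
    using q8_in[of 0 0 1 0] q8_in[of 0 0 0 1] q8_in[of 0 1 0 0] by (simp_all add: q8_def)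
  have cl: "x + y \<in> Qzeta8" "x * y \<in> Qzeta8" if "x \<in> Qzeta8" "y \<in> Qzeta8" for x y
    using that by (auto simp: Qzeta8_q8 q8_add q8_mult) blast+
  have s2: "s (zeta8 ^ 2) = (zeta8 ^ 3) * (zeta8 ^ 3)"
    using mult[of zeta8 zeta8] zp z by (simp add: power2_eq_square)
  have s3: "s (zeta8 ^ 3) = (zeta8 ^ 3) * (zeta8 ^ 3) * (zeta8 ^ 3)"
    using mult[of zeta8 "zeta8 ^ 2"] zp z s2 by (simp add: power3_eq_cube power2_eq_square mult_ac)
  have "s (q8 a b c d) = of_rat a + of_rat b * s zeta8 + of_rat c * s (zeta8 ^ 2) + of_rat d * s (zeta8 ^ 3)"
    unfolding q8_def by (simp add: add mult cl inQ zp rat del: z)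
  also have "\<dots> = q8 a d (- c) b"
  proof -
    have "(zeta8 ^ 3) * (zeta8 ^ 3) = - (zeta8 ^ 2)" "- (zeta8 ^ 2) * (zeta8 ^ 3) = zeta8"
      unfolding zeta8_3 zeta8_2 unfolding zeta8_eq by (simp_all add: complex_eq_iff)
    then show ?thesis unfolding z s2 s3 by (simp add: q8_def of_rat_minus)
  qed
  finally show ?thesis .
qed

lemma ex1_sigma: "\<exists>!s. is_sigma s"
proof (rule ex_ex1I)
  define s where "s = restrict (\<lambda>x. THE y. \<exists>a b c d. x = q8 a b c d \<and> y = q8 a d (- c) b) Qzeta8"
  have s: "s (q8 a b c d) = q8 a d (- c) b" for a b c d
    unfolding s_def by (auto simp: q8_inject)
  have "bij_betw s Qzeta8 Qzeta8"
    by (rule bij_betw_byWitness[where f' = s]) (auto simp: Qzeta8_q8 s simp del: ex_simps, blast+)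
  moreover have "s (x + y) = s x + s y \<and> s (x * y) = s x * s y" if "x \<in> Qzeta8" "y \<in> Qzeta8" for x y
    using that by (auto simp: Qzeta8_q8 s q8_add q8_mult q8_inject algebra_simps)
  moreover have "s 1 = 1" using s[of 1 0 0 0] by (simp add: q8_def)
  moreover have "s zeta8 = zeta8 ^ 3" unfolding zeta8_3_q8 by (subst zeta8_q8) (simp add: s)
  moreover have "s \<in> extensional Qzeta8" by (simp add: s_def)
  ultimately have "is_sigma s"
    by (auto simp: is_sigma_def ring_iso_def ring_hom_def induced_ring_def bij_betw_def)
  then show "\<exists>s. is_sigma s" by blast
next
  fix s t assume st: "is_sigma s" "is_sigma t"
  show "s = t"
  proof (rule extensionalityI[of _ Qzeta8])
    fix x assume "x \<in> Qzeta8"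
    then show "s x = t x" using st by (auto simp: Qzeta8_q8 is_sigma_q8)
  qed (use st in \<open>auto simp: is_sigma_def\<close>)
qed

lemma is_sigma_sigma: "is_sigma sigma8"
  unfolding sigma8_def by (rule theI'[OF ex1_sigma])

lemma sigma_q8: "sigma8 (q8 a b c d) = q8 a d (- c) b"
  by (rule is_sigma_q8[OF is_sigma_sigma])

lemma sigma_Qsqrt2:
  "sigma8 (of_real (of_rat a + of_rat b * sqrt 2)) = of_real (of_rat a - of_rat b * sqrt 2)"
proof -
  have "of_real (of_rat a + of_rat b * sqrt 2) = q8 a b 0 (- b)" for a b
    by (simp add: q8_eq complex_eq_iff of_rat_add[of b b, folded mult_2])
  from this[of a b] this[of a "- b"] show ?thesis by (simp add: sigma_q8 of_rat_minus)
qed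

lemma nrm_Qsqrt2: "nrm (of_rat a + of_rat b * sqrt 2) = of_rat (a\<^sup>2 - 2 * b\<^sup>2)"
  unfolding nrm_def sigma_Qsqrt2
  by (simp add: of_rat_diff of_rat_mult of_rat_power algebra_simps power2_eq_square)


subsection \<open>Finiteness\<close>

lemma finite_Zzeta8_bounded: "finite {x \<in> Zzeta8. cmod x \<le> R \<and> cmod (sigma8 x) \<le> R}"
proof -
  define B where "B = \<lceil>2 * R\<rceil>"
  let ?g = "\<lambda>(a, b, c, d). q8 (of_int a) (of_int b) (of_int c) (of_int d)"
  have "x \<in> ?g ` ({-B..B} \<times> {-B..B} \<times> {-B..B} \<times> {-B..B})"
    if x: "x \<in> Zzeta8" "cmod x \<le> R" "cmod (sigma8 x) \<le> R" for x
  proof -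
    obtain a b c d where xe: "x = q8 (of_int a) (of_int b) (of_int c) (of_int d)"
      using x(1) by (auto simp: Zzeta8_def q8_def)
    have sx: "sigma8 x = q8 (of_int a) (of_int d) (- of_int c) (of_int b)"
      by (simp add: xe sigma_q8)
    define u v where "u = (real_of_int b - d) * (sqrt 2 / 2)" and "v = (real_of_int b + d) * (sqrt 2 / 2)"
    have "\<bar>Re x\<bar> \<le> R" "\<bar>Im x\<bar> \<le> R" "\<bar>Re (sigma8 x)\<bar> \<le> R" "\<bar>Im (sigma8 x)\<bar> \<le> R"
      using x(2,3) abs_Re_le_cmod abs_Im_le_cmod order_trans by blast+
    moreover have "Re x = a + u" "Im x = c + v" "Re (sigma8 x) = a - u" "Im (sigma8 x) = - c + v"
      unfolding sx unfolding xe q8_eq by (simp_all add: u_def v_def of_rat_diff of_rat_add of_rat_minus field_simps)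
    ultimately have bnd: "\<bar>real_of_int a\<bar> \<le> R" "\<bar>real_of_int c\<bar> \<le> R" "\<bar>u\<bar> \<le> R" "\<bar>v\<bar> \<le> R"
      by linarith+
    have "real_of_int b = sqrt 2 / 2 * (u + v)" "real_of_int d = sqrt 2 / 2 * (v - u)"
      by (simp_all add: u_def v_def algebra_simps) (simp_all add: field_simps)
    moreover have "\<bar>sqrt 2 / 2 * w\<bar> \<le> 2 * R" if "\<bar>w\<bar> \<le> 2 * R" for w
    proof -
      have "sqrt 2 / 2 \<le> (1::real)" using real_sqrt_le_mono[of 2 4] by simp
      then have "\<bar>sqrt 2 / 2\<bar> * \<bar>w\<bar> \<le> 1 * \<bar>w\<bar>" by (intro mult_right_mono) auto
      then show ?thesis using that by (simp add: abs_mult)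
    qed
    ultimately have "\<bar>real_of_int b\<bar> \<le> 2 * R" "\<bar>real_of_int d\<bar> \<le> 2 * R"
      using bnd by (metis abs_triangle_ineq abs_triangle_ineq4 add_mono mult_2 order_trans)+
    moreover have "\<bar>real_of_int a\<bar> \<le> 2 * R" "\<bar>real_of_int c\<bar> \<le> 2 * R" using bnd by linarith+
    moreover have "z \<in> {-B..B}" if "\<bar>real_of_int z\<bar> \<le> 2 * R" for z
      using that unfolding B_def by (simp add: abs_le_iff) linarith
    ultimately show ?thesis by (auto simp: xe intro!: image_eqI[of _ _ "(a, b, c, d)"])
  qed
  then have "{x \<in> Zzeta8. cmod x \<le> R \<and> cmod (sigma8 x) \<le> R}
      \<subseteq> ?g ` ({-B..B} \<times> {-B..B} \<times> {-B..B} \<times> {-B..B})" by blast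
  then show ?thesis by (rule finite_subset) auto
qed

lemma finite_A_win:
  assumes "bounded W" "bounded D"
  shows "finite (A_win W \<inter> D)"
proof -
  obtain R1 R2 where "\<forall>x\<in>W. cmod x \<le> R1" "\<forall>x\<in>D. cmod x \<le> R2"
    using assms by (auto simp: bounded_iff)
  then have "A_win W \<inter> D \<subseteq> {x \<in> Zzeta8. cmod x \<le> max R1 R2 \<and> cmod (sigma8 x) \<le> max R1 R2}"
    by (fastforce simp: A_win_def)
  then show ?thesis using finite_Zzeta8_bounded by (rule finite_subset)
qed

lemma finite_PP_bounded: "finite {p \<in> PP. cmod (sigma8 (of_real p)) \<le> r}"
proof -
  let ?R = "max fund_unit r"
  have "complex_of_real p \<in> Zzeta8" if p: "p \<in> Zsqrt2" for p
  proof -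
    obtain a b :: int where ab: "p = of_int a + of_int b * sqrt 2" using p by (auto simp: Zsqrt2_def)
    have "complex_of_real p = of_int a + of_int b * zeta8 + of_int 0 * zeta8 ^ 2 + of_int (- b) * zeta8 ^ 3"
      unfolding zeta8_3 unfolding zeta8_eq ab by (simp add: complex_eq_iff)
    then show ?thesis unfolding Zzeta8_def by blast
  qed
  then have "complex_of_real ` {p \<in> PP. cmod (sigma8 (of_real p)) \<le> r}
      \<subseteq> {x \<in> Zzeta8. cmod x \<le> ?R \<and> cmod (sigma8 x) \<le> ?R}"
    by (auto simp: PP_def)
  then have "finite (complex_of_real ` {p \<in> PP. cmod (sigma8 (of_real p)) \<le> r})"
    using finite_Zzeta8_bounded by (rule finite_subset)
  then show ?thesis by (rule finite_imageD) (simp add: inj_on_def)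
qed

end

theory Submission
  imports Defs
begin

text \<open>Nonzero points of \<open>\<A>\<^sub>\<W>\<close> are hidden by a prime \<open>\<pi> \<notin> P\<close> exactly when \<open>\<pi>\<close> divides them, because
  star-shapedness and \<open>-\<W> \<subseteq> r \<W>\<close> give \<open>\<W> / \<sigma>(\<pi>) \<subseteq> \<W>\<close> once \<open>\<bar>\<sigma>(\<pi>)\<bar> > r\<close>. So the visible points
  are obtained by sieving out all primes outside \<open>P\<close> and, by inclusion and exclusion, the finitely many
  conditions \<open>x/c \<in> \<A>\<^sub>\<W>\<close> with \<open>c \<in> M\<close>; each conjunction of such conditions is a divisibility by a least common
  multiple together with a smaller window.

  The underlying lattice point count is elementary: a unit \<open>\<lambda>\<^sup>k\<close> moves the thin region
  \<open>T D \<times> \<W>\<close> to one whose two factors have comparable size \<open>\<surd>T\<close>, where lattice points are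
  counted by comparing unit cells with volume. The same balancing bounds the nonzero points divisible by a prime
  of large norm, uniformly in the prime, so that the sieve may be truncated; the truncated Euler products
  converge because sifting the ideals by the primes of norm at most \<open>X\<close> leaves only the unit ideal and
  ideals of norm larger than \<open>X\<close>.\<close>

section \<open>The ring of integers of the real quadratic subfield\<close>

text \<open>The factor 4 is the determinant of the diagonal embedding of Z[zeta] in C x C. Since
  Z[zeta] is free of rank 2 over Z[sqrt 2], a scalar a divides a proportion 1/N(a)^2 of its points;
  so the sieve factors are Euler factors of the zeta function at 2, and the factors of
  \<open>P\<close>, which is not sieved, have to be divided out. Primes of \<open>P\<close> cannot
  be sieved because dividing x by one of them may move sigma(x) out of the window; they enter only
  through \<open>M\<close>. The two mechanisms are independent: numerators of elements of
  \<open>M\<close> consist of units and primes of \<open>P\<close>, so their least common multiples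
  are prime to every sieved prime.

  The obstacle is the exchange of two limits, the dilation T and the sieving bound X. Boundary
  errors of the volume comparison cannot be summed over infinitely many primes. A second, cruder
  count has no main term but is bounded by a multiple of T^2/N(p)^2. It rests on the fact that a
  nonzero algebraic integer has norm at least 1: once |N(p)| exceeds a multiple of T, no nonzero
  multiple of p is left.\<close>

definition Qsqrt2 :: "real set" where
  "Qsqrt2 = {of_rat a + of_rat b * sqrt 2 |a b. True}"

text \<open>The Galois conjugate as a real function; it is meaningful only on \<open>Qsqrt2\<close>,
  which explains the membership premises below.\<close>

definition cj :: "real \<Rightarrow> real" where
  "cj x = Re (sigma8 (of_real x))"

lemma nrm_cj: "nrm x = x * cj x"
  by (simp add: nrm_def cj_def)

lemma Zsqrt2I: "of_int a + of_int b * sqrt 2 \<in> Zsqrt2"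
  by (auto simp: Zsqrt2_def)

lemma Qsqrt2I: "of_rat a + of_rat b * sqrt 2 \<in> Qsqrt2"
  by (auto simp: Qsqrt2_def)

lemma Zsqrt2_Qsqrt2 [simp]: "x \<in> Zsqrt2 \<Longrightarrow> x \<in> Qsqrt2"
proof -
  assume "x \<in> Zsqrt2"
  then obtain a b :: int where "x = of_int a + of_int b * sqrt 2" by (auto simp: Zsqrt2_def)
  then show ?thesis using Qsqrt2I[of "of_int a" "of_int b"] by simp
qed

lemma Zsqrt2_of_int [simp]: "of_int n \<in> Zsqrt2"
  using Zsqrt2I[of n 0] by simp

lemma Zsqrt2_0 [simp]: "0 \<in> Zsqrt2" and Zsqrt2_1 [simp]: "1 \<in> Zsqrt2"
  using Zsqrt2_of_int[of 0] Zsqrt2_of_int[of 1] by simp_all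

lemma Zsqrt2_add [simp]: "x \<in> Zsqrt2 \<Longrightarrow> y \<in> Zsqrt2 \<Longrightarrow> x + y \<in> Zsqrt2"
proof -
  assume "x \<in> Zsqrt2" "y \<in> Zsqrt2"
  then obtain a b a' b' :: int where "x = a + b * sqrt 2" "y = a' + b' * sqrt 2"
    by (auto simp: Zsqrt2_def)
  then show ?thesis using Zsqrt2I[of "a + a'" "b + b'"] by (simp add: algebra_simps)
qed

lemma Zsqrt2_mult [simp]: "x \<in> Zsqrt2 \<Longrightarrow> y \<in> Zsqrt2 \<Longrightarrow> x * y \<in> Zsqrt2"
proof -
  assume "x \<in> Zsqrt2" "y \<in> Zsqrt2"
  then obtain a b a' b' :: int where "x = a + b * sqrt 2" "y = a' + b' * sqrt 2"
    by (auto simp: Zsqrt2_def)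
  then show ?thesis using Zsqrt2I[of "a * a' + 2 * b * b'" "a * b' + b * a'"] by (simp add: algebra_simps)
qed

lemma Zsqrt2_uminus [simp]: "x \<in> Zsqrt2 \<Longrightarrow> - x \<in> Zsqrt2"
  using Zsqrt2_mult[of "of_int (- 1)" x, OF Zsqrt2_of_int] by simp

lemma Zsqrt2_diff [simp]: "x \<in> Zsqrt2 \<Longrightarrow> y \<in> Zsqrt2 \<Longrightarrow> x - y \<in> Zsqrt2"
  using Zsqrt2_add[of x "- y"] by simp

lemma Zsqrt2_power [simp]: "x \<in> Zsqrt2 \<Longrightarrow> x ^ n \<in> Zsqrt2"
  by (induction n) auto

lemma Zsqrt2_prod [simp]: "(\<And>i. i \<in> A \<Longrightarrow> f i \<in> Zsqrt2) \<Longrightarrow> prod f A \<in> Zsqrt2"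
  by (induction A rule: infinite_finite_induct) auto

lemma cj_Qsqrt2: "cj (of_rat a + of_rat b * sqrt 2) = of_rat a - of_rat b * sqrt 2"
  unfolding cj_def sigma_Qsqrt2 by simp

lemma cj_Zsqrt2: "cj (of_int a + of_int b * sqrt 2) = of_int a - of_int b * sqrt 2"
  using cj_Qsqrt2[of "of_int a" "of_int b"] by simp

lemma Qsqrt2E:
  assumes "x \<in> Qsqrt2" obtains a b where "x = of_rat a + of_rat b * sqrt 2"
  using assms by (auto simp: Qsqrt2_def)

lemma Zsqrt2E:
  assumes "x \<in> Zsqrt2" obtains a b :: int where "x = of_int a + of_int b * sqrt 2"
  using assms by (auto simp: Zsqrt2_def)

lemma sigma8_of_real:
  assumes "x \<in> Qsqrt2" shows "sigma8 (of_real x) = of_real (cj x)"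
proof -
  obtain a b where "x = of_rat a + of_rat b * sqrt 2" using assms by (rule Qsqrt2E)
  then show ?thesis by (simp only: sigma_Qsqrt2 cj_Qsqrt2)
qed

lemma Qsqrt2_add [simp]: "x \<in> Qsqrt2 \<Longrightarrow> y \<in> Qsqrt2 \<Longrightarrow> x + y \<in> Qsqrt2"
  and cj_add: "x \<in> Qsqrt2 \<Longrightarrow> y \<in> Qsqrt2 \<Longrightarrow> cj (x + y) = cj x + cj y"
proof -
  assume "x \<in> Qsqrt2" "y \<in> Qsqrt2"
  then obtain a b a' b' where xy: "x = of_rat a + of_rat b * sqrt 2" "y = of_rat a' + of_rat b' * sqrt 2"
    by (elim Qsqrt2E)
  have e: "x + y = of_rat (a + a') + of_rat (b + b') * sqrt 2"
    by (simp add: xy of_rat_add algebra_simps)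
  show "x + y \<in> Qsqrt2" unfolding e by (rule Qsqrt2I)
  show "cj (x + y) = cj x + cj y"
    unfolding e unfolding xy cj_Qsqrt2 by (simp add: of_rat_add algebra_simps)
qed

lemma Qsqrt2_mult [simp]: "x \<in> Qsqrt2 \<Longrightarrow> y \<in> Qsqrt2 \<Longrightarrow> x * y \<in> Qsqrt2"
  and cj_mult: "x \<in> Qsqrt2 \<Longrightarrow> y \<in> Qsqrt2 \<Longrightarrow> cj (x * y) = cj x * cj y"
proof -
  assume "x \<in> Qsqrt2" "y \<in> Qsqrt2"
  then obtain a b a' b' where xy: "x = of_rat a + of_rat b * sqrt 2" "y = of_rat a' + of_rat b' * sqrt 2"
    by (elim Qsqrt2E)
  have e: "x * y = of_rat (a * a' + 2 * b * b') + of_rat (a * b' + b * a') * sqrt 2"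
    by (simp add: xy of_rat_add of_rat_mult algebra_simps)
  show "x * y \<in> Qsqrt2" unfolding e by (rule Qsqrt2I)
  show "cj (x * y) = cj x * cj y"
    unfolding e unfolding xy cj_Qsqrt2 by (simp add: of_rat_add of_rat_mult algebra_simps)
qed

lemma cj_0 [simp]: "cj 0 = 0" and cj_1 [simp]: "cj 1 = 1"
  using cj_Zsqrt2[of 0 0] cj_Zsqrt2[of 1 0] by simp_all

lemma cj_of_int [simp]: "cj (of_int n) = of_int n"
  using cj_Zsqrt2[of n 0] by simp

lemma cj_cj: "x \<in> Qsqrt2 \<Longrightarrow> cj (cj x) = x"
  and cj_Qsqrt2_closed [simp]: "x \<in> Qsqrt2 \<Longrightarrow> cj x \<in> Qsqrt2"
proof -
  assume "x \<in> Qsqrt2"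
  then obtain a b where x: "x = of_rat a + of_rat b * sqrt 2" by (elim Qsqrt2E)
  have c: "cj x = of_rat a + of_rat (- b) * sqrt 2" by (simp add: x cj_Qsqrt2 of_rat_minus)
  show "cj x \<in> Qsqrt2" unfolding c by (rule Qsqrt2I)
  show "cj (cj x) = x" unfolding c cj_Qsqrt2 by (simp add: x of_rat_minus)
qed

lemma cj_uminus: "x \<in> Qsqrt2 \<Longrightarrow> cj (- x) = - cj x"
  using cj_mult[of "of_int (-1)" x] cj_of_int[of "-1"] Zsqrt2_of_int[of "-1"] by simp

lemma cj_diff: "x \<in> Qsqrt2 \<Longrightarrow> y \<in> Qsqrt2 \<Longrightarrow> cj (x - y) = cj x - cj y"
  using cj_add[of x "- y"] Qsqrt2_mult[of "of_int (-1)" y] Zsqrt2_of_int[of "-1"] cj_uminus[of y] by simp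

lemma cj_Zsqrt2_closed [simp]: "x \<in> Zsqrt2 \<Longrightarrow> cj x \<in> Zsqrt2"
  by (metis Zsqrt2E Zsqrt2I cj_Zsqrt2 diff_conv_add_uminus minus_mult_left of_int_minus)

lemma cj_eq_0: "x \<in> Qsqrt2 \<Longrightarrow> cj x = 0 \<longleftrightarrow> x = 0"
  using cj_cj by fastforce

lemma nrm_mult: "x \<in> Qsqrt2 \<Longrightarrow> y \<in> Qsqrt2 \<Longrightarrow> nrm (x * y) = nrm x * nrm y"
  by (simp add: nrm_cj cj_mult)

lemma nrm_eq_0: "x \<in> Qsqrt2 \<Longrightarrow> nrm x = 0 \<longleftrightarrow> x = 0"
  by (simp add: nrm_cj cj_eq_0)

lemma nrm_1 [simp]: "nrm 1 = 1"
  by (simp add: nrm_cj)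

lemma nrm_Zsqrt2_eq: "nrm (of_int a + of_int b * sqrt 2) = of_int (a\<^sup>2 - 2 * b\<^sup>2)"
  unfolding nrm_cj cj_Zsqrt2 by (simp add: algebra_simps power2_eq_square)

lemma nrm_Ints: "x \<in> Zsqrt2 \<Longrightarrow> nrm x \<in> \<int>"
  by (metis Ints_of_int Zsqrt2E nrm_Zsqrt2_eq)

lemma nrm_ge_1: "x \<in> Zsqrt2 \<Longrightarrow> x \<noteq> 0 \<Longrightarrow> \<bar>nrm x\<bar> \<ge> 1"
  by (simp add: Ints_nonzero_abs_ge1 nrm_Ints nrm_eq_0)

lemma Qsqrt2_inverse [simp]: "x \<in> Qsqrt2 \<Longrightarrow> inverse x \<in> Qsqrt2"
proof (cases "x = 0")
  case False
  assume x: "x \<in> Qsqrt2"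
  then obtain a b where xe: "x = of_rat a + of_rat b * sqrt 2" by (elim Qsqrt2E)
  have n: "nrm x = of_rat (a\<^sup>2 - 2 * b\<^sup>2)" by (simp add: xe nrm_Qsqrt2)
  have "nrm x \<noteq> 0" using nrm_eq_0 x False by simp
  then have "inverse x = cj x * inverse (nrm x)" using False by (simp add: nrm_cj field_simps)
  also have "\<dots> = cj x * (of_rat (inverse (a\<^sup>2 - 2 * b\<^sup>2)) + of_rat 0 * sqrt 2)"
    by (simp add: n of_rat_inverse)
  also have "\<dots> \<in> Qsqrt2" using x Qsqrt2I cj_Qsqrt2_closed Qsqrt2_mult by blast
  finally show ?thesis .
next
  case True
  then show ?thesis using Zsqrt2_Qsqrt2[OF Zsqrt2_0] by simp
qed

lemma Qsqrt2_divide [simp]: "x \<in> Qsqrt2 \<Longrightarrow> y \<in> Qsqrt2 \<Longrightarrow> x / y \<in> Qsqrt2"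
  by (simp add: divide_inverse)

lemma cj_divide: "x \<in> Qsqrt2 \<Longrightarrow> y \<in> Qsqrt2 \<Longrightarrow> cj (x / y) = cj x / cj y"
proof (cases "y = 0")
  case False
  assume "x \<in> Qsqrt2" "y \<in> Qsqrt2"
  then have "cj x = cj (x / y) * cj y" using cj_mult[of "x / y" y] False by simp
  then show ?thesis using cj_eq_0[of y] False \<open>y \<in> Qsqrt2\<close> by simp
qed simp

lemma nrm_divide: "x \<in> Qsqrt2 \<Longrightarrow> y \<in> Qsqrt2 \<Longrightarrow> nrm (x / y) = nrm x / nrm y"
  by (simp add: nrm_cj cj_divide)

text \<open>Norm-Euclidean division: round both coordinates of the quotient.\<close>

lemma Zsqrt2_euclid:
  assumes "a \<in> Zsqrt2" "b \<in> Zsqrt2" "b \<noteq> 0"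
  obtains q where "q \<in> Zsqrt2" "\<bar>nrm (a - q * b)\<bar> < \<bar>nrm b\<bar>"
proof -
  have "a / b \<in> Qsqrt2" using assms by simp
  then obtain x y where xy: "a / b = of_rat x + of_rat y * sqrt 2" by (elim Qsqrt2E)
  define e f where "e = x - of_int (round x)" and "f = y - of_int (round y)"
  define q where "q = of_int (round x) + of_int (round y) * sqrt 2"
  have q: "q \<in> Zsqrt2" by (simp add: q_def Zsqrt2I)
  have ef: "a / b - q = of_rat e + of_rat f * sqrt 2"
    by (simp add: xy q_def e_def f_def of_rat_diff algebra_simps)
  have "\<bar>e\<bar> \<le> 1 / 2" "\<bar>f\<bar> \<le> 1 / 2"
    using of_int_round_abs_le[of x] of_int_round_abs_le[of y] by (simp_all add: e_def f_def abs_minus_commute)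
  then have "e\<^sup>2 \<le> 1 / 4" "f\<^sup>2 \<le> 1 / 4"
    using power_mono[of "\<bar>e\<bar>" "1 / 2" 2] power_mono[of "\<bar>f\<bar>" "1 / 2" 2] by (simp_all add: power_divide)
  moreover have "e\<^sup>2 \<ge> 0" "f\<^sup>2 \<ge> 0" by simp_all
  \<comment> \<open>Both squares lie in [0, 1/4], so this norm lies in [-1/2, 1/4].\<close>
  ultimately have "\<bar>e\<^sup>2 - 2 * f\<^sup>2\<bar> < 1" unfolding abs_less_iff by linarith
  then have "\<bar>nrm (a / b - q)\<bar> < 1" unfolding ef nrm_Qsqrt2
    by (metis of_rat_1 of_rat_less abs_of_rat)
  moreover have "a - q * b = (a / b - q) * b" using assms(3) by (simp add: field_simps)
  moreover have "a / b - q \<in> Qsqrt2" unfolding ef by (rule Qsqrt2I)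
  ultimately have "\<bar>nrm (a - q * b)\<bar> < \<bar>nrm b\<bar>"
    using assms nrm_mult[of "a / b - q" b] nrm_eq_0[of b]
    by (simp add: abs_mult mult_less_cancel_right1)
  with q show ?thesis using that by blast
qed

text \<open>A nonzero element of least absolute norm generates, because the remainder of a division
  by it has smaller norm and must vanish. The closure properties are spelled out so that the lemma
  serves both Bezout combinations and ideals of the ring record.\<close>

lemma Zsqrt2_ideal_principal:
  assumes J: "J \<subseteq> Zsqrt2" and diff: "\<And>x y. x \<in> J \<Longrightarrow> y \<in> J \<Longrightarrow> x - y \<in> J"
    and mult: "\<And>r x. r \<in> Zsqrt2 \<Longrightarrow> x \<in> J \<Longrightarrow> r * x \<in> J" and nz: "x0 \<in> J" "x0 \<noteq> 0"
  obtains g where "g \<in> J" "g \<noteq> 0" "\<And>x. x \<in> J \<Longrightarrow> x / g \<in> Zsqrt2"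
proof -
  define f where "f x = nat \<lfloor>\<bar>nrm x\<bar>\<rfloor>" for x
  have f: "real (f x) = \<bar>nrm x\<bar>" if x: "x \<in> J" for x
  proof -
    obtain n :: int where "nrm x = of_int n" using nrm_Ints[of x] J x by (auto elim: Ints_cases)
    then show ?thesis by (simp add: f_def)
  qed
  obtain g where g: "g \<in> J" "g \<noteq> 0" and min: "\<And>y. y \<in> J \<Longrightarrow> y \<noteq> 0 \<Longrightarrow> f g \<le> f y"
    using ex_has_least_nat[of "\<lambda>x. x \<in> J \<and> x \<noteq> 0" x0 f] nz by blast
  have "x / g \<in> Zsqrt2" if x: "x \<in> J" for x
  proof -
    obtain q where q: "q \<in> Zsqrt2" "\<bar>nrm (x - q * g)\<bar> < \<bar>nrm g\<bar>"
      using Zsqrt2_euclid[of x g] J x g by blast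
    have in_J: "x - q * g \<in> J" using q(1) x g(1) diff mult by blast
    have "x - q * g = 0"
      using min[OF in_J] q(2) f[OF in_J] f[OF g(1)] by linarith
    then show ?thesis using q(1) g(2) by (simp add: field_simps)
  qed
  with g that show ?thesis by blast
qed

lemma Zsqrt2_bezout:
  assumes "a \<in> Zsqrt2" "b \<in> Zsqrt2" "a \<noteq> 0"
  obtains g r s where "g \<in> Zsqrt2" "g \<noteq> 0" "a / g \<in> Zsqrt2" "b / g \<in> Zsqrt2"
    "r \<in> Zsqrt2" "s \<in> Zsqrt2" "g = r * a + s * b"
proof -
  define J where "J = {r * a + s * b |r s. r \<in> Zsqrt2 \<and> s \<in> Zsqrt2}"
  have JI: "r * a + s * b \<in> J" if "r \<in> Zsqrt2" "s \<in> Zsqrt2" for r s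
    using that by (auto simp: J_def)
  have sub: "J \<subseteq> Zsqrt2" using assms by (auto simp: J_def)
  have diff: "x - y \<in> J" if xy: "x \<in> J" "y \<in> J" for x y
  proof -
    obtain r s r' s' where "x = r * a + s * b" "y = r' * a + s' * b"
      and z: "r \<in> Zsqrt2" "s \<in> Zsqrt2" "r' \<in> Zsqrt2" "s' \<in> Zsqrt2"
      using xy by (auto simp: J_def)
    then have "x - y = (r - r') * a + (s - s') * b" by (simp add: algebra_simps)
    then show ?thesis using z JI[of "r - r'" "s - s'"] by simp
  qed
  have mult: "t * x \<in> J" if tx: "t \<in> Zsqrt2" "x \<in> J" for t x
  proof -
    obtain r s where "x = r * a + s * b" and z: "r \<in> Zsqrt2" "s \<in> Zsqrt2"
      using tx by (auto simp: J_def)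
    then have "t * x = (t * r) * a + (t * s) * b" by (simp add: algebra_simps)
    then show ?thesis using z tx JI[of "t * r" "t * s"] by simp
  qed
  have ab: "a \<in> J" "b \<in> J" using JI[of 1 0] JI[of 0 1] by simp_all
  obtain g where g: "g \<in> J" "g \<noteq> 0" "\<And>x. x \<in> J \<Longrightarrow> x / g \<in> Zsqrt2"
    using Zsqrt2_ideal_principal[OF sub diff mult ab(1) assms(3)] by metis
  obtain r s where "r \<in> Zsqrt2" "s \<in> Zsqrt2" "g = r * a + s * b" using g(1) by (auto simp: J_def)
  then show ?thesis using g(1,2) g(3)[OF ab(1)] g(3)[OF ab(2)] sub
    by (intro that[of g r s]) auto
qed

text \<open>Coprimality in Bezout form; the coefficients are what the divisibility arguments
  multiply with.\<close>

definition comaximal :: "real \<Rightarrow> real \<Rightarrow> bool" where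
  "comaximal a b \<longleftrightarrow> (\<exists>r\<in>Zsqrt2. \<exists>s\<in>Zsqrt2. r * a + s * b = 1)"

lemma comaximal_sym: "comaximal a b \<Longrightarrow> comaximal b a"
  unfolding comaximal_def by (metis add.commute)

text \<open>The norms of u and 1/u are nonzero integers with product 1. Conversely, norm 1 or -1
  makes the conjugate the inverse up to sign.\<close>

lemma Zsqrt2_unit_iff:
  assumes "u \<in> Zsqrt2" "u \<noteq> 0"
  shows "1 / u \<in> Zsqrt2 \<longleftrightarrow> \<bar>nrm u\<bar> = 1"
proof
  assume "1 / u \<in> Zsqrt2"
  then have "\<bar>nrm (1 / u)\<bar> \<ge> 1" "\<bar>nrm u\<bar> \<ge> 1" using nrm_ge_1 assms by simp_all
  moreover have "nrm (1 / u) * nrm u = 1" using nrm_mult[of "1 / u" u] assms by simp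
  then have "\<bar>nrm (1 / u)\<bar> * \<bar>nrm u\<bar> = 1" by (metis abs_mult abs_1)
  ultimately show "\<bar>nrm u\<bar> = 1"
    by (smt (verit) mult_le_cancel_right1)
next
  assume "\<bar>nrm u\<bar> = 1"
  then have "1 / u = cj u \<or> 1 / u = - cj u"
    using assms by (auto simp: nrm_cj abs_if field_simps split: if_splits)
  then show "1 / u \<in> Zsqrt2" using assms by auto
qed

section \<open>The fundamental unit and normalised generators\<close>

lemma fund_unit_gt_1: "fund_unit > 1"
  by (simp add: fund_unit_def)

lemma fund_unit_Zsqrt2 [simp]: "fund_unit \<in> Zsqrt2"
  using Zsqrt2I[of 1 1] by (simp add: fund_unit_def)

lemma cj_fund_unit: "cj fund_unit = - 1 / fund_unit"
proof -
  have e: "cj fund_unit = 1 - sqrt 2" using cj_Zsqrt2[of 1 1] by (simp add: fund_unit_def)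
  have "(1 - sqrt 2) * fund_unit = - 1" by (simp add: fund_unit_def algebra_simps)
  then show ?thesis unfolding e using fund_unit_gt_1 by (intro eq_divide_imp) auto
qed

lemma nrm_fund_unit: "nrm fund_unit = - 1"
  using fund_unit_gt_1 by (simp add: nrm_cj cj_fund_unit)

lemma inverse_fund_unit_Zsqrt2 [simp]: "1 / fund_unit \<in> Zsqrt2"
  using Zsqrt2_unit_iff[of fund_unit] fund_unit_gt_1 nrm_fund_unit by simp

lemma fund_unit_powi_Zsqrt2 [simp]: "fund_unit powi k \<in> Zsqrt2"
  using inverse_fund_unit_Zsqrt2 by (auto simp: power_int_def inverse_eq_divide simp del: inverse_fund_unit_Zsqrt2)

lemma nrm_fund_unit_powi: "(nrm (fund_unit powi k))\<^sup>2 = 1"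
proof -
  have "fund_unit powi k \<noteq> 0" using fund_unit_gt_1 by simp
  moreover have "1 / fund_unit powi k = fund_unit powi (- k)"
    by (simp add: power_int_minus inverse_eq_divide)
  then have "1 / fund_unit powi k \<in> Zsqrt2" by simp
  ultimately show ?thesis using Zsqrt2_unit_iff[of "fund_unit powi k"] by (simp add: power2_eq_1_iff abs_if split: if_splits)
qed

text \<open>Used twice for different ends: to choose generators of ideals, and to balance the two
  scaling factors of a window.\<close>

lemma fund_unit_normalize:
  assumes "x > 0"
  obtains k where "1 \<le> fund_unit powi k * x" "fund_unit powi k * x < fund_unit"
proof -
  define k where "k = \<lfloor>log fund_unit x\<rfloor>"
  have l: "fund_unit > 0" "fund_unit \<noteq> 1" using fund_unit_gt_1 by auto
  have "fund_unit powr (of_int k) \<le> x" "x < fund_unit powr (of_int k + 1)"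
    using assms fund_unit_gt_1 by (simp_all add: k_def powr_le_iff less_powr_iff)
  then have "fund_unit powi k \<le> x" "x < fund_unit powi k * fund_unit"
    using l by (simp_all add: powr_add powr_real_of_int' )
  then have "1 \<le> fund_unit powi (- k) * x" "fund_unit powi (- k) * x < fund_unit"
    using l by (simp_all add: power_int_minus field_simps)
  then show ?thesis by (rule that)
qed

text \<open>One generator for each nonzero ideal.\<close>

definition Reps :: "real set" where
  "Reps = {a \<in> Zsqrt2. 1 \<le> a \<and> a < fund_unit}"

text \<open>A quotient of two elements of \<open>Reps\<close> that exceeds 1 is still below
  \<open>fund_unit\<close>, and no unit lies strictly between 1 and
  \<open>fund_unit\<close>.\<close>

lemma Reps_unique:
  assumes "a \<in> Reps" "b \<in> Reps" "a / b \<in> Zsqrt2" "b / a \<in> Zsqrt2"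
  shows "a = b"
proof -
  have le: "a \<le> b" if ab: "a \<in> Reps" "b \<in> Reps" "a / b \<in> Zsqrt2" "b / a \<in> Zsqrt2" for a b
  proof (rule ccontr)
    assume "\<not> a \<le> b"
    define u where "u = a / b"
    have u: "u \<in> Zsqrt2" "1 / u \<in> Zsqrt2" "u > 1" using ab \<open>\<not> a \<le> b\<close> by (auto simp: u_def Reps_def)
    have "u < fund_unit"
    proof -
      have b: "1 \<le> b" "a < fund_unit" using ab by (auto simp: Reps_def)
      then have "fund_unit * 1 \<le> fund_unit * b" using fund_unit_gt_1 by (intro mult_left_mono) auto
      then have "a < fund_unit * b" using b by linarith
      then show ?thesis using b by (simp add: u_def divide_less_eq)
    qed
    have "\<bar>u * cj u\<bar> = 1" using Zsqrt2_unit_iff[of u] u by (simp add: nrm_cj)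
    then have cju: "\<bar>cj u\<bar> = 1 / u" using u(3) by (simp add: abs_mult field_simps)
    obtain m n :: int where mn: "u = m + n * sqrt 2" using u(1) by (rule Zsqrt2E)
    then have cj: "cj u = m - n * sqrt 2" by (simp add: cj_Zsqrt2)
    have lt: "\<bar>cj u\<bar> < 1" using cju u(3) by simp
    \<comment> \<open>As u > 1 > |cj u|, the sum and the difference of u and its conjugate are both
      positive. So both integer coordinates are at least 1, which forces u >= 1 + sqrt 2.\<close>
    have "2 * (n * sqrt 2) = u - cj u" "2 * real_of_int m = u + cj u" using mn cj by simp_all
    then have n: "n * sqrt 2 > 0" and m: "real_of_int m > 0" "2 * real_of_int m < 2 + sqrt 2"
      using u(3) lt \<open>u < fund_unit\<close> by (auto simp: fund_unit_def)
    have "n \<ge> 1" using n by (simp add: zero_less_mult_iff)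
    moreover have "m \<ge> 1" using m by simp
    ultimately have "u \<ge> fund_unit"
      unfolding mn fund_unit_def by (intro add_mono) (auto simp: mult_le_cancel_right1)
    with \<open>u < fund_unit\<close> show False by simp
  qed
  show ?thesis using le[of a b] le[of b a] assms by simp
qed

lemma Reps_exist:
  assumes "x \<in> Zsqrt2" "x \<noteq> 0"
  obtains a where "a \<in> Reps" "a / x \<in> Zsqrt2" "x / a \<in> Zsqrt2"
proof -
  obtain k where k: "1 \<le> fund_unit powi k * \<bar>x\<bar>" "fund_unit powi k * \<bar>x\<bar> < fund_unit"
    using assms fund_unit_normalize[of "\<bar>x\<bar>"] by auto
  let ?a = "fund_unit powi k * \<bar>x\<bar>"
  have "?a \<in> Reps" using k assms by (auto simp: Reps_def abs_if)
  moreover have "?a / x \<in> Zsqrt2" using assms by (auto simp: abs_if)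
  moreover have "x / ?a = sgn x * fund_unit powi (- k)"
    using assms by (simp add: power_int_minus field_simps abs_if sgn_if)
  then have "x / ?a \<in> Zsqrt2" by (simp add: sgn_if)
  ultimately show ?thesis by (rule that)
qed

subsection \<open>Primes\<close>

abbreviation "RZ \<equiv> induced_ring Zsqrt2"

lemma RZ_simps: "carrier RZ = Zsqrt2" "mult RZ = (*)" "one RZ = 1" "zero RZ = 0" "add RZ = (+)"
  by (simp_all add: induced_ring_def)

lemma divides_RZ:
  assumes "a \<noteq> 0" shows "a divides\<^bsub>RZ\<^esub> b \<longleftrightarrow> b / a \<in> Zsqrt2"
proof
  assume "b / a \<in> Zsqrt2"
  then show "a divides\<^bsub>RZ\<^esub> b" using assms
    unfolding factor_def RZ_simps by (intro bexI[of _ "b / a"]) simp_all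
qed (use assms in \<open>auto simp: factor_def RZ_simps\<close>)

lemma Units_RZ: "u \<in> Units RZ \<longleftrightarrow> u \<in> Zsqrt2 \<and> u \<noteq> 0 \<and> 1 / u \<in> Zsqrt2"
proof
  assume "u \<in> Units RZ"
  then obtain v where "u \<in> Zsqrt2" "v \<in> Zsqrt2" "v * u = 1" by (auto simp: Units_def RZ_simps)
  then show "u \<in> Zsqrt2 \<and> u \<noteq> 0 \<and> 1 / u \<in> Zsqrt2"
    by (metis mult_zero_right nonzero_mult_div_cancel_right zero_neq_one)
next
  assume "u \<in> Zsqrt2 \<and> u \<noteq> 0 \<and> 1 / u \<in> Zsqrt2"
  then show "u \<in> Units RZ" unfolding Units_def RZ_simps by (auto intro!: bexI[of _ "1 / u"])
qed

lemma PP_D: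
  assumes "p \<in> PP"
  shows "p \<in> Zsqrt2" "1 < p" "p < fund_unit" "p \<noteq> 0" "p \<in> Reps" "1 / p \<notin> Zsqrt2" "p \<in> Qsqrt2"
  using assms by (auto simp: PP_def Reps_def ring_prime_def prime_def Units_RZ)

lemma PP_dvd_mult:
  assumes "p \<in> PP" "a \<in> Zsqrt2" "b \<in> Zsqrt2" "a * b / p \<in> Zsqrt2"
  shows "a / p \<in> Zsqrt2 \<or> b / p \<in> Zsqrt2"
proof -
  have "prime RZ p" using assms(1) by (simp add: PP_def ring_prime_def)
  then show ?thesis
    using assms unfolding prime_def RZ_simps divides_RZ[OF PP_D(4)[OF assms(1)]] by blast
qed

text \<open>A gcd g of p and a splits p as g * (p / g), and p divides one of the factors. If it
  divided g it would divide a; so it divides p / g, and g is a unit.\<close>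

lemma PP_comaximal:
  assumes p: "p \<in> PP" and a: "a \<in> Zsqrt2" "a / p \<notin> Zsqrt2"
  shows "comaximal p a"
proof -
  note pp = PP_D[OF p]
  obtain g r s where g: "g \<in> Zsqrt2" "g \<noteq> 0" "p / g \<in> Zsqrt2" "a / g \<in> Zsqrt2"
    and rs: "r \<in> Zsqrt2" "s \<in> Zsqrt2" "g = r * p + s * a"
    using Zsqrt2_bezout[OF pp(1) a(1) pp(4)] by metis
  have "g / p \<in> Zsqrt2 \<or> (p / g) / p \<in> Zsqrt2"
    using PP_dvd_mult[OF p g(1,3)] g(2) pp by simp
  moreover have "g / p \<notin> Zsqrt2"
  proof
    assume "g / p \<in> Zsqrt2"
    then have "(a / g) * (g / p) \<in> Zsqrt2" using g(4) Zsqrt2_mult by blast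
    then show False using a(2) g(2) by simp
  qed
  ultimately have u: "1 / g \<in> Zsqrt2" using pp by simp
  have "(1 / g * r) * p + (1 / g * s) * a = (r * p + s * a) / g" by (simp add: add_divide_distrib)
  then have "(1 / g * r) * p + (1 / g * s) * a = 1" using rs(3) g(2) by simp
  then show ?thesis using u rs Zsqrt2_mult unfolding comaximal_def by blast
qed

text \<open>A nonunit divisor d of least absolute norm is prime, because a gcd of d with any u is
  either a unit or an associate of d. The associate of d in \<open>Reps\<close> is not 1, hence lies
  in the open interval required by \<open>PP\<close>.\<close>

lemma PP_divisor_exists:
  assumes a: "a \<in> Zsqrt2" "a \<noteq> 0" "1 / a \<notin> Zsqrt2"
  obtains p where "p \<in> PP" "a / p \<in> Zsqrt2"
proof -
  define P where "P d \<longleftrightarrow> d \<in> Zsqrt2 \<and> d \<noteq> 0 \<and> 1 / d \<notin> Zsqrt2 \<and> a / d \<in> Zsqrt2" for d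
  define f where "f x = nat \<lfloor>\<bar>nrm x\<bar>\<rfloor>" for x
  have f: "real (f x) = \<bar>nrm x\<bar>" if x: "x \<in> Zsqrt2" for x
  proof -
    obtain n :: int where "nrm x = of_int n" using nrm_Ints[of x] x by (auto elim: Ints_cases)
    then show ?thesis by (simp add: f_def)
  qed
  have "P a" using a by (simp add: P_def)
  then obtain d where d: "P d" and min: "\<And>y. P y \<Longrightarrow> f d \<le> f y"
    using ex_has_least_nat[of P a f] by blast
  then have dZ: "d \<in> Zsqrt2" "d \<noteq> 0" "1 / d \<notin> Zsqrt2" "a / d \<in> Zsqrt2" by (auto simp: P_def)
  have prime: "u / d \<in> Zsqrt2 \<or> v / d \<in> Zsqrt2"
    if uv: "u \<in> Zsqrt2" "v \<in> Zsqrt2" "u * v / d \<in> Zsqrt2" for u v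
  proof -
    obtain g r s where g: "g \<in> Zsqrt2" "g \<noteq> 0" "d / g \<in> Zsqrt2" "u / g \<in> Zsqrt2"
      and rs: "r \<in> Zsqrt2" "s \<in> Zsqrt2" "g = r * d + s * u"
      using Zsqrt2_bezout[OF dZ(1) uv(1) dZ(2)] by metis
    show ?thesis
    proof (cases "1 / g \<in> Zsqrt2")
      case True
      have "v / d = (r * d + s * u) * v / (g * d)" using rs(3) g(2) by simp
      also have "\<dots> = 1 / g * (r * v + s * (u * v / d))"
        using g(2) dZ(2) by (simp add: field_simps)
      also have "\<dots> \<in> Zsqrt2" using True rs uv by (intro Zsqrt2_mult Zsqrt2_add)
      finally show ?thesis by simp
    next
      case False
      have "(a / d) * (d / g) \<in> Zsqrt2" using dZ g by (intro Zsqrt2_mult)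
      then have "P g" using False g dZ by (simp add: P_def)
      then have le: "\<bar>nrm d\<bar> \<le> \<bar>nrm g\<bar>" using min f g(1) dZ(1) by (metis of_nat_le_iff)
      have n: "nrm d = nrm (d / g) * nrm g" using nrm_mult[of "d / g" g] g dZ by simp
      have "\<bar>nrm (d / g)\<bar> \<ge> 1" using nrm_ge_1[of "d / g"] g dZ by simp
      moreover have "\<bar>nrm (d / g)\<bar> \<le> 1"
        using le nrm_ge_1[OF g(1,2)] unfolding n abs_mult by (simp add: mult_le_cancel_right2)
      ultimately have "1 / (d / g) \<in> Zsqrt2" using Zsqrt2_unit_iff[of "d / g"] g dZ by simp
      then have "(u / g) * (g / d) \<in> Zsqrt2" using g by (intro Zsqrt2_mult) simp_all
      then show ?thesis using g by simp
    qed
  qed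
  obtain p where p: "p \<in> Reps" "p / d \<in> Zsqrt2" "d / p \<in> Zsqrt2" using Reps_exist dZ by blast
  then have pZ: "p \<in> Zsqrt2" "p \<noteq> 0" by (auto simp: Reps_def)
  have np: "1 / p \<notin> Zsqrt2"
  proof
    assume "1 / p \<in> Zsqrt2"
    then have "1 / p * (p / d) \<in> Zsqrt2" using p by (intro Zsqrt2_mult)
    then show False using dZ pZ by simp
  qed
  have dvd: "x / p \<in> Zsqrt2 \<longleftrightarrow> x / d \<in> Zsqrt2" for x
    using Zsqrt2_mult[of "x / p" "p / d"] Zsqrt2_mult[of "x / d" "d / p"] p pZ dZ by auto
  have "p \<noteq> 1" using np by auto
  moreover have "ring_prime\<^bsub>RZ\<^esub> p"
    using pZ np prime unfolding ring_prime_def prime_def Units_RZ RZ_simps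
    by (auto simp: divides_RZ[OF pZ(2)] dvd)
  ultimately have "p \<in> PP" using p by (auto simp: PP_def Reps_def)
  then show ?thesis using dvd dZ(4) by (intro that[of p]) auto
qed

text \<open>Multiply the Bezout identity r * a + s * b = 1 by x / (a * b).\<close>

lemma comaximal_dvd_mult:
  assumes "comaximal a b" "x / a \<in> Zsqrt2" "x / b \<in> Zsqrt2" "a \<noteq> 0" "b \<noteq> 0"
  shows "x / (a * b) \<in> Zsqrt2"
proof -
  obtain r s where rs: "r \<in> Zsqrt2" "s \<in> Zsqrt2" "r * a + s * b = 1" using assms by (auto simp: comaximal_def)
  have "x / (a * b) = (r * a + s * b) * (x / (a * b))" using rs(3) by simp
  also have "\<dots> = r * (x / b) + s * (x / a)" using assms by (simp add: field_simps)
  also have "\<dots> \<in> Zsqrt2" using rs assms by (intro Zsqrt2_add Zsqrt2_mult)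
  finally show ?thesis .
qed

lemma comaximal_if_relatively_prime:
  assumes "relatively_prime RZ a b" "a \<in> Zsqrt2" "b \<in> Zsqrt2" "b \<noteq> 0"
  shows "comaximal a b"
proof -
  obtain g r s where g: "g \<in> Zsqrt2" "g \<noteq> 0" "b / g \<in> Zsqrt2" "a / g \<in> Zsqrt2"
    and rs: "r \<in> Zsqrt2" "s \<in> Zsqrt2" "g = r * b + s * a"
    using Zsqrt2_bezout[OF assms(3,2,4)] by metis
  have "g \<in> Units RZ" using assms(1) g by (auto simp: relatively_prime_def RZ_simps divides_RZ)
  then have u: "1 / g \<in> Zsqrt2" by (simp add: Units_RZ)
  have "(1 / g * s) * a + (1 / g * r) * b = (r * b + s * a) / g" by (simp add: add_divide_distrib)
  then have "(1 / g * s) * a + (1 / g * r) * b = 1" using rs(3) g(2) by simp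
  then show ?thesis using u rs Zsqrt2_mult unfolding comaximal_def by blast
qed

text \<open>Cancel a gcd. Existence matters because least common multiples are taken over the set of
  all numerators: an element without a numerator would impose no condition there.\<close>

lemma numerator_exists:
  assumes "c = x / y" "x \<in> Zsqrt2" "y \<in> Zsqrt2" "x \<noteq> 0" "y \<noteq> 0"
  obtains a where "is_numerator c a"
proof -
  obtain g r s where g: "g \<in> Zsqrt2" "g \<noteq> 0" "x / g \<in> Zsqrt2" "y / g \<in> Zsqrt2"
    and rs: "r \<in> Zsqrt2" "s \<in> Zsqrt2" "g = r * x + s * y"
    using Zsqrt2_bezout[OF assms(2,3,4)] by metis
  have "relatively_prime RZ (x / g) (y / g)"
    unfolding relatively_prime_def RZ_simps
  proof (intro ballI impI)
    fix d assume d: "d \<in> Zsqrt2" "d divides\<^bsub>RZ\<^esub> x / g \<and> d divides\<^bsub>RZ\<^esub> y / g"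
    have nz: "d \<noteq> 0" using d assms g by (auto simp: factor_def RZ_simps)
    have "r * (x / g / d) + s * (y / g / d) \<in> Zsqrt2"
      using d nz rs by (intro Zsqrt2_add Zsqrt2_mult) (simp_all only: divides_RZ[OF nz])
    moreover have "r * (x / g / d) + s * (y / g / d) = 1 / d"
    proof -
      have "r * (x / g / d) + s * (y / g / d) = (r * x + s * y) / g / d"
        by (simp add: add_divide_distrib)
      then show ?thesis using rs(3) g(2) by simp
    qed
    ultimately show "d \<in> Units RZ" using d nz by (simp add: Units_RZ)
  qed
  then have "is_numerator c (x / g)"
    using g assms unfolding is_numerator_def by (intro conjI bexI[of _ "y / g"]) auto
  then show ?thesis by (rule that)
qed

section \<open>Counting lattice points in scaled windows\<close>

text \<open>Elimination on the coefficient matrix: for fixed y substitute u = a x + b y, which turns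
  the second argument into (c / a) u + D y with D the determinant divided by a. After exchanging the
  integrals, y is rescaled by D.\<close>

lemma nn_integral_linear_change_2:
  fixes f g :: "real \<Rightarrow> ennreal"
  assumes [measurable]: "f \<in> borel_measurable borel" "g \<in> borel_measurable borel"
    and a: "a \<noteq> 0" and det: "a * d - b * c \<noteq> 0"
  shows "ennreal \<bar>a * d - b * c\<bar> * (\<integral>\<^sup>+y. \<integral>\<^sup>+x. f (a * x + b * y) * g (c * x + d * y) \<partial>lborel \<partial>lborel)
    = (\<integral>\<^sup>+x. f x \<partial>lborel) * (\<integral>\<^sup>+y. g y \<partial>lborel)"
proof -
  define D where "D = (a * d - b * c) / a"
  have D: "D \<noteq> 0" using a det by (simp add: D_def)
  have inner: "ennreal \<bar>a\<bar> * (\<integral>\<^sup>+x. f (a * x + b * y) * g (c * x + d * y) \<partial>lborel)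
      = (\<integral>\<^sup>+u. f u * g (c / a * u + D * y) \<partial>lborel)" for y
  proof -
    have e: "c / a * (b * y + a * x) + D * y = c * x + d * y" for x
      using a by (simp add: D_def field_simps)
    show ?thesis
      by (subst nn_integral_real_affine[where f = "\<lambda>u. f u * g (c / a * u + D * y)", OF _ a, of "b * y"])
         (simp, simp only: e, simp only: add.commute[of "b * y"])
  qed
  have "(\<integral>\<^sup>+y. \<integral>\<^sup>+u. f u * g (c / a * u + D * y) \<partial>lborel \<partial>lborel)
      = (\<integral>\<^sup>+u. \<integral>\<^sup>+y. f u * g (c / a * u + D * y) \<partial>lborel \<partial>lborel)"
    by (rule lborel_pair.Fubini'[symmetric]) measurable
  also have "\<dots> = (\<integral>\<^sup>+u. f u * (\<integral>\<^sup>+y. g (c / a * u + D * y) \<partial>lborel) \<partial>lborel)"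
    by (intro nn_integral_cong nn_integral_cmult) measurable
  finally have "ennreal \<bar>D\<bar> * (\<integral>\<^sup>+y. \<integral>\<^sup>+u. f u * g (c / a * u + D * y) \<partial>lborel \<partial>lborel)
      = ennreal \<bar>D\<bar> * (\<integral>\<^sup>+u. f u * (\<integral>\<^sup>+y. g (c / a * u + D * y) \<partial>lborel) \<partial>lborel)" by simp
  also have "\<dots> = (\<integral>\<^sup>+u. f u * (ennreal \<bar>D\<bar> * (\<integral>\<^sup>+y. g (c / a * u + D * y) \<partial>lborel)) \<partial>lborel)"
    by (subst nn_integral_cmult[symmetric]) (measurable, simp add: mult_ac)
  also have "\<dots> = (\<integral>\<^sup>+u. f u * (\<integral>\<^sup>+y. g y \<partial>lborel) \<partial>lborel)"
    using nn_integral_real_affine[of g, OF _ D] by simp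
  also have "\<dots> = (\<integral>\<^sup>+x. f x \<partial>lborel) * (\<integral>\<^sup>+y. g y \<partial>lborel)"
    by (rule nn_integral_multc) measurable
  finally have main: "ennreal \<bar>D\<bar> * (\<integral>\<^sup>+y. \<integral>\<^sup>+u. f u * g (c / a * u + D * y) \<partial>lborel \<partial>lborel)
      = (\<integral>\<^sup>+x. f x \<partial>lborel) * (\<integral>\<^sup>+y. g y \<partial>lborel)" .
  have "(\<integral>\<^sup>+y. \<integral>\<^sup>+u. f u * g (c / a * u + D * y) \<partial>lborel \<partial>lborel)
      = ennreal \<bar>a\<bar> * (\<integral>\<^sup>+y. \<integral>\<^sup>+x. f (a * x + b * y) * g (c * x + d * y) \<partial>lborel \<partial>lborel)"
    unfolding inner[symmetric] by (rule nn_integral_cmult) measurable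
  moreover have "ennreal \<bar>a * d - b * c\<bar> = ennreal \<bar>D\<bar> * ennreal \<bar>a\<bar>"
    using a by (simp add: D_def abs_mult flip: ennreal_mult)
  ultimately show ?thesis using main by (simp add: mult.assoc)
qed

section \<open>The covolume of the embedded ring Z[zeta]\<close>

lemma box_Pair_eq: "box (a, c) (b, d) = box a b \<times> box c d"
  by (auto simp: box_def Basis_prod_def ball_Un)

lemma mem_box_complex_iff: "z \<in> box l u \<longleftrightarrow> Re l < Re z \<and> Re z < Re u \<and> Im l < Im z \<and> Im z < Im u"
  by (auto simp: box_def Basis_complex_def)

lemma emeasure_complex_box:
  "emeasure lborel (box l u :: complex set)
    = emeasure lborel {Re l<..<Re u} * emeasure lborel {Im l<..<Im u}"
  by (auto simp: emeasure_lborel_box_eq Basis_complex_def ennreal_mult inner_diff_left)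

text \<open>The diagonal embedding \<open>x \<mapsto> (\<alpha> x, \<beta> \<sigma>(x))\<close>, in the coordinates \<open>((b, d), (a, c))\<close> of
  \<open>x = a + b \<zeta> + c \<zeta>\<^sup>2 + d \<zeta>\<^sup>3\<close>.\<close>

definition emb8 :: "real \<Rightarrow> real \<Rightarrow> (real \<times> real) \<times> real \<times> real \<Rightarrow> complex \<times> complex" where
  "emb8 \<alpha> \<beta> = (\<lambda>((b, d), (a, c)).
    (\<alpha> *\<^sub>R Complex (a + (b - d) * (sqrt 2 / 2)) (c + (b + d) * (sqrt 2 / 2)),
     \<beta> *\<^sub>R Complex (a - (b - d) * (sqrt 2 / 2)) (- c + (b + d) * (sqrt 2 / 2))))"

lemma emb8_measurable [measurable]: "emb8 \<alpha> \<beta> \<in> borel_measurable borel"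
  unfolding emb8_def case_prod_beta' Complex_eq
  by (intro borel_measurable_continuous_onI continuous_intros)

text \<open>In terms of p = b - d and q = b + d, both real parts depend only on (a, p) and both
  imaginary parts only on (c, q). This is why \<open>emb8\<close> groups b with d and a with c. The
  change from (b, d) to (p, q) has determinant 2, and each of the two remaining planar maps has
  determinant sqrt 2 * \<alpha> * \<beta> up to sign.\<close>

lemma emeasure_emb8_box:
  assumes \<alpha>: "\<alpha> \<noteq> 0" and \<beta>: "\<beta> \<noteq> 0"
  shows "ennreal (4 * \<alpha>\<^sup>2 * \<beta>\<^sup>2) * emeasure lborel (emb8 \<alpha> \<beta> -` box l u) = emeasure lborel (box l u)"
proof -
  obtain l1 l2 u1 u2 where lu: "l = (l1, l2)" "u = (u1, u2)" by (cases l, cases u)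
  define h where "h = sqrt 2 / 2"
  have h: "h > 0" by (simp add: h_def)
  have [measurable]: "{x<..<y} \<in> sets borel" for x y :: real by simp
  define I1 I2 J1 J2 :: "real \<Rightarrow> ennreal"
    where "I1 = indicator {Re l1<..<Re u1}" and "I2 = indicator {Im l1<..<Im u1}"
      and "J1 = indicator {Re l2<..<Re u2}" and "J2 = indicator {Im l2<..<Im u2}"
  have [measurable]: "I1 \<in> borel_measurable borel" "I2 \<in> borel_measurable borel"
    "J1 \<in> borel_measurable borel" "J2 \<in> borel_measurable borel"
    unfolding I1_def I2_def J1_def J2_def by measurable
  define G where "G p = (\<integral>\<^sup>+a. I1 (\<alpha> * a + \<alpha> * h * p) * J1 (\<beta> * a + (- (\<beta> * h)) * p) \<partial>lborel)" for p
  define H where "H q = (\<integral>\<^sup>+c. I2 (\<alpha> * c + \<alpha> * h * q) * J2 ((- \<beta>) * c + \<beta> * h * q) \<partial>lborel)" for q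
  have [measurable]: "G \<in> borel_measurable borel" "H \<in> borel_measurable borel"
    unfolding G_def H_def by measurable
  have boxeq: "indicator (emb8 \<alpha> \<beta> -` box l u) ((b, d), (a, c)) =
      (I1 (\<alpha> * a + \<alpha> * h * (b - d)) * J1 (\<beta> * a + (- (\<beta> * h)) * (b - d))) *
      (I2 (\<alpha> * c + \<alpha> * h * (b + d)) * J2 ((- \<beta>) * c + \<beta> * h * (b + d)))" for a b c d
    by (auto simp: lu emb8_def I1_def I2_def J1_def J2_def box_Pair_eq mem_box_complex_iff
        algebra_simps h_def[symmetric] split: split_indicator)
  have ms: "emb8 \<alpha> \<beta> -` box l u \<in> sets borel"
    using measurable_sets_borel[OF emb8_measurable, of "box l u"] by simp
  have inner: "(\<integral>\<^sup>+ac. indicator (emb8 \<alpha> \<beta> -` box l u) ((b, d), ac) \<partial>lborel) = G (b - d) * H (b + d)" for b d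
  proof -
    have "(\<integral>\<^sup>+ac. indicator (emb8 \<alpha> \<beta> -` box l u) ((b, d), ac) \<partial>lborel)
        = (\<integral>\<^sup>+ac. (case ac of (a, c) \<Rightarrow> (I1 (\<alpha> * a + \<alpha> * h * (b - d)) * J1 (\<beta> * a + (- (\<beta> * h)) * (b - d))) *
      (I2 (\<alpha> * c + \<alpha> * h * (b + d)) * J2 ((- \<beta>) * c + \<beta> * h * (b + d)))) \<partial>(lborel \<Otimes>\<^sub>M lborel))"
      unfolding lborel_prod by (intro nn_integral_cong) (auto simp: boxeq split: prod.split)
    also have "\<dots> = (\<integral>\<^sup>+a. \<integral>\<^sup>+c. (I1 (\<alpha> * a + \<alpha> * h * (b - d)) * J1 (\<beta> * a + (- (\<beta> * h)) * (b - d))) *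
      (I2 (\<alpha> * c + \<alpha> * h * (b + d)) * J2 ((- \<beta>) * c + \<beta> * h * (b + d))) \<partial>lborel \<partial>lborel)"
      by (subst lborel.nn_integral_fst[symmetric]) auto
    also have "\<dots> = (\<integral>\<^sup>+a. (I1 (\<alpha> * a + \<alpha> * h * (b - d)) * J1 (\<beta> * a + (- (\<beta> * h)) * (b - d))) * H (b + d) \<partial>lborel)"
      unfolding H_def by (intro nn_integral_cong nn_integral_cmult) measurable
    also have "\<dots> = G (b - d) * H (b + d)"
      unfolding G_def by (rule nn_integral_multc) measurable
    finally show ?thesis .
  qed
  have "emeasure lborel (emb8 \<alpha> \<beta> -` box l u) = (\<integral>\<^sup>+v. indicator (emb8 \<alpha> \<beta> -` box l u) v \<partial>lborel)"
    using ms by simp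
  also have "\<dots> = (\<integral>\<^sup>+bd. \<integral>\<^sup>+ac. indicator (emb8 \<alpha> \<beta> -` box l u) (bd, ac) \<partial>lborel \<partial>lborel)"
    using ms unfolding lborel_prod[symmetric, where 'a = "real \<times> real" and 'b = "real \<times> real"]
    by (subst lborel.nn_integral_fst[symmetric]) (auto simp: lborel_prod)
  also have "\<dots> = (\<integral>\<^sup>+bd. (case bd of (b, d) \<Rightarrow> G (b - d) * H (b + d)) \<partial>(lborel \<Otimes>\<^sub>M lborel))"
    unfolding lborel_prod by (intro nn_integral_cong) (auto simp: inner split: prod.split)
  also have "\<dots> = (\<integral>\<^sup>+d. \<integral>\<^sup>+b. G (b - d) * H (b + d) \<partial>lborel \<partial>lborel)"
    by (subst lborel_pair.nn_integral_snd[symmetric]) auto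
  finally have vol: "emeasure lborel (emb8 \<alpha> \<beta> -` box l u) = (\<integral>\<^sup>+d. \<integral>\<^sup>+b. G (b - d) * H (b + d) \<partial>lborel \<partial>lborel)" .
  have GH: "ennreal 2 * emeasure lborel (emb8 \<alpha> \<beta> -` box l u) = (\<integral>\<^sup>+p. G p \<partial>lborel) * (\<integral>\<^sup>+q. H q \<partial>lborel)"
    unfolding vol using nn_integral_linear_change_2[of G H 1 1 "-1" 1] by simp
  have k': "\<alpha> * (- (\<beta> * h)) - \<alpha> * h * \<beta> = - (sqrt 2 * (\<alpha> * \<beta>))" "\<alpha> * (\<beta> * h) - \<alpha> * h * (- \<beta>) = sqrt 2 * (\<alpha> * \<beta>)"
    by (simp_all add: h_def)
  then have nz: "\<alpha> * (- (\<beta> * h)) - \<alpha> * h * \<beta> \<noteq> 0" "\<alpha> * (\<beta> * h) - \<alpha> * h * (- \<beta>) \<noteq> 0"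
    using \<alpha> \<beta> h by simp_all
  have k: "\<bar>\<alpha> * (- (\<beta> * h)) - \<alpha> * h * \<beta>\<bar> = sqrt 2 * \<bar>\<alpha> * \<beta>\<bar>" "\<bar>\<alpha> * (\<beta> * h) - \<alpha> * h * (- \<beta>)\<bar> = sqrt 2 * \<bar>\<alpha> * \<beta>\<bar>"
    unfolding k' by (simp_all add: abs_mult)
  have G: "ennreal (sqrt 2 * \<bar>\<alpha> * \<beta>\<bar>) * (\<integral>\<^sup>+p. G p \<partial>lborel) = (\<integral>\<^sup>+x. I1 x \<partial>lborel) * (\<integral>\<^sup>+x. J1 x \<partial>lborel)"
    unfolding G_def k(1)[symmetric] using \<alpha> nz(1) by (intro nn_integral_linear_change_2) auto
  have H: "ennreal (sqrt 2 * \<bar>\<alpha> * \<beta>\<bar>) * (\<integral>\<^sup>+p. H p \<partial>lborel) = (\<integral>\<^sup>+x. I2 x \<partial>lborel) * (\<integral>\<^sup>+x. J2 x \<partial>lborel)"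
    unfolding H_def k(2)[symmetric] using \<alpha> nz(2) by (intro nn_integral_linear_change_2) auto
  have c: "ennreal (4 * \<alpha>\<^sup>2 * \<beta>\<^sup>2) = ennreal (sqrt 2 * \<bar>\<alpha> * \<beta>\<bar>) * ennreal (sqrt 2 * \<bar>\<alpha> * \<beta>\<bar>) * ennreal 2"
  proof -
    have "4 * \<alpha>\<^sup>2 * \<beta>\<^sup>2 = (sqrt 2 * \<bar>\<alpha> * \<beta>\<bar>)\<^sup>2 * 2" by (simp add: power_mult_distrib)
    then show ?thesis by (simp only: power2_eq_square[of "sqrt 2 * \<bar>\<alpha> * \<beta>\<bar>"]) (simp add: ennreal_mult)
  qed
  have "ennreal (4 * \<alpha>\<^sup>2 * \<beta>\<^sup>2) * emeasure lborel (emb8 \<alpha> \<beta> -` box l u)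
      = (ennreal (sqrt 2 * \<bar>\<alpha> * \<beta>\<bar>) * (\<integral>\<^sup>+p. G p \<partial>lborel)) * (ennreal (sqrt 2 * \<bar>\<alpha> * \<beta>\<bar>) * (\<integral>\<^sup>+q. H q \<partial>lborel))"
    unfolding c unfolding mult.assoc GH by (simp add: mult_ac)
  also have "\<dots> = emeasure lborel (box l1 u1) * emeasure lborel (box l2 u2)"
    unfolding G H emeasure_complex_box I1_def I2_def J1_def J2_def by (simp add: mult_ac)
  also have "\<dots> = emeasure lborel (box l u)"
    unfolding lu box_Pair_eq lborel_prod[symmetric, where 'a = complex and 'b = complex]
    by (simp add: lborel.emeasure_pair_measure_Times)
  finally show ?thesis .
qed

text \<open>Uniqueness of Lebesgue measure: the rescaled image measure agrees with
  \<open>lborel\<close> on boxes, hence on all Borel sets.\<close>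

lemma emeasure_emb8:
  assumes "\<alpha> \<noteq> 0" "\<beta> \<noteq> 0" "S \<in> sets borel"
  shows "ennreal (4 * \<alpha>\<^sup>2 * \<beta>\<^sup>2) * emeasure lborel (emb8 \<alpha> \<beta> -` S) = emeasure lborel S"
proof -
  define M where "M = scale_measure (ennreal (4 * \<alpha>\<^sup>2 * \<beta>\<^sup>2)) (distr lborel borel (emb8 \<alpha> \<beta>))"
  have M: "emeasure M T = ennreal (4 * \<alpha>\<^sup>2 * \<beta>\<^sup>2) * emeasure lborel (emb8 \<alpha> \<beta> -` T)" if "T \<in> sets borel" for T
    using that by (simp add: M_def emeasure_distr)
  have "lborel = M"
  proof (rule lborel_eqI)
    fix l u :: "complex \<times> complex"
    assume "\<And>b. b \<in> Basis \<Longrightarrow> l \<bullet> b \<le> u \<bullet> b"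
    then have "emeasure lborel (box l u) = (\<Prod>b\<in>Basis. (u - l) \<bullet> b)" by simp
    then show "emeasure M (box l u) = (\<Prod>b\<in>Basis. (u - l) \<bullet> b)"
      using M emeasure_emb8_box[OF assms(1,2)] by simp
  qed (simp add: M_def)
  then show ?thesis using M[OF assms(3)] by simp
qed

section \<open>Unit cells and boundary collars\<close>

definition floor8 :: "(real \<times> real) \<times> real \<times> real \<Rightarrow> (int \<times> int) \<times> int \<times> int" where
  "floor8 = (\<lambda>((b, d), (a, c)). ((\<lfloor>b\<rfloor>, \<lfloor>d\<rfloor>), (\<lfloor>a\<rfloor>, \<lfloor>c\<rfloor>)))"

definition of_int8 :: "(int \<times> int) \<times> int \<times> int \<Rightarrow> (real \<times> real) \<times> real \<times> real" where
  "of_int8 = (\<lambda>((b, d), (a, c)). ((of_int b, of_int d), (of_int a, of_int c)))"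

lemma emeasure_floor8_singleton:
  fixes n :: "(int \<times> int) \<times> int \<times> int"
  shows "floor8 -` {n} \<in> sets borel" "emeasure lborel (floor8 -` {n}) = 1"
proof -
  obtain b d a c where n: "n = ((b, d), (a, c))" by (metis surj_pair)
  define I where "I x = {real_of_int x..<of_int x + 1}" for x
  have eq: "floor8 -` {n} = (I b \<times> I d) \<times> (I a \<times> I c)"
    by (auto simp: floor8_def n I_def floor_eq_iff)
  have [measurable]: "I x \<in> sets borel" for x by (simp add: I_def)
  have I1: "emeasure lborel (I x) = 1" for x by (simp add: I_def)
  have m: "I x \<times> I y \<in> sets borel" for x y by (intro borel_Times) measurable
  show "floor8 -` {n} \<in> sets borel" unfolding eq by (intro borel_Times m)
  have e2: "emeasure lborel (I x \<times> I y) = 1" for x y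
    unfolding lborel_prod[symmetric, where 'a = real and 'b = real]
    by (simp add: lborel.emeasure_pair_measure_Times I1)
  show "emeasure lborel (floor8 -` {n}) = 1"
    unfolding eq lborel_prod[symmetric, where 'a = "real \<times> real" and 'b = "real \<times> real"]
    by (simp add: lborel.emeasure_pair_measure_Times e2 m)
qed

lemma emeasure_floor8:
  assumes "finite N"
  shows "floor8 -` N \<in> sets borel" "emeasure lborel (floor8 -` N) = ennreal (card N)"
proof -
  have eq: "floor8 -` N = (\<Union>n\<in>N. floor8 -` {n})" by auto
  note m = emeasure_floor8_singleton(1) and e = emeasure_floor8_singleton(2)
  show "floor8 -` N \<in> sets borel" unfolding eq using assms m by (intro sets.finite_UN) auto
  have "emeasure lborel (floor8 -` N) = (\<Sum>n\<in>N. emeasure lborel (floor8 -` {n}))"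
    unfolding eq using assms m by (intro sum_emeasure[symmetric]) (auto simp: disjoint_family_on_def)
  also have "\<dots> = ennreal (card N)" by (simp add: e ennreal_of_nat_eq_real_of_nat)
  finally show "emeasure lborel (floor8 -` N) = ennreal (card N)" .
qed

text \<open>The neighbourhood is a closed one, so that a compact K has a compact, hence measurable,
  collar.\<close>

definition collar :: "real \<Rightarrow> 'a::metric_space set \<Rightarrow> 'a set" where
  "collar \<rho> K = {z. \<exists>k\<in>K. dist z k \<le> \<rho>}"

lemma collar_mono: "\<rho> \<le> \<rho>' \<Longrightarrow> collar \<rho> K \<subseteq> collar \<rho>' K"
  by (force simp: collar_def)

lemma compact_collar:
  fixes K :: "'a::euclidean_space set"
  assumes "compact K" shows "compact (collar \<rho> K)"
proof -
  have "collar \<rho> K = {x + y |x y. x \<in> K \<and> y \<in> cball 0 \<rho>}"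
  proof (intro equalityI subsetI)
    fix z assume "z \<in> collar \<rho> K"
    then obtain k where "k \<in> K" "dist z k \<le> \<rho>" by (auto simp: collar_def)
    then have "k \<in> K \<and> z - k \<in> cball 0 \<rho>" "z = k + (z - k)" by (auto simp: dist_norm norm_minus_commute)
    then show "z \<in> {x + y |x y. x \<in> K \<and> y \<in> cball 0 \<rho>}" by blast
  next
    fix z assume "z \<in> {x + y |x y. x \<in> K \<and> y \<in> cball 0 \<rho>}"
    then obtain x y where "z = x + y" "x \<in> K" "norm y \<le> \<rho>" by auto
    then show "z \<in> collar \<rho> K" by (auto simp: collar_def dist_norm intro!: bexI[of _ x])
  qed
  then show ?thesis using compact_sums[OF assms compact_cball[of 0 \<rho>]] by simp
qed

text \<open>Continuity of measure from above: the collars of radius 1/(n+1) decrease to a subset of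
  K, because K is closed.\<close>

lemma collar_small:
  fixes K :: "'a::euclidean_space set"
  assumes K: "compact K" and neg: "negligible K" and "\<epsilon> > 0"
  obtains \<rho> where "\<rho> > 0" "measure lebesgue (collar \<rho> K) < \<epsilon>"
proof -
  let ?A = "\<lambda>n. collar (inverse (real (Suc n))) K"
  have lm: "?A n \<in> lmeasurable" for n using K compact_collar lmeasurable_compact by blast
  have "(\<Inter>n. ?A n) \<subseteq> K"
  proof
    fix z assume z: "z \<in> (\<Inter>n. ?A n)"
    have "\<exists>k\<in>K. dist k z < e" if "e > 0" for e
    proof -
      obtain n where "inverse (real (Suc n)) < e" using \<open>e > 0\<close> reals_Archimedean by blast
      moreover obtain k where "k \<in> K" "dist z k \<le> inverse (real (Suc n))"
        using z by (auto simp: collar_def)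
      ultimately show ?thesis by (metis dist_commute le_less_trans)
    qed
    then show "z \<in> K" using compact_imp_closed[OF K] closed_approachable by blast
  qed
  then have "negligible (\<Inter>n. ?A n)" using neg negligible_subset by blast
  then have 0: "measure lebesgue (\<Inter>n. ?A n) = 0" by (rule negligible_imp_measure0)
  have "(\<lambda>n. measure lebesgue (?A n)) \<longlonglongrightarrow> measure lebesgue (\<Inter>n. ?A n)"
  proof (rule Lim_measure_decseq)
    show "range ?A \<subseteq> sets lebesgue" using lm by blast
    show "decseq ?A" unfolding decseq_def by (auto intro!: collar_mono le_imp_inverse_le)
    show "emeasure lebesgue (?A i) \<noteq> \<infinity>" for i using fmeasurableD2[OF lm[of i]] by simp
  qed
  then have "eventually (\<lambda>n. measure lebesgue (?A n) < \<epsilon>) sequentially"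
    using 0 \<open>\<epsilon> > 0\<close> by (auto intro: order_tendstoD)
  then obtain n where "measure lebesgue (?A n) < \<epsilon>" by (auto simp: eventually_sequentially)
  then show ?thesis by (intro that[of "inverse (real (Suc n))"]) auto
qed

lemma frontier_Times_subset:
  "frontier (A \<times> B) \<subseteq> (closure A \<times> frontier B) \<union> (frontier A \<times> closure B)"
  by (auto simp: frontier_def closure_Times interior_Times)

lemma lborel_Times:
  fixes A :: "'a::euclidean_space set" and B :: "'b::euclidean_space set"
  assumes "A \<in> sets borel" "B \<in> sets borel"
  shows "emeasure lborel (A \<times> B) = emeasure lborel A * emeasure lborel B"
  using assms unfolding lborel_prod[symmetric] by (simp add: lborel.emeasure_pair_measure_Times)

text \<open>The frontier of a product lies in a union of two products, each with a null factor.
  Volumes are compared through interiors, since Jordan measurable sets need not be Borel.\<close>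

lemma jordan_measurable_Times:
  fixes A :: "'a::euclidean_space set" and B :: "'b::euclidean_space set"
  assumes A: "jordan_measurable A" and B: "jordan_measurable B"
  shows "jordan_measurable (A \<times> B)"
    and "measure lebesgue (A \<times> B) = measure lebesgue A * measure lebesgue B"
proof -
  have null: "emeasure lborel (frontier S) = 0" if "jordan_measurable S" for S :: "'c::euclidean_space set"
    using that by (simp add: jordan_measurable_def negligible_iff_emeasure0)
  have "emeasure lborel (closure A \<times> frontier B) = 0" "emeasure lborel (frontier A \<times> closure B) = 0"
    by (simp_all add: lborel_Times null A B)
  moreover have "closure A \<times> frontier B \<in> sets borel" "frontier A \<times> closure B \<in> sets borel"
    by (simp_all add: closed_Times)
  ultimately have "negligible (closure A \<times> frontier B)" "negligible (frontier A \<times> closure B)"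
    by (simp_all add: negligible_iff_emeasure0)
  then have neg: "negligible (frontier (A \<times> B))"
    using negligible_subset[OF _ frontier_Times_subset] negligible_Un by blast
  have bd: "bounded (A \<times> B)" using A B by (auto simp: jordan_measurable_def bounded_Times)
  with neg show "jordan_measurable (A \<times> B)" by (simp add: jordan_measurable_def)
  have "measure lebesgue (A \<times> B) = measure lebesgue (interior A \<times> interior B)"
    using measure_interior[OF bd neg] by (simp add: interior_Times)
  also have "\<dots> = measure lebesgue (interior A) * measure lebesgue (interior B)"
    by (simp add: measure_def lborel_Times enn2real_mult open_Times)
  also have "\<dots> = measure lebesgue A * measure lebesgue B"
    using A B measure_interior unfolding jordan_measurable_def by metis
  finally show "measure lebesgue (A \<times> B) = measure lebesgue A * measure lebesgue B" .
qed

text \<open>Fractional parts lie in [0, 1] and sqrt 2 / 2 <= 1, so in each component the real part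
  moves by at most 2 and the imaginary part by at most 3 times the scaling factor; 5 is the
  sum.\<close>

lemma dist_emb8_floor:
  "dist (emb8 \<alpha> \<beta> v) (emb8 \<alpha> \<beta> (of_int8 (floor8 v))) \<le> 5 * \<bar>\<alpha>\<bar> + 5 * \<bar>\<beta>\<bar>"
proof -
  obtain b d a c where v: "v = ((b, d), (a, c))" by (metis surj_pair)
  define h where "h = sqrt 2 / 2"
  have h: "0 < h" "h \<le> 1" using real_sqrt_le_mono[of 2 4] by (simp_all add: h_def)
  define a' b' c' d' where diffs: "a' = a - of_int \<lfloor>a\<rfloor>" "b' = b - of_int \<lfloor>b\<rfloor>"
    "c' = c - of_int \<lfloor>c\<rfloor>" "d' = d - of_int \<lfloor>d\<rfloor>"
  have I: "0 \<le> a' \<and> a' \<le> 1" "0 \<le> b' \<and> b' \<le> 1" "0 \<le> c' \<and> c' \<le> 1" "0 \<le> d' \<and> d' \<le> 1"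
    unfolding diffs by linarith+
  have "\<bar>(b' - d') * h\<bar> \<le> 1 * 1" "\<bar>(b' + d') * h\<bar> \<le> 2 * 1"
    unfolding abs_mult by (intro mult_mono; use I h in auto)+
  then have x: "\<bar>a' + (b' - d') * h\<bar> \<le> 2" "\<bar>c' + (b' + d') * h\<bar> \<le> 3"
    "\<bar>a' - (b' - d') * h\<bar> \<le> 2" "\<bar>- c' + (b' + d') * h\<bar> \<le> 3"
    using I by (simp_all add: abs_le_iff)
  have cm: "cmod (Complex p q) \<le> 5" if "\<bar>p\<bar> \<le> 2" "\<bar>q\<bar> \<le> 3" for p q
    using cmod_le[of "Complex p q"] that by simp
  have e1: "fst (emb8 \<alpha> \<beta> v) - fst (emb8 \<alpha> \<beta> (of_int8 (floor8 v))) = \<alpha> *\<^sub>R Complex (a' + (b' - d') * h) (c' + (b' + d') * h)"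
    and e2: "snd (emb8 \<alpha> \<beta> v) - snd (emb8 \<alpha> \<beta> (of_int8 (floor8 v))) = \<beta> *\<^sub>R Complex (a' - (b' - d') * h) (- c' + (b' + d') * h)"
    by (simp_all add: v emb8_def of_int8_def floor8_def diffs h_def complex_eq_iff algebra_simps add_divide_distrib diff_divide_distrib)
  have "dist (fst (emb8 \<alpha> \<beta> v)) (fst (emb8 \<alpha> \<beta> (of_int8 (floor8 v)))) \<le> 5 * \<bar>\<alpha>\<bar>"
    "dist (snd (emb8 \<alpha> \<beta> v)) (snd (emb8 \<alpha> \<beta> (of_int8 (floor8 v)))) \<le> 5 * \<bar>\<beta>\<bar>"
    unfolding dist_norm e1 e2 norm_scaleR
    using mult_left_mono[OF cm[OF x(1,2)], of "\<bar>\<alpha>\<bar>"] mult_left_mono[OF cm[OF x(3,4)], of "\<bar>\<beta>\<bar>"]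
    by simp_all
  moreover have "dist p q \<le> dist (fst p) (fst q) + dist (snd p) (snd q)" for p q :: "complex \<times> complex"
    by (simp add: dist_prod_def sqrt_sum_squares_le_sum)
  ultimately show ?thesis by (smt (verit))
qed

text \<open>The segment from a point inside E to a point outside meets the frontier, and the meeting
  point is within \<rho> of both ends.\<close>

lemma closed_segment_frontier:
  fixes x y :: "'a::euclidean_space"
  assumes "x \<in> E" "y \<notin> E" "dist x y \<le> \<rho>"
  shows "x \<in> collar \<rho> (frontier E)" "y \<in> collar \<rho> (frontier E)"
proof -
  have "closed_segment x y \<inter> frontier E \<noteq> {}"
    by (rule connected_Int_frontier) (use assms in auto)
  then obtain k where k: "k \<in> closed_segment x y" "k \<in> frontier E" by blast
  then have "dist x k \<le> \<rho>" "dist y k \<le> \<rho>"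
    using assms(3) dist_in_closed_segment[OF k(1)] by (auto simp: dist_commute intro: order_trans)
  then show "x \<in> collar \<rho> (frontier E)" "y \<in> collar \<rho> (frontier E)"
    using k(2) by (auto simp: collar_def)
qed

text \<open>Every lattice point stands for its unit cell, whose image has volume 4 \<alpha>^2
  \<beta>^2. The union of these cells can differ from E only near the frontier, within the distance
  bound for a point and the corner of its cell.\<close>

lemma emb8_lattice_count:
  assumes E: "jordan_measurable E" and \<alpha>: "\<alpha> \<noteq> 0" and \<beta>: "\<beta> \<noteq> 0"
  defines "N \<equiv> {n. emb8 \<alpha> \<beta> (of_int8 n) \<in> E}"
  shows "finite N"
    and "\<bar>4 * \<alpha>\<^sup>2 * \<beta>\<^sup>2 * real (card N) - measure lebesgue E\<bar>
      \<le> measure lebesgue (collar (5 * \<bar>\<alpha>\<bar> + 5 * \<bar>\<beta>\<bar>) (frontier E))"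
proof -
  define \<rho> where "\<rho> = 5 * \<bar>\<alpha>\<bar> + 5 * \<bar>\<beta>\<bar>"
  define c where "c = 4 * \<alpha>\<^sup>2 * \<beta>\<^sup>2"
  have c: "c > 0" using \<alpha> \<beta> by (simp add: c_def)
  define U where "U = collar \<rho> (frontier E)"
  have bd: "bounded E" "negligible (frontier E)" using E by (auto simp: jordan_measurable_def)
  have cU: "compact U" unfolding U_def by (intro compact_collar compact_frontier_bounded bd)
  have cE: "compact (closure E)" using bd compact_closure by blast
  have FU: "frontier E \<subseteq> U" unfolding U_def \<rho>_def collar_def by auto (metis dist_self add_nonneg_nonneg abs_ge_zero mult_nonneg_nonneg zero_le_numeral)
  \<comment> \<open>An open inner and a compact outer approximation: both are Borel even if E is
    not, and they differ only inside U.\<close>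
  define O' C where "O' = interior E - U" and "C = closure E \<union> U"
  have cC: "compact C" using compact_Un[OF cE cU] by (simp add: C_def)
  have oO: "open O'" unfolding O'_def using cU compact_imp_closed by blast
  have bO: "bounded O'" unfolding O'_def using bd by (meson Diff_subset bounded_subset interior_subset)
  have lm: "E \<in> lmeasurable" "U \<in> lmeasurable" "O' \<in> lmeasurable" "C \<in> lmeasurable"
    using measurable_Jordan[OF bd] lmeasurable_compact cU cC lmeasurable_open oO bO by auto
  have upper: "floor8 -` N' \<subseteq> emb8 \<alpha> \<beta> -` C" if "N' \<subseteq> N" for N'
  proof
    fix v assume "v \<in> floor8 -` N'"
    then have "emb8 \<alpha> \<beta> (of_int8 (floor8 v)) \<in> E" using that by (auto simp: N_def)
    then have "emb8 \<alpha> \<beta> v \<in> E \<or> emb8 \<alpha> \<beta> v \<in> U"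
      using closed_segment_frontier(2) dist_emb8_floor unfolding U_def \<rho>_def by (metis dist_commute)
    then show "v \<in> emb8 \<alpha> \<beta> -` C" using closure_subset by (auto simp: C_def)
  qed
  have lower: "emb8 \<alpha> \<beta> -` O' \<subseteq> floor8 -` N"
  proof
    fix v assume "v \<in> emb8 \<alpha> \<beta> -` O'"
    then have "emb8 \<alpha> \<beta> v \<in> E" "emb8 \<alpha> \<beta> v \<notin> U" using interior_subset by (auto simp: O'_def)
    then have "emb8 \<alpha> \<beta> (of_int8 (floor8 v)) \<in> E"
      using closed_segment_frontier(1) dist_emb8_floor unfolding U_def \<rho>_def by metis
    then show "v \<in> floor8 -` N" by (simp add: N_def)
  qed
  have em: "ennreal c * emeasure lborel (emb8 \<alpha> \<beta> -` S) = ennreal (measure lebesgue S)"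
    if "S \<in> sets borel" "S \<in> lmeasurable" for S
    using that emeasure_emb8[OF \<alpha> \<beta> that(1)] emeasure_eq_measure2[OF that(2)] by (simp add: c_def)
  have vm: "emb8 \<alpha> \<beta> -` S \<in> sets borel" if "S \<in> sets borel" for S
    using measurable_sets_borel[OF emb8_measurable that] .
  have C: "C \<in> sets borel" and O: "O' \<in> sets borel"
    using borel_compact[OF cC] borel_open[OF oO] by auto
  have le: "c * real (card N') \<le> measure lebesgue C" if N': "finite N'" "N' \<subseteq> N" for N'
  proof -
    have "ennreal (c * real (card N')) = ennreal c * emeasure lborel (floor8 -` N')"
      using c N' by (simp add: emeasure_floor8 ennreal_mult)
    also have "\<dots> \<le> ennreal c * emeasure lborel (emb8 \<alpha> \<beta> -` C)"
      using upper[OF N'(2)] vm[OF C] by (intro mult_left_mono emeasure_mono) auto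
    also have "\<dots> = ennreal (measure lebesgue C)" by (rule em[OF C lm(4)])
    finally show ?thesis by simp
  qed
  \<comment> \<open>Finiteness is read off from the volume bound, which holds uniformly for all
    finite subsets of N.\<close>
  show fin: "finite N"
  proof (rule finite_if_finite_subsets_card_bdd[THEN conjunct1])
    fix N' assume "N' \<subseteq> N" "finite N'"
    then have "real (card N') \<le> measure lebesgue C / c" using le[of N'] c by (simp add: field_simps)
    then show "card N' \<le> nat \<lfloor>measure lebesgue C / c\<rfloor>" by linarith
  qed
  have ge: "measure lebesgue O' \<le> c * real (card N)"
  proof -
    have "ennreal (measure lebesgue O') = ennreal c * emeasure lborel (emb8 \<alpha> \<beta> -` O')"
      by (rule em[OF O lm(3), symmetric])
    also have "\<dots> \<le> ennreal c * emeasure lborel (floor8 -` N)"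
      using lower emeasure_floor8(1)[OF fin] by (intro mult_left_mono emeasure_mono) auto
    also have "\<dots> = ennreal (c * real (card N))"
      using c fin by (simp add: emeasure_floor8 ennreal_mult)
    finally show ?thesis using c by simp
  qed
  have "C \<subseteq> O' \<union> U" using FU by (auto simp: C_def O'_def frontier_def)
  then have "measure lebesgue C \<le> measure lebesgue (O' \<union> U)"
    using lm by (intro measure_mono_fmeasurable) auto
  also have "\<dots> \<le> measure lebesgue O' + measure lebesgue U" using lm by (intro measure_Un_le) auto
  finally have CO: "measure lebesgue C \<le> measure lebesgue O' + measure lebesgue U" .
  have "measure lebesgue O' \<le> measure lebesgue E" "measure lebesgue E \<le> measure lebesgue C"
    using lm interior_subset[of E] closure_subset[of E] by (intro measure_mono_fmeasurable; auto simp: O'_def C_def)+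
  with CO ge le[OF fin subset_refl] show "\<bar>4 * \<alpha>\<^sup>2 * \<beta>\<^sup>2 * real (card N) - measure lebesgue E\<bar>
      \<le> measure lebesgue (collar (5 * \<bar>\<alpha>\<bar> + 5 * \<bar>\<beta>\<bar>) (frontier E))"
    unfolding c_def U_def \<rho>_def by linarith
qed

section \<open>Counting in Z[zeta] and balancing by units\<close>

definition z8 :: "(int \<times> int) \<times> int \<times> int \<Rightarrow> complex" where
  "z8 = (\<lambda>((b, d), (a, c)). q8 (of_int a) (of_int b) (of_int c) (of_int d))"

lemma bij_z8: "bij_betw z8 UNIV Zzeta8"
proof -
  have "inj z8" by (auto simp: inj_def z8_def q8_inject)
  moreover have "range z8 = Zzeta8"
  proof (intro equalityI subsetI)
    fix x assume "x \<in> Zzeta8"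
    then obtain a b c d where "x = of_int a + of_int b * zeta8 + of_int c * zeta8 ^ 2 + of_int d * zeta8 ^ 3"
      by (auto simp: Zzeta8_def)
    then have "x = z8 ((b, d), (a, c))" by (simp add: z8_def q8_def)
    then show "x \<in> range z8" by simp
  qed (auto simp: z8_def q8_def Zzeta8_def)
  ultimately show ?thesis by (simp add: bij_betw_def)
qed

lemma z8_in: "z8 n \<in> Zzeta8"
  using bij_z8 by (auto simp: bij_betw_def)

lemma z8E:
  assumes "x \<in> Zzeta8" obtains a b c d where "x = z8 ((b, d), (a, c))"
proof -
  obtain n where "x = z8 n" using assms bij_z8 unfolding bij_betw_def by blast
  then show ?thesis using that by (metis surj_pair)
qed

lemma emb8_of_int8: "emb8 \<alpha> \<beta> (of_int8 n) = (\<alpha> *\<^sub>R z8 n, \<beta> *\<^sub>R sigma8 (z8 n))"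
proof -
  obtain b d a c where n: "n = ((b, d), (a, c))" by (metis surj_pair)
  show ?thesis
    by (simp add: n z8_def sigma_q8) (auto simp: emb8_def of_int8_def q8_eq of_rat_diff of_rat_add of_rat_minus algebra_simps
        add_divide_distrib diff_divide_distrib)
qed

lemma Zzeta8_lattice_count:
  assumes E: "jordan_measurable E" and \<alpha>: "\<alpha> \<noteq> 0" and \<beta>: "\<beta> \<noteq> 0"
  defines "X \<equiv> {x \<in> Zzeta8. (\<alpha> *\<^sub>R x, \<beta> *\<^sub>R sigma8 x) \<in> E}"
  shows "finite X"
    and "\<bar>4 * \<alpha>\<^sup>2 * \<beta>\<^sup>2 * real (card X) - measure lebesgue E\<bar>
      \<le> measure lebesgue (collar (5 * \<bar>\<alpha>\<bar> + 5 * \<bar>\<beta>\<bar>) (frontier E))"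
proof -
  define N where "N = {n. emb8 \<alpha> \<beta> (of_int8 n) \<in> E}"
  have "bij_betw z8 N X"
  proof (rule bij_betw_subset[OF bij_z8])
    show "z8 ` N = X"
      using bij_betw_imp_surj_on[OF bij_z8] by (auto simp: N_def X_def emb8_of_int8)
  qed auto
  then have "finite X \<longleftrightarrow> finite N" "card X = card N"
    using bij_betw_finite bij_betw_same_card by metis+
  then show "finite X"
    and "\<bar>4 * \<alpha>\<^sup>2 * \<beta>\<^sup>2 * real (card X) - measure lebesgue E\<bar>
      \<le> measure lebesgue (collar (5 * \<bar>\<alpha>\<bar> + 5 * \<bar>\<beta>\<bar>) (frontier E))"
    using emb8_lattice_count[OF assms(1-3)] by (simp_all add: N_def)
qed

lemma z8_mult_closed: "x \<in> Zzeta8 \<Longrightarrow> y \<in> Zzeta8 \<Longrightarrow> x * y \<in> Zzeta8"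
proof -
  assume "x \<in> Zzeta8" "y \<in> Zzeta8"
  then obtain a b c d a' b' c' d' where "x = z8 ((b, d), (a, c))" "y = z8 ((b', d'), (a', c'))"
    by (elim z8E)
  then have "x * y = z8 ((a * b' + b * a' - c * d' - d * c', a * d' + b * c' + c * b' + d * a'),
      (a * a' - b * d' - c * c' - d * b', a * c' + b * b' + c * a' - d * d'))"
    by (simp add: z8_def q8_mult)
  then show ?thesis by (simp add: z8_in)
qed

lemma z8_add_closed: "x \<in> Zzeta8 \<Longrightarrow> y \<in> Zzeta8 \<Longrightarrow> x + y \<in> Zzeta8"
proof -
  assume "x \<in> Zzeta8" "y \<in> Zzeta8"
  then obtain a b c d a' b' c' d' where "x = z8 ((b, d), (a, c))" "y = z8 ((b', d'), (a', c'))"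
    by (elim z8E)
  then have "x + y = z8 ((b + b', d + d'), (a + a', c + c'))"
    by (simp add: z8_def q8_add)
  then show ?thesis by (simp add: z8_in)
qed

lemma Zzeta8_Qzeta8: "x \<in> Zzeta8 \<Longrightarrow> x \<in> Qzeta8"
  by (elim z8E) (simp add: z8_def)

lemma of_real_Qsqrt2: "of_real (of_rat a + of_rat b * sqrt 2) = q8 a b 0 (- b)"
  by (simp add: q8_eq complex_eq_iff of_rat_add[of b b, folded mult_2])

lemma of_real_Qzeta8: "c \<in> Qsqrt2 \<Longrightarrow> complex_of_real c \<in> Qzeta8"
  using of_real_Qsqrt2 q8_in by (metis Qsqrt2E)

lemma of_real_Zzeta8: "c \<in> Zsqrt2 \<Longrightarrow> complex_of_real c \<in> Zzeta8"
proof -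
  assume "c \<in> Zsqrt2"
  then obtain a b :: int where "c = of_int a + of_int b * sqrt 2" by (rule Zsqrt2E)
  then have "complex_of_real c = z8 ((b, - b), (a, 0))"
    using of_real_Qsqrt2[of "of_int a" "of_int b"] by (simp add: z8_def)
  then show ?thesis by (simp add: z8_in)
qed

lemma sigma8_mult:
  assumes "x \<in> Qzeta8" "y \<in> Qzeta8" shows "sigma8 (x * y) = sigma8 x * sigma8 y"
proof -
  obtain a b c d a' b' c' d' where "x = q8 a b c d" "y = q8 a' b' c' d'"
    using assms by (auto simp: Qzeta8_q8)
  then show ?thesis by (simp add: sigma_q8 q8_mult q8_inject algebra_simps)
qed

lemma sigma8_scaleR:
  assumes "c \<in> Qsqrt2" "x \<in> Qzeta8" shows "sigma8 (c *\<^sub>R x) = cj c *\<^sub>R sigma8 x"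
  using sigma8_mult[OF of_real_Qzeta8[OF assms(1)] assms(2)] sigma8_of_real[OF assms(1)]
  by (simp add: scaleR_conv_of_real)

lemma scaleR_Zzeta8: "c \<in> Zsqrt2 \<Longrightarrow> x \<in> Zzeta8 \<Longrightarrow> c *\<^sub>R x \<in> Zzeta8"
  using z8_mult_closed[OF of_real_Zzeta8] by (simp add: scaleR_conv_of_real)

text \<open>The norm of a nonzero element of \<open>\<int>[\<zeta>]\<close> is a nonzero integer.\<close>

lemma Zzeta8_norm_ge_1:
  assumes "x \<in> Zzeta8" "x \<noteq> 0"
  shows "cmod x * cmod (sigma8 x) \<ge> 1"
proof -
  obtain a b c d where "x = z8 ((b, d), (a, c))" using assms(1) by (rule z8E)
  then have x: "x = q8 (of_int a) (of_int b) (of_int c) (of_int d)" by (simp add: z8_def)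
  define m :: int where "m = a\<^sup>2 + b\<^sup>2 + c\<^sup>2 + d\<^sup>2"
  define k :: int where "k = a * b - a * d + b * c + c * d"
  have q: "(cmod (q8 (of_int a) (of_int b) (of_int c) (of_int d)))\<^sup>2
     = of_int (a\<^sup>2 + b\<^sup>2 + c\<^sup>2 + d\<^sup>2) + of_int (a * b - a * d + b * c + c * d) * sqrt 2" for a b c d :: int
  proof -
    define h where "h = sqrt 2 / 2"
    have h: "h * h = 1 / 2" "sqrt 2 = 2 * h" by (simp_all add: h_def)
    have "(cmod (q8 (of_int a) (of_int b) (of_int c) (of_int d)))\<^sup>2
        = (a + (b - d) * h)\<^sup>2 + (c + (b + d) * h)\<^sup>2"
      by (simp add: q8_eq cmod_power2 of_rat_add of_rat_diff h_def)
    also have "\<dots> = a\<^sup>2 + c\<^sup>2 + (2 * b\<^sup>2 + 2 * d\<^sup>2) * (h * h) + (a * b - a * d + b * c + c * d) * (2 * h)"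
      by (simp add: power2_eq_square algebra_simps)
    finally show ?thesis unfolding h(1) h(2)[symmetric] by simp
  qed
  have x2: "(cmod x)\<^sup>2 = of_int m + of_int k * sqrt 2" unfolding x q m_def k_def ..
  have sx: "sigma8 x = q8 (of_int a) (of_int d) (of_int (- c)) (of_int b)"
    by (simp add: x sigma_q8)
  have "(cmod (sigma8 x))\<^sup>2 = of_int m - of_int k * sqrt 2"
    unfolding sx q by (simp add: m_def k_def algebra_simps)
  \<comment> \<open>This reflects that sigma commutes with complex conjugation: the squared moduli
    of x and sigma(x) are conjugate elements of Z[sqrt 2].\<close>
  also have "\<dots> = cj ((cmod x)\<^sup>2)" unfolding x2 cj_Zsqrt2 ..
  finally have "(cmod x * cmod (sigma8 x))\<^sup>2 = nrm ((cmod x)\<^sup>2)"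
    by (simp add: nrm_cj power_mult_distrib)
  moreover have "(cmod x)\<^sup>2 \<in> Zsqrt2" unfolding x2 by (rule Zsqrt2I)
  then have "\<bar>nrm ((cmod x)\<^sup>2)\<bar> \<ge> 1" using assms(2) by (intro nrm_ge_1) auto
  ultimately have "(cmod x * cmod (sigma8 x))\<^sup>2 \<ge> 1\<^sup>2" by (metis abs_power2 power_one)
  then show ?thesis by (rule power2_le_imp_le) simp
qed

lemma cj_fund_unit_powi: "\<bar>cj (fund_unit powi k)\<bar> = fund_unit powi (- k)"
proof -
  have "nrm (fund_unit powi k) ^ 2 = 1" by (rule nrm_fund_unit_powi)
  then have "\<bar>nrm (fund_unit powi k)\<bar> = 1" by (auto simp: power2_eq_1_iff)
  then have "fund_unit powi k * \<bar>cj (fund_unit powi k)\<bar> = 1"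
    using fund_unit_gt_1 by (simp add: nrm_cj abs_mult)
  then show ?thesis using fund_unit_gt_1 by (simp add: power_int_minus field_simps)
qed

text \<open>Multiplying by a power of the fundamental unit balances the two scaling factors.\<close>

lemma balanced_lattice_count:
  assumes E: "jordan_measurable E" and s: "s \<noteq> 0" and t: "t \<noteq> 0"
  defines "X \<equiv> {x \<in> Zzeta8. (s *\<^sub>R x, t *\<^sub>R sigma8 x) \<in> E}"
  shows "finite X"
    and "\<bar>4 * s\<^sup>2 * t\<^sup>2 * real (card X) - measure lebesgue E\<bar>
      \<le> measure lebesgue (collar (5 * (fund_unit + 1) * sqrt \<bar>s * t\<bar>) (frontier E))"
proof -
  \<comment> \<open>Both |s| u and |t| / u should be close to sqrt |s t|. Relative to it they are u
    r and 1 / (u r), so bringing u r into [1, fund_unit) bounds their sum by (fund_unit + 1) * sqrt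
    |s t|. This explains the collar radius.\<close>
  define r where "r = sqrt \<bar>s\<bar> / sqrt \<bar>t\<bar>"
  have "r > 0" using s t by (simp add: r_def)
  then obtain k where k: "1 \<le> fund_unit powi k * r" "fund_unit powi k * r < fund_unit"
    using fund_unit_normalize by blast
  define u where "u = fund_unit powi k"
  have l0: "fund_unit > 0" using fund_unit_gt_1 by simp
  have u: "u \<in> Zsqrt2" "u > 0" "\<bar>cj u\<bar> = 1 / u" "u \<noteq> 0"
    using l0 by (auto simp: u_def cj_fund_unit_powi power_int_minus inverse_eq_divide)
  have u': "1 / u \<in> Zsqrt2" using fund_unit_powi_Zsqrt2[of "- k"] by (simp add: u_def power_int_minus inverse_eq_divide)
  define \<alpha> \<beta> where "\<alpha> = s * u" and "\<beta> = t * cj u"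
  have ab: "\<alpha> \<noteq> 0" "\<beta> \<noteq> 0" using s t u cj_eq_0[of u] by (auto simp: \<alpha>_def \<beta>_def)
  have sq: "sqrt \<bar>s * t\<bar> = sqrt \<bar>s\<bar> * sqrt \<bar>t\<bar>" by (simp add: abs_mult real_sqrt_mult)
  have pos: "sqrt \<bar>s\<bar> > 0" "sqrt \<bar>t\<bar> > 0" using s t by simp_all
  have r: "r * sqrt \<bar>s * t\<bar> = \<bar>s\<bar>" "1 / r * sqrt \<bar>s * t\<bar> = \<bar>t\<bar>"
    unfolding sq r_def using pos by simp_all
  have "\<bar>\<alpha>\<bar> = (u * r) * sqrt \<bar>s * t\<bar>"
    unfolding \<alpha>_def abs_mult[of s u] mult.assoc r(1) using u by simp
  also have "\<dots> \<le> fund_unit * sqrt \<bar>s * t\<bar>" using k by (intro mult_right_mono) (auto simp: u_def)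
  finally have a_le: "\<bar>\<alpha>\<bar> \<le> fund_unit * sqrt \<bar>s * t\<bar>" .
  have "\<bar>\<beta>\<bar> = 1 / u * (1 / r * sqrt \<bar>s * t\<bar>)"
    unfolding \<beta>_def abs_mult[of t] r(2) u(3) by simp
  then have "\<bar>\<beta>\<bar> = 1 / (u * r) * sqrt \<bar>s * t\<bar>" by simp
  also have "\<dots> \<le> 1 * sqrt \<bar>s * t\<bar>" using k by (intro mult_right_mono) (auto simp: u_def)
  finally have b_le: "\<bar>\<beta>\<bar> \<le> sqrt \<bar>s * t\<bar>" by simp
  define Y where "Y = {y \<in> Zzeta8. (\<alpha> *\<^sub>R y, \<beta> *\<^sub>R sigma8 y) \<in> E}"
  have "bij_betw (\<lambda>y. u *\<^sub>R y) Y X"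
  proof (rule bij_betw_byWitness[where f' = "\<lambda>x. (1 / u) *\<^sub>R x"])
    show "(\<lambda>y. u *\<^sub>R y) ` Y \<subseteq> X"
      using u by (auto simp: X_def Y_def \<alpha>_def \<beta>_def scaleR_Zzeta8 sigma8_scaleR Zzeta8_Qzeta8)
    show "(\<lambda>x. (1 / u) *\<^sub>R x) ` X \<subseteq> Y"
    proof safe
      fix x assume x: "x \<in> X"
      have "sigma8 x = cj u *\<^sub>R sigma8 ((1 / u) *\<^sub>R x)"
        using sigma8_scaleR[of u "(1 / u) *\<^sub>R x"] u u' x scaleR_Zzeta8[of "1 / u" x]
        by (simp add: X_def Zzeta8_Qzeta8)
      then show "(1 / u) *\<^sub>R x \<in> Y"
        using x u' u scaleR_Zzeta8[of "1 / u" x] by (auto simp: X_def Y_def \<alpha>_def \<beta>_def)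
    qed
  qed (use u in auto)
  then have XY: "finite X \<longleftrightarrow> finite Y" "card X = card Y"
    using bij_betw_finite bij_betw_same_card by metis+
  note Y = Zzeta8_lattice_count[OF E ab, folded Y_def]
  show "finite X" using XY Y by simp
  have "\<bar>\<alpha>\<bar> * \<bar>\<beta>\<bar> = \<bar>s\<bar> * \<bar>t\<bar>" using u by (simp add: \<alpha>_def \<beta>_def abs_mult)
  then have "(\<bar>\<alpha>\<bar> * \<bar>\<beta>\<bar>)\<^sup>2 = (\<bar>s\<bar> * \<bar>t\<bar>)\<^sup>2" by simp
  then have eq: "4 * \<alpha>\<^sup>2 * \<beta>\<^sup>2 = 4 * s\<^sup>2 * t\<^sup>2" by (simp add: power_mult_distrib)
  have cf: "compact (frontier E)" using E by (simp add: jordan_measurable_def compact_frontier_bounded)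
  have "measure lebesgue (collar (5 * \<bar>\<alpha>\<bar> + 5 * \<bar>\<beta>\<bar>) (frontier E))
      \<le> measure lebesgue (collar (5 * (fund_unit + 1) * sqrt \<bar>s * t\<bar>) (frontier E))"
    using a_le b_le
    by (intro measure_mono_fmeasurable collar_mono fmeasurableD lmeasurable_compact compact_collar cf)
      (simp_all add: algebra_simps)
  then show "\<bar>4 * s\<^sup>2 * t\<^sup>2 * real (card X) - measure lebesgue E\<bar>
      \<le> measure lebesgue (collar (5 * (fund_unit + 1) * sqrt \<bar>s * t\<bar>) (frontier E))"
    using Y(2) unfolding eq XY(2) by linarith
qed

text \<open>Take s = 1/T and t = 1 in the balanced count. The collar radius is then of order
  T^(-1/2), so the error tends to 0 because the frontier of D x W is null.\<close>

lemma cut_and_project_density: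
  assumes D: "jordan_measurable D" and W: "jordan_measurable W"
  shows "((\<lambda>T::real. real (card {x \<in> Zzeta8. x /\<^sub>R T \<in> D \<and> sigma8 x \<in> W}) / T\<^sup>2)
      \<longlongrightarrow> measure lebesgue D * measure lebesgue W / 4) at_top"
proof -
  define E where "E = D \<times> W"
  define c where "c = 5 * (fund_unit + 1)"
  define X where "X T = {x \<in> Zzeta8. x /\<^sub>R T \<in> D \<and> sigma8 x \<in> W}" for T
  have E: "jordan_measurable E" "measure lebesgue E = measure lebesgue D * measure lebesgue W"
    using jordan_measurable_Times[OF D W] by (simp_all add: E_def)
  have cf: "compact (frontier E)" "negligible (frontier E)"
    using E by (simp_all add: jordan_measurable_def compact_frontier_bounded)
  have "((\<lambda>T. 4 * (real (card (X T)) / T\<^sup>2)) \<longlongrightarrow> measure lebesgue E) at_top"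
  proof (rule tendstoI)
    fix e :: real assume "e > 0"
    then obtain \<rho> where \<rho>: "\<rho> > 0" "measure lebesgue (collar \<rho> (frontier E)) < e"
      using collar_small[OF cf] by blast
    have "((\<lambda>T::real. c * sqrt \<bar>inverse T * 1\<bar>) \<longlongrightarrow> c * sqrt \<bar>0 * 1\<bar>) at_top"
      by (intro tendsto_intros tendsto_inverse_0_at_top filterlim_ident)
    then have "eventually (\<lambda>T::real. c * sqrt \<bar>inverse T * 1\<bar> < \<rho>) at_top"
      by (rule order_tendstoD) (use \<rho> in simp)
    then show "eventually (\<lambda>T. dist (4 * (real (card (X T)) / T\<^sup>2)) (measure lebesgue E) < e) at_top"
      using eventually_gt_at_top[of 0]
    proof eventually_elim
      case (elim T)
      have "X T = {x \<in> Zzeta8. (inverse T *\<^sub>R x, 1 *\<^sub>R sigma8 x) \<in> E}" by (auto simp: X_def E_def)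
      then have "\<bar>4 * (inverse T)\<^sup>2 * 1\<^sup>2 * real (card (X T)) - measure lebesgue E\<bar>
          \<le> measure lebesgue (collar (c * sqrt \<bar>inverse T * 1\<bar>) (frontier E))"
        using balanced_lattice_count(2)[OF E(1), of "inverse T" 1] elim by (simp add: c_def)
      also have "\<dots> \<le> measure lebesgue (collar \<rho> (frontier E))"
        using elim by (intro measure_mono_fmeasurable collar_mono fmeasurableD lmeasurable_compact compact_collar cf) auto
      finally show ?case using \<rho> by (simp add: dist_real_def field_simps power2_eq_square)
    qed
  qed
  then have "((\<lambda>T. 4 * (real (card (X T)) / T\<^sup>2) / 4) \<longlongrightarrow> measure lebesgue E / 4) at_top"
    by (intro tendsto_intros) auto
  then show ?thesis by (simp add: X_def E)
qed

lemma jordan_measurable_cball: "jordan_measurable (cball a r :: 'a::euclidean_space set)"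
  using negligible_convex_frontier[OF convex_cball, of a r]
  by (simp only: jordan_measurable_def bounded_cball)

text \<open>If A * B < 1, the norm bound leaves no nonzero point. Otherwise the collar radius in the
  balanced count stays below a constant and the error can be absorbed into C. Excluding 0 is what
  allows a bound proportional to (A * B)^2 for small A * B as well.\<close>

lemma Zzeta8_crude_bound:
  obtains C where "C > 0" "\<And>A B. A > 0 \<Longrightarrow> B > 0 \<Longrightarrow>
      finite {x \<in> Zzeta8. x \<noteq> 0 \<and> cmod x \<le> A \<and> cmod (sigma8 x) \<le> B} \<and>
      real (card {x \<in> Zzeta8. x \<noteq> 0 \<and> cmod x \<le> A \<and> cmod (sigma8 x) \<le> B}) \<le> C * (A * B)\<^sup>2"
    "\<And>A B. A > 0 \<Longrightarrow> B > 0 \<Longrightarrow> A * B < 1 \<Longrightarrow>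
      {x \<in> Zzeta8. x \<noteq> 0 \<and> cmod x \<le> A \<and> cmod (sigma8 x) \<le> B} = {}"
proof -
  define E :: "(complex \<times> complex) set" where "E = cball 0 1 \<times> cball 0 1"
  have E: "jordan_measurable E" unfolding E_def by (intro jordan_measurable_Times jordan_measurable_cball)
  have cf: "compact (frontier E)" using E by (simp add: jordan_measurable_def compact_frontier_bounded)
  define c where "c = 5 * (fund_unit + 1)"
  have c: "c > 0" using fund_unit_gt_1 by (simp add: c_def)
  define C where "C = measure lebesgue E + measure lebesgue (collar c (frontier E)) + 1"
  define X where "X A B = {x \<in> Zzeta8. x \<noteq> 0 \<and> cmod x \<le> A \<and> cmod (sigma8 x) \<le> B}" for A B
  have C: "C > 0" unfolding C_def by (intro add_nonneg_pos add_nonneg_nonneg measure_nonneg) simp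
  have small: "X A B = {}" if "A > 0" "B > 0" "A * B < 1" for A B
  proof -
    have False if x: "x \<in> X A B" for x
    proof -
      have "cmod x * cmod (sigma8 x) \<le> A * B"
        using x \<open>A > 0\<close> by (intro mult_mono) (auto simp: X_def)
      then show False using Zzeta8_norm_ge_1[of x] x \<open>A * B < 1\<close> by (auto simp: X_def)
    qed
    then show ?thesis by blast
  qed
  have "finite (X A B) \<and> real (card (X A B)) \<le> C * (A * B)\<^sup>2" if AB: "A > 0" "B > 0" for A B
  proof (cases "A * B < 1")
    case True
    then show ?thesis using small AB C by simp
  next
    case False
    define Y where "Y = {x \<in> Zzeta8. (inverse A *\<^sub>R x, inverse B *\<^sub>R sigma8 x) \<in> E}"
    have Y: "finite Y" "\<bar>4 * (inverse A)\<^sup>2 * (inverse B)\<^sup>2 * real (card Y) - measure lebesgue E\<bar>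
        \<le> measure lebesgue (collar (c * sqrt \<bar>inverse A * inverse B\<bar>) (frontier E))"
      using balanced_lattice_count[OF E, of "inverse A" "inverse B"] AB by (simp_all add: Y_def c_def)
    have "inverse A * inverse B \<le> 1" using False AB by (simp add: field_simps)
    then have "c * sqrt \<bar>inverse A * inverse B\<bar> \<le> c" using AB c by simp
    then have "measure lebesgue (collar (c * sqrt \<bar>inverse A * inverse B\<bar>) (frontier E))
        \<le> measure lebesgue (collar c (frontier E))"
      by (intro measure_mono_fmeasurable collar_mono fmeasurableD lmeasurable_compact compact_collar cf)
    then have "(inverse A)\<^sup>2 * (inverse B)\<^sup>2 * real (card Y) \<le> C"
      using Y(2) measure_nonneg[of lebesgue E] measure_nonneg[of lebesgue "collar c (frontier E)"] unfolding C_def by linarith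
    then have "real (card Y) \<le> C * (A * B)\<^sup>2" using AB by (simp add: field_simps power2_eq_square)
    moreover have "X A B \<subseteq> Y" using AB by (auto simp: X_def Y_def E_def field_simps)
    ultimately show ?thesis using Y(1) card_mono[of Y "X A B"] finite_subset[of "X A B" Y] by auto
  qed
  with small C that show ?thesis unfolding X_def by blast
qed

section \<open>Ideals and the Dedekind zeta function\<close>

lemma cring_RZ: "cring RZ"
proof (rule cringI)
  show "abelian_group RZ"
  proof (rule abelian_groupI)
    show "\<exists>y\<in>carrier RZ. y \<oplus>\<^bsub>RZ\<^esub> x = \<zero>\<^bsub>RZ\<^esub>" if "x \<in> carrier RZ" for x
      using that by (auto simp: RZ_simps intro!: bexI[of _ "- x"])
  qed (auto simp: RZ_simps)
  show "comm_monoid RZ" by (rule comm_monoidI) (auto simp: RZ_simps)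
qed (auto simp: RZ_simps algebra_simps)

definition multiples :: "real \<Rightarrow> real set" where
  "multiples a = {x \<in> Zsqrt2. x / a \<in> Zsqrt2}"

lemma multiples_uminus: "multiples (- a) = multiples a"
proof -
  have "x / - a \<in> Zsqrt2 \<longleftrightarrow> x / a \<in> Zsqrt2" for x
    using Zsqrt2_uminus[of "x / a"] Zsqrt2_uminus[of "- (x / a)"] by auto
  then show ?thesis by (simp add: multiples_def)
qed

lemma ideal_multiples:
  assumes "a \<in> Zsqrt2" "a \<noteq> 0" shows "ideal (multiples a) RZ"
proof -
  have "PIdl\<^bsub>RZ\<^esub> a = multiples a"
    using assms by (force simp: cgenideal_def multiples_def RZ_simps)
  then show ?thesis using cring.cgenideal_ideal[OF cring_RZ, of a] assms by (simp add: RZ_simps)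
qed

lemma bij_multiples: "bij_betw multiples Reps {I. ideal I RZ \<and> I \<noteq> {\<zero>\<^bsub>RZ\<^esub>}}"
proof (rule bij_betw_imageI)
  have self: "a \<in> multiples a" if "a \<in> Reps" for a
    using that by (auto simp: multiples_def Reps_def)
  show "inj_on multiples Reps"
  proof (rule inj_onI)
    fix a b assume ab: "a \<in> Reps" "b \<in> Reps" "multiples a = multiples b"
    then have "a \<in> multiples b" "b \<in> multiples a" using self by blast+
    then show "a = b" using Reps_unique[of a b] ab by (simp add: multiples_def)
  qed
  show "multiples ` Reps = {I. ideal I RZ \<and> I \<noteq> {\<zero>\<^bsub>RZ\<^esub>}}"
  proof (intro equalityI subsetI)
    fix I assume "I \<in> multiples ` Reps"
    then obtain a where a: "a \<in> Reps" "I = multiples a" by blast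
    then have "a \<noteq> 0" "a \<in> I" "a \<in> Zsqrt2" using self by (auto simp: Reps_def)
    then show "I \<in> {I. ideal I RZ \<and> I \<noteq> {\<zero>\<^bsub>RZ\<^esub>}}"
      using ideal_multiples[of a] a(2) by (auto simp: RZ_simps)
  next
    fix I assume "I \<in> {I. ideal I RZ \<and> I \<noteq> {\<zero>\<^bsub>RZ\<^esub>}}"
    then have I: "ideal I RZ" "I \<noteq> {0}" by (auto simp: RZ_simps)
    interpret ideal I RZ by (rule I(1))
    have sub: "I \<subseteq> Zsqrt2" using a_subset by (simp add: RZ_simps)
    have mult: "r * x \<in> I" if "r \<in> Zsqrt2" "x \<in> I" for r x
      using I_l_closed[OF that(2), of r] that(1) by (simp add: RZ_simps)
    have diff: "x - y \<in> I" if "x \<in> I" "y \<in> I" for x y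
      using additive_subgroup.a_closed[OF additive_subgroup_axioms that(1) mult[of "- 1" y]] that(2)
      by (simp add: RZ_simps)
    have "0 \<in> I" using additive_subgroup.zero_closed[OF additive_subgroup_axioms] by (simp add: RZ_simps)
    with I(2) obtain x0 where "x0 \<in> I" "x0 \<noteq> 0" by blast
    then obtain g where g: "g \<in> I" "g \<noteq> 0" "\<And>x. x \<in> I \<Longrightarrow> x / g \<in> Zsqrt2"
      using Zsqrt2_ideal_principal[OF sub diff mult, of x0] by metis
    then obtain a where a: "a \<in> Reps" "a / g \<in> Zsqrt2" "g / a \<in> Zsqrt2"
      using Reps_exist[of g] sub by blast
    have a0: "a \<noteq> 0" using a by (auto simp: Reps_def)
    have "I = multiples a"
    proof (intro equalityI subsetI)
      fix x assume x: "x \<in> I"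
      have "(x / g) * (g / a) \<in> Zsqrt2" using g(3)[OF x] a by (intro Zsqrt2_mult)
      then show "x \<in> multiples a" using x sub g(2) by (auto simp: multiples_def)
    next
      fix x assume "x \<in> multiples a"
      then have "(x / a) * (a / g) \<in> Zsqrt2" using a by (intro Zsqrt2_mult) (auto simp: multiples_def)
      then have "((x / a) * (a / g)) * g \<in> I" using g(1) by (rule mult)
      then show "x \<in> I" using a0 g(2) by simp
    qed
    then show "I \<in> multiples ` Reps" using a(1) by blast
  qed
qed

section \<open>Complete residue systems and the absolute norm of a principal ideal\<close>

definition transversal :: "real \<Rightarrow> real set \<Rightarrow> bool" where
  "transversal a S \<longleftrightarrow> S \<subseteq> Zsqrt2 \<and> (\<forall>x\<in>Zsqrt2. \<exists>!s. s \<in> S \<and> (x - s) / a \<in> Zsqrt2)"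

text \<open>Representatives correspond bijectively to cosets. An infinite S is allowed; both
  cardinalities are then 0.\<close>

lemma card_Quot_transversal:
  assumes a: "a \<noteq> 0" and S: "transversal a S"
  shows "card (carrier (RZ Quot multiples a)) = card S"
proof -
  define co where "co x = multiples a +>\<^bsub>RZ\<^esub> x" for x
  have co: "y \<in> co x \<longleftrightarrow> y \<in> Zsqrt2 \<and> (y - x) / a \<in> Zsqrt2" if "x \<in> Zsqrt2" for x y
  proof
    assume "y \<in> Zsqrt2 \<and> (y - x) / a \<in> Zsqrt2"
    then have "y - x \<in> multiples a" "y = (y - x) + x" using that by (auto simp: multiples_def)
    then show "y \<in> co x" unfolding co_def a_r_coset_def' RZ_simps by blast
  qed (use that in \<open>auto simp: co_def a_r_coset_def' RZ_simps multiples_def\<close>)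
  have eq: "co x = co y" if "x \<in> Zsqrt2" "y \<in> Zsqrt2" "(x - y) / a \<in> Zsqrt2" for x y
  proof -
    have "(z - x) / a \<in> Zsqrt2 \<longleftrightarrow> (z - y) / a \<in> Zsqrt2" for z
      using Zsqrt2_add[OF _ that(3), of "(z - x) / a"] Zsqrt2_diff[OF _ that(3), of "(z - y) / a"]
      by (auto simp flip: add_divide_distrib diff_divide_distrib)
    then show ?thesis using co that by blast
  qed
  have "carrier (RZ Quot multiples a) = co ` Zsqrt2"
    by (auto simp: FactRing_def A_RCOSETS_def' co_def RZ_simps)
  also have "\<dots> = co ` S"
  proof (intro equalityI subsetI)
    fix C assume "C \<in> co ` Zsqrt2"
    then obtain x where x: "x \<in> Zsqrt2" "C = co x" by blast
    then obtain s where "s \<in> S" "(x - s) / a \<in> Zsqrt2" using S by (auto simp: transversal_def)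
    then show "C \<in> co ` S" using x eq[of x s] S by (auto simp: transversal_def)
  qed (use S in \<open>auto simp: transversal_def\<close>)
  finally have "carrier (RZ Quot multiples a) = co ` S" .
  moreover have "inj_on co S"
  proof (rule inj_onI)
    fix s t assume st: "s \<in> S" "t \<in> S" "co s = co t"
    then have Z: "s \<in> Zsqrt2" "t \<in> Zsqrt2" using S by (auto simp: transversal_def)
    have "s \<in> co t" using co[OF Z(1), of s] Z st(3) by simp
    then have "(s - t) / a \<in> Zsqrt2" using co[OF Z(2)] by simp
    moreover have "(s - s) / a \<in> Zsqrt2" by simp
    ultimately show "s = t" using S Z st unfolding transversal_def by metis
  qed
  ultimately show ?thesis by (simp add: card_image)
qed

lemma transversal_exists: "\<exists>S. transversal a S"
proof -
  define R where "R x y \<longleftrightarrow> x \<in> Zsqrt2 \<and> y \<in> Zsqrt2 \<and> (x - y) / a \<in> Zsqrt2" for x y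
  have Rrefl: "R x x" if "x \<in> Zsqrt2" for x using that by (simp add: R_def)
  have Rsym: "R y x" if "R x y" for x y
    using that Zsqrt2_uminus[of "(x - y) / a"] by (simp add: R_def minus_divide_left)
  have Rtrans: "R x z" if "R x y" "R y z" for x y z
    using that Zsqrt2_add[of "(x - y) / a" "(y - z) / a"] by (simp add: R_def flip: add_divide_distrib)
  define f where "f x = (SOME y. R x y)" for x
  have f: "R x (f x)" if "x \<in> Zsqrt2" for x unfolding f_def using Rrefl[OF that] by (rule someI)
  have fcong: "f x = f y" if "R x y" for x y
  proof -
    have "R x z \<longleftrightarrow> R y z" for z using that Rsym Rtrans by blast
    then have "R x = R y" by (intro ext)
    then show ?thesis by (simp add: f_def)
  qed
  have "transversal a (f ` Zsqrt2)"
    unfolding transversal_def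
  proof (intro conjI ballI)
    show "f ` Zsqrt2 \<subseteq> Zsqrt2" using f by (auto simp: R_def)
    fix x assume x: "x \<in> Zsqrt2"
    show "\<exists>!s. s \<in> f ` Zsqrt2 \<and> (x - s) / a \<in> Zsqrt2"
    proof (rule ex1I[of _ "f x"])
      show "f x \<in> f ` Zsqrt2 \<and> (x - f x) / a \<in> Zsqrt2" using f[OF x] x by (auto simp: R_def)
      fix s assume s: "s \<in> f ` Zsqrt2 \<and> (x - s) / a \<in> Zsqrt2"
      then obtain y where y: "y \<in> Zsqrt2" "s = f y" by blast
      have "R x s" using s x f[OF y(1)] y by (simp add: R_def)
      then have "R x y" using f[OF y(1)] y Rsym Rtrans by blast
      then show "s = f x" using fcong y by simp
    qed
  qed
  then show ?thesis by blast
qed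

text \<open>Two-digit expansion modulo a * b: s is the residue of x modulo a, and t is the residue
  of (x - s) / a modulo b.\<close>

lemma transversal_mult:
  assumes a: "a \<in> Zsqrt2" "a \<noteq> 0" "transversal a S" and b: "b \<in> Zsqrt2" "b \<noteq> 0" "transversal b T"
  shows "\<exists>U. transversal (a * b) U \<and> card U = card S * card T"
proof -
  define f where "f = (\<lambda>(s, t). s + a * t)"
  have SZ: "S \<subseteq> Zsqrt2" and TZ: "T \<subseteq> Zsqrt2" using a b by (auto simp: transversal_def)
  have uS: "s = s'" if "s \<in> S" "s' \<in> S" "x \<in> Zsqrt2" "(x - s) / a \<in> Zsqrt2" "(x - s') / a \<in> Zsqrt2" for s s' x
    using a(3) that unfolding transversal_def by metis
  have uT: "s = s'" if "s \<in> T" "s' \<in> T" "x \<in> Zsqrt2" "(x - s) / b \<in> Zsqrt2" "(x - s') / b \<in> Zsqrt2" for s s' x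
    using b(3) that unfolding transversal_def by metis
  have key: "s = s' \<and> t = t'"
    if st: "s \<in> S" "s' \<in> S" "t \<in> T" "t' \<in> T" and x: "x \<in> Zsqrt2"
      and 1: "(x - f (s, t)) / (a * b) \<in> Zsqrt2" and 2: "(x - f (s', t')) / (a * b) \<in> Zsqrt2" for s s' t t' x
  proof -
    have red: "(x - s) / a \<in> Zsqrt2 \<and> (((x - s) / a) - t) / b \<in> Zsqrt2"
      if "(x - f (s, t)) / (a * b) \<in> Zsqrt2" "t \<in> T" for s t
    proof -
      have e: "(((x - s) / a) - t) / b = (x - f (s, t)) / (a * b)"
        using a b by (simp add: f_def field_simps)
      then have "(((x - s) / a) - t) / b \<in> Zsqrt2" using that by simp
      moreover have "(x - s) / a = (((x - s) / a) - t) / b * b + t" using b by simp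
      then have "(x - s) / a \<in> Zsqrt2" using calculation b that TZ by (metis Zsqrt2_add Zsqrt2_mult subsetD)
      ultimately show ?thesis by simp
    qed
    note r1 = red[OF 1 st(3)] and r2 = red[OF 2 st(4)]
    have "s = s'" using uS[OF st(1,2) x] r1 r2 by blast
    then show ?thesis using uT[OF st(3,4), of "(x - s) / a"] r1 r2 by simp
  qed
  have "inj_on f (S \<times> T)"
  proof (rule inj_onI)
    fix p q assume pq: "p \<in> S \<times> T" "q \<in> S \<times> T" "f p = f q"
    have "f p \<in> Zsqrt2" using pq(1) SZ TZ a by (auto simp: f_def intro!: Zsqrt2_add Zsqrt2_mult)
    then show "p = q" using key[of "fst p" "fst q" "snd p" "snd q" "f p"] pq by (auto simp: prod_eq_iff)
  qed
  then have "card (f ` (S \<times> T)) = card S * card T" by (simp add: card_image card_cartesian_product)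
  moreover have "transversal (a * b) (f ` (S \<times> T))"
    unfolding transversal_def
  proof (intro conjI ballI)
    show "f ` (S \<times> T) \<subseteq> Zsqrt2" using SZ TZ a by (auto simp: f_def intro!: Zsqrt2_add Zsqrt2_mult)
    fix x assume x: "x \<in> Zsqrt2"
    obtain s where s: "s \<in> S" "(x - s) / a \<in> Zsqrt2" using a(3) x by (auto simp: transversal_def)
    obtain t where t: "t \<in> T" "((x - s) / a - t) / b \<in> Zsqrt2" using b(3) s(2) by (auto simp: transversal_def)
    have e: "(((x - s) / a) - t) / b = (x - f (s, t)) / (a * b)"
      using a b by (simp add: f_def field_simps)
    show "\<exists>!u. u \<in> f ` (S \<times> T) \<and> (x - u) / (a * b) \<in> Zsqrt2"
    proof (rule ex1I[of _ "f (s, t)"])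
      show "f (s, t) \<in> f ` (S \<times> T) \<and> (x - f (s, t)) / (a * b) \<in> Zsqrt2" using s t e by auto
      fix u assume u: "u \<in> f ` (S \<times> T) \<and> (x - u) / (a * b) \<in> Zsqrt2"
      then obtain s' t' where st: "s' \<in> S" "t' \<in> T" "u = f (s', t')" by blast
      have 1: "(x - f (s', t')) / (a * b) \<in> Zsqrt2" using u st by simp
      have 2: "(x - f (s, t)) / (a * b) \<in> Zsqrt2" using t(2) e by simp
      show "u = f (s, t)" using key[OF st(1) s(1) st(2) t(1) x 1 2] st by simp
    qed
  qed
  ultimately show ?thesis by blast
qed

text \<open>Conjugation is a ring automorphism of Z[sqrt 2], so it carries congruences modulo a to
  congruences modulo \<open>cj a\<close>.\<close>

lemma transversal_cj:
  assumes "a \<in> Zsqrt2" "transversal a S"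
  shows "transversal (cj a) (cj ` S)" "card (cj ` S) = card S"
proof -
  have SZ: "S \<subseteq> Zsqrt2" using assms by (auto simp: transversal_def)
  have cjcj: "cj (cj x) = x" if "x \<in> Zsqrt2" for x using that by (simp add: cj_cj)
  have "inj_on cj S" using SZ cjcj by (metis inj_onI subsetD)
  then show "card (cj ` S) = card S" by (rule card_image)
  have iff: "(x - cj s) / cj a \<in> Zsqrt2 \<longleftrightarrow> (cj x - s) / a \<in> Zsqrt2" if "x \<in> Zsqrt2" "s \<in> Zsqrt2" for x s
  proof -
    have "cj ((cj x - s) / a) = (x - cj s) / cj a" "cj ((x - cj s) / cj a) = (cj x - s) / a"
      using that assms by (simp_all add: cj_divide cj_diff cjcj)
    then show ?thesis by (metis cj_Zsqrt2_closed)
  qed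
  show "transversal (cj a) (cj ` S)"
    unfolding transversal_def
  proof (intro conjI ballI)
    show "cj ` S \<subseteq> Zsqrt2" using SZ by auto
    fix x assume x: "x \<in> Zsqrt2"
    then obtain s where s: "s \<in> S" "(cj x - s) / a \<in> Zsqrt2"
      and u: "\<And>s'. s' \<in> S \<Longrightarrow> (cj x - s') / a \<in> Zsqrt2 \<Longrightarrow> s' = s"
      using assms(2) unfolding transversal_def by (metis cj_Zsqrt2_closed)
    show "\<exists>!t. t \<in> cj ` S \<and> (x - t) / cj a \<in> Zsqrt2"
    proof (rule ex1I[of _ "cj s"])
      show "cj s \<in> cj ` S \<and> (x - cj s) / cj a \<in> Zsqrt2" using s iff[OF x] SZ by blast
      fix t assume t: "t \<in> cj ` S \<and> (x - t) / cj a \<in> Zsqrt2"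
      then obtain s' where s': "s' \<in> S" "t = cj s'" by blast
      then have "(cj x - s') / a \<in> Zsqrt2" using t iff[OF x, of s'] SZ by blast
      then show "t = cj s" using u s' by simp
    qed
  qed
qed

lemma Zsqrt2_div_nat:
  assumes "n > 0"
  shows "(of_int p + of_int q * sqrt 2) / real n \<in> Zsqrt2 \<longleftrightarrow> int n dvd p \<and> int n dvd q"
proof
  assume "(of_int p + of_int q * sqrt 2) / real n \<in> Zsqrt2"
  then obtain a b :: int where "(of_int p + of_int q * sqrt 2) / real n = a + b * sqrt 2" by (rule Zsqrt2E)
  then have "of_int p + of_int q * sqrt 2 = real n * a + real n * b * sqrt 2"
    using assms by (simp add: field_simps)
  then have "of_int (p - int n * a) + of_int (q - int n * b) * sqrt 2 = (0 :: real)"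
    by (simp add: algebra_simps)
  then have "of_rat (of_int (p - int n * a)) + of_rat (of_int (q - int n * b)) * sqrt 2 = (0 :: real)"
    by (simp only: of_rat_of_int_eq)
  from sqrt2_indep[OF this] show "int n dvd p \<and> int n dvd q"
    by (metis dvd_triv_left eq_iff_diff_eq_0 of_int_eq_0_iff)
next
  assume "int n dvd p \<and> int n dvd q"
  then obtain a b where "p = int n * a" "q = int n * b" by (auto elim!: dvdE)
  then have "of_int p + of_int q * sqrt 2 = real n * (a + b * sqrt 2)" by (simp add: algebra_simps)
  then show "(of_int p + of_int q * sqrt 2) / real n \<in> Zsqrt2"
    using assms Zsqrt2I[of a b] by simp
qed

lemma transversal_nat:
  assumes n: "n > 0"
  shows "\<exists>S. transversal (real n) S \<and> card S = n\<^sup>2"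
proof -
  define f :: "int \<times> int \<Rightarrow> real" where "f = (\<lambda>(p, q). of_int p + of_int q * sqrt 2)"
  define B where "B = {0..<int n} \<times> {0..<int n}"
  have f: "(f (p, q) - f (p', q')) / real n \<in> Zsqrt2 \<longleftrightarrow> int n dvd (p - p') \<and> int n dvd (q - q')" for p q p' q'
    using Zsqrt2_div_nat[OF n, of "p - p'" "q - q'"] by (simp add: f_def algebra_simps)
  have eqB: "x = y" if "x \<in> {0..<int n}" "y \<in> {0..<int n}" "int n dvd (z - x)" "int n dvd (z - y)" for x y z
    using that by (metis atLeastLessThan_iff mod_eq_dvd_iff mod_pos_pos_trivial)
  have inj: "inj_on f B"
  proof (rule inj_onI)
    fix x y assume xy: "x \<in> B" "y \<in> B" "f x = f y"
    obtain p q p' q' where "x = (p, q)" "y = (p', q')" by (metis surj_pair)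
    then show "x = y" using f[of p q p' q'] eqB[of p p' p] eqB[of q q' q] xy by (auto simp: B_def)
  qed
  have "transversal (real n) (f ` B)"
    unfolding transversal_def
  proof (intro conjI ballI)
    show "f ` B \<subseteq> Zsqrt2" by (auto simp: f_def Zsqrt2I)
    fix x assume "x \<in> Zsqrt2"
    then obtain p q :: int where "x = of_int p + of_int q * sqrt 2" by (rule Zsqrt2E)
    then have x: "x = f (p, q)" by (simp add: f_def)
    have m: "int n dvd (p - p mod int n)" "int n dvd (q - q mod int n)" for p q
      by (simp_all add: minus_mod_eq_mult_div)
    have B: "(p mod int n, q mod int n) \<in> B" using n by (simp add: B_def)
    show "\<exists>!s. s \<in> f ` B \<and> (x - s) / real n \<in> Zsqrt2"
    proof (rule ex1I[of _ "f (p mod int n, q mod int n)"])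
      show "f (p mod int n, q mod int n) \<in> f ` B \<and> (x - f (p mod int n, q mod int n)) / real n \<in> Zsqrt2"
        using B m unfolding x f by blast
      fix s assume "s \<in> f ` B \<and> (x - s) / real n \<in> Zsqrt2"
      then obtain p' q' where pq: "(p', q') \<in> B" "s = f (p', q')" "(x - f (p', q')) / real n \<in> Zsqrt2" by auto
      then have d: "int n dvd (p - p')" "int n dvd (q - q')" unfolding x f by blast+
      have "p' = p mod int n" using eqB[of p' "p mod int n" p] pq(1) B d(1) m(1) by (simp add: B_def)
      moreover have "q' = q mod int n" using eqB[of q' "q mod int n" q] pq(1) B d(2) m(2) by (simp add: B_def)
      ultimately show "s = f (p mod int n, q mod int n)" using pq(2) by simp
    qed
  qed
  moreover have "card (f ` B) = n\<^sup>2"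
    using inj by (simp add: card_image B_def card_cartesian_product power2_eq_square)
  ultimately show ?thesis by blast
qed

text \<open>The quotients by \<open>a\<close> and by \<open>\<sigma>(a)\<close> have equal size, and the product of the two sizes is
  that of the quotient by the integer \<open>N(a)\<close>.\<close>

lemma card_Quot_multiples:
  assumes a: "a \<in> Zsqrt2" "a \<noteq> 0"
  shows "real (card (carrier (RZ Quot multiples a))) = \<bar>nrm a\<bar>"
proof -
  obtain k where k: "nrm a = of_int k" using nrm_Ints[OF a(1)] by (rule Ints_cases)
  define n where "n = nat \<bar>k\<bar>"
  have n: "real n = \<bar>nrm a\<bar>" by (simp add: n_def k)
  then have n0: "n > 0" using nrm_ge_1[OF a] by linarith
  obtain S where S: "transversal a S" using transversal_exists by blast
  have cja: "cj a \<in> Zsqrt2" "cj a \<noteq> 0" using a cj_eq_0[of a] by auto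
  obtain U where U: "transversal (a * cj a) U" "card U = card S * card S"
    using transversal_mult[OF a S cja transversal_cj(1)[OF a(1) S]] transversal_cj(2)[OF a(1) S] by auto
  obtain T where T: "transversal (real n) T" "card T = n\<^sup>2" using transversal_nat[OF n0] by blast
  \<comment> \<open>The norm may be negative, but an ideal does not see the sign of its
    generator.\<close>
  have "real n = a * cj a \<or> real n = - (a * cj a)" using n by (auto simp: nrm_cj)
  then have "multiples (real n) = multiples (a * cj a)"
    using multiples_uminus by metis
  then have "card U = card T"
    using card_Quot_transversal[OF _ U(1)] card_Quot_transversal[OF _ T(1)] a cja n0 by simp
  then have "(card S)\<^sup>2 = n\<^sup>2" using U T by (simp add: power2_eq_square)
  then have "card S = n" by simp
  then show ?thesis using card_Quot_transversal[OF a(2) S] n by simp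
qed

text \<open>The term of the ideal (a) in the zeta series at 2, and at the same time the proportion
  of points of Z[zeta] that are divisible by a.\<close>

definition wt :: "real \<Rightarrow> real" where "wt a = 1 / (nrm a)\<^sup>2"

lemma wt_nonneg [simp]: "wt a \<ge> 0"
  by (simp add: wt_def)

lemma wt_mult: "a \<in> Zsqrt2 \<Longrightarrow> b \<in> Zsqrt2 \<Longrightarrow> wt (a * b) = wt a * wt b"
  by (simp add: wt_def nrm_mult power_mult_distrib)

lemma wt_1 [simp]: "wt 1 = 1"
  by (simp add: wt_def)

lemma wt_le_1: "a \<in> Zsqrt2 \<Longrightarrow> a \<noteq> 0 \<Longrightarrow> wt a \<le> 1"
proof -
  assume "a \<in> Zsqrt2" "a \<noteq> 0"
  then have "1\<^sup>2 \<le> \<bar>nrm a\<bar>\<^sup>2" using nrm_ge_1 by (intro power_mono) auto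
  then show ?thesis by (auto simp: wt_def divide_simps)
qed

lemma wt_PP_less_1:
  assumes "p \<in> PP" shows "wt p < 1"
proof -
  note p = PP_D[OF assms]
  have "\<bar>nrm p\<bar> \<noteq> 1" using Zsqrt2_unit_iff[of p] p by simp
  then have "1 < \<bar>nrm p\<bar>" using nrm_ge_1[of p] p by simp
  then have "1\<^sup>2 < \<bar>nrm p\<bar>\<^sup>2" by (intro power_strict_mono) auto
  then show ?thesis by (simp add: wt_def divide_less_eq_1)
qed

section \<open>Convergence of the zeta series at 2\<close>

lemma dedekind_zeta_Reps: "dedekind_zeta RZ 2 = (\<Sum>\<^sub>\<infinity>a\<in>Reps. wt a)"
proof -
  have "dedekind_zeta RZ 2 = (\<Sum>\<^sub>\<infinity>a\<in>Reps. 1 / real (card (carrier (RZ Quot multiples a))) powr 2)"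
    unfolding dedekind_zeta_def by (rule infsum_reindex_bij_betw[OF bij_multiples, symmetric])
  also have "\<dots> = (\<Sum>\<^sub>\<infinity>a\<in>Reps. wt a)"
  proof (rule infsum_cong)
    fix a assume "a \<in> Reps"
    then have "a \<in> Zsqrt2" "a \<noteq> 0" by (auto simp: Reps_def)
    then show "1 / real (card (carrier (RZ Quot multiples a))) powr 2 = wt a"
      by (simp add: card_Quot_multiples wt_def nrm_eq_0)
  qed
  finally show ?thesis .
qed

text \<open>An element a of \<open>Reps\<close> is bounded, so its conjugate a - 2 sqrt 2 v, and
  with it the norm, grows linearly in |v|. The summand 1 in the denominator makes the bound cover v
  = 0.\<close>

lemma wt_le_coordinate:
  assumes "of_int u + of_int v * sqrt 2 \<in> Reps"
  shows "wt (of_int u + of_int v * sqrt 2) \<le> 13 / (1 + (real (nat (abs v)))\<^sup>2)"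
proof -
  define a where "a = of_int u + of_int v * sqrt 2"
  have a: "1 \<le> a" "a < fund_unit" "a \<in> Zsqrt2" using assms by (auto simp: a_def Reps_def)
  define w where "w = real (nat (abs v))"
  have w: "w = \<bar>real_of_int v\<bar>" by (simp add: w_def)
  show ?thesis
  proof (cases "v = 0")
    case True
    have "wt a \<le> 1" using a by (intro wt_le_1) auto
    then show ?thesis using True by (simp add: a_def)
  next
    case False
    then have w1: "w \<ge> 1" unfolding w by linarith
    define s where "s = sqrt (2::real)"
    \<comment> \<open>The conjugate will be at least (sqrt 2 - 1) * w, hence at least 2/5 * w. This
      gives the weight bound 25 / (4 w^2), which for w >= 1 is at most 13 / (1 + w^2).\<close>
    have s: "s > 7 / 5" unfolding s_def by (rule real_less_rsqrt) (simp add: power2_eq_square)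
    have cj: "cj a = a - 2 * s * v" unfolding a_def cj_Zsqrt2 s_def by simp
    have "\<bar>2 * s * v\<bar> = 2 * s * w" using s by (simp add: abs_mult w)
    then have "\<bar>cj a\<bar> \<ge> 2 * s * w - \<bar>a\<bar>" unfolding cj by linarith
    also have "2 * s * w - \<bar>a\<bar> \<ge> 2 * s * w - (1 + s) * w"
    proof -
      have "\<bar>a\<bar> \<le> 1 + s" using a by (simp add: fund_unit_def s_def)
      also have "\<dots> \<le> (1 + s) * w" using w1 s by simp
      finally show ?thesis by simp
    qed
    finally have "\<bar>cj a\<bar> \<ge> (s - 1) * w" by (simp add: algebra_simps)
    also have "(s - 1) * w \<ge> 2 / 5 * w" using s w1 by (intro mult_right_mono) auto
    finally have "\<bar>cj a\<bar> \<ge> 2 / 5 * w" by simp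
    moreover have "1 * \<bar>cj a\<bar> \<le> \<bar>a\<bar> * \<bar>cj a\<bar>" using a by (intro mult_right_mono) auto
    ultimately have n: "2 / 5 * w \<le> \<bar>nrm a\<bar>" by (simp add: nrm_cj abs_mult)
    then have "(2 / 5 * w)\<^sup>2 \<le> \<bar>nrm a\<bar>\<^sup>2" using w1 by (intro power_mono) auto
    then have n2: "4 / 25 * w\<^sup>2 \<le> (nrm a)\<^sup>2" by (simp add: power_mult_distrib power_divide)
    have w2: "w\<^sup>2 \<ge> 1" using w1 by simp
    then have "w\<^sup>2 > 0" "(nrm a)\<^sup>2 > 0" using n2 by linarith+
    then have "wt a \<le> 1 / (4 / 25 * w\<^sup>2)"
      unfolding wt_def using n2 by (intro divide_left_mono mult_pos_pos) simp_all
    also have "\<dots> \<le> 13 / (1 + w\<^sup>2)" using w2 by (simp add: divide_simps)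
    finally show ?thesis by (simp add: a_def w_def)
  qed
qed

text \<open>Recovers |v| from u + v sqrt 2, because the difference to the conjugate is 2 sqrt 2 v.
  On Z[sqrt 2] the floor only serves to produce a natural number.\<close>

definition level :: "real \<Rightarrow> nat" where
  "level a = nat \<lfloor>\<bar>a - cj a\<bar> / (2 * sqrt 2)\<rfloor>"

lemma level_eq: "level (of_int u + of_int v * sqrt 2) = nat (abs v)"
proof -
  have e: "\<bar>(of_int u + of_int v * sqrt 2) - cj (of_int u + of_int v * sqrt 2)\<bar> / (2 * sqrt 2) = of_int (abs v)"
    unfolding cj_Zsqrt2 by (simp add: abs_mult)
  show ?thesis unfolding level_def e floor_of_int ..
qed

text \<open>There are at most two choices of v; for each, u ranges over a half-open interval of
  length sqrt 2 < 2, which contains at most two integers.\<close>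

lemma card_Reps_level: "finite {a \<in> Reps. level a = n}" "card {a \<in> Reps. level a = n} \<le> 4"
proof -
  define f :: "int \<times> int \<Rightarrow> real" where
    "f = (\<lambda>(v, i). of_int (\<lceil>1 - of_int v * sqrt 2\<rceil> + i) + of_int v * sqrt 2)"
  have sub: "{a \<in> Reps. level a = n} \<subseteq> f ` ({int n, - int n} \<times> {0, 1})"
  proof
    fix a assume a: "a \<in> {a \<in> Reps. level a = n}"
    then have "a \<in> Zsqrt2" by (auto simp: Reps_def)
    then obtain u v :: int where uv: "a = of_int u + of_int v * sqrt 2" by (rule Zsqrt2E)
    have "v \<in> {int n, - int n}" using a by (auto simp: uv level_eq)
    moreover have "u - \<lceil>1 - of_int v * sqrt 2\<rceil> \<in> {0, 1}"
    proof -
      have "1 \<le> of_int u + of_int v * sqrt 2" "of_int u + of_int v * sqrt 2 < 1 + sqrt 2"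
        using a by (auto simp: uv Reps_def fund_unit_def)
      moreover have "sqrt 2 < (2::real)" using real_sqrt_less_mono[of 2 4] by simp
      ultimately have "\<lceil>1 - of_int v * sqrt 2\<rceil> \<le> u" "u < \<lceil>1 - of_int v * sqrt 2\<rceil> + 2" by linarith+
      then show ?thesis by auto
    qed
    moreover have "a = f (v, u - \<lceil>1 - of_int v * sqrt 2\<rceil>)" by (simp add: f_def uv)
    ultimately show "a \<in> f ` ({int n, - int n} \<times> {0, 1})" by blast
  qed
  then show "finite {a \<in> Reps. level a = n}" by (rule finite_subset) simp
  have "card {a \<in> Reps. level a = n} \<le> card (f ` ({int n, - int n} \<times> {0, 1}))"
    using sub by (intro card_mono) auto
  also have "\<dots> \<le> card ({int n, - int n} \<times> {0 :: int, 1})" by (rule card_image_le) simp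
  also have "\<dots> \<le> 4" by (simp add: card_cartesian_product card_insert_if)
  finally show "card {a \<in> Reps. level a = n} \<le> 4" .
qed

lemma wt_summable: "wt summable_on Reps"
proof (rule nonneg_bdd_above_summable_on)
  \<comment> \<open>52 = 4 * 13: at most four elements on each level, each of weight at most 13 / (1
    + n^2).\<close>
  define g where "g n = 52 / (1 + (real n)\<^sup>2)" for n
  have "summable (\<lambda>n. inverse (real n ^ 2))" by (rule inverse_power_summable) simp
  then have "summable (\<lambda>n. 52 * inverse (real n ^ 2))" by (rule summable_mult)
  then have sg: "summable g"
  proof (rule summable_comparison_test'[where N = 1])
    fix n :: nat assume "n \<ge> 1"
    then have "52 / (1 + (real n)\<^sup>2) \<le> 52 / (real n)\<^sup>2"
      by (intro divide_left_mono) (auto intro!: mult_pos_pos add_pos_nonneg)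
    moreover have "g n \<ge> 0" by (simp add: g_def)
    ultimately show "norm (g n) \<le> 52 * inverse (real n ^ 2)" by (simp add: g_def divide_inverse)
  qed
  have bound: "sum wt F \<le> suminf g" if F: "finite F" "F \<subseteq> Reps" for F
  proof -
    have "sum wt F = (\<Sum>n\<in>level ` F. \<Sum>a\<in>{a \<in> F. level a = n}. wt a)"
      using F(1) by (rule sum.image_gen)
    also have "\<dots> \<le> (\<Sum>n\<in>level ` F. g n)"
    proof (rule sum_mono)
      fix n
      have "wt a \<le> 13 / (1 + (real n)\<^sup>2)" if a: "a \<in> {a \<in> F. level a = n}" for a
      proof -
        have "a \<in> Zsqrt2" "a \<in> Reps" using a F by (auto simp: Reps_def)
        then obtain u v :: int where uv: "a = of_int u + of_int v * sqrt 2" by (elim Zsqrt2E)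
        then have "nat (abs v) = n" using a by (auto simp: level_eq)
        then show ?thesis using wt_le_coordinate[of u v] \<open>a \<in> Reps\<close> uv by simp
      qed
      then have "(\<Sum>a\<in>{a \<in> F. level a = n}. wt a) \<le> real (card {a \<in> F. level a = n}) * (13 / (1 + (real n)\<^sup>2))"
        using sum_bounded_above[of "{a \<in> F. level a = n}" wt "13 / (1 + (real n)\<^sup>2)"] by simp
      also have "\<dots> \<le> 4 * (13 / (1 + (real n)\<^sup>2))"
      proof (rule mult_right_mono)
        have "card {a \<in> F. level a = n} \<le> card {a \<in> Reps. level a = n}"
          using F card_Reps_level(1) by (intro card_mono) auto
        then show "real (card {a \<in> F. level a = n}) \<le> 4" using card_Reps_level(2)[of n] by simp
      qed simp
      finally show "(\<Sum>a\<in>{a \<in> F. level a = n}. wt a) \<le> g n" by (simp add: g_def)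
    qed
    also have "\<dots> \<le> suminf g"
      using F by (intro sum_le_suminf[OF sg]) (auto simp: g_def)
    finally show ?thesis .
  qed
  then show "bdd_above (sum wt ` {F. F \<subseteq> Reps \<and> finite F})"
    by (intro bdd_aboveI[where M = "suminf g"]) auto
qed simp

lemma wt_summable_subset: "A \<subseteq> Reps \<Longrightarrow> wt summable_on A"
  using summable_on_subset_banach[OF wt_summable] .

section \<open>Sifting ideals by finitely many primes\<close>

lemma PP_not_dvd:
  assumes "p \<in> PP" "q \<in> PP" "p \<noteq> q"
  shows "q / p \<notin> Zsqrt2"
proof
  note pp = PP_D[OF assms(1)] and qq = PP_D[OF assms(2)]
  assume qp: "q / p \<in> Zsqrt2"
  have "p / q \<notin> Zsqrt2" using Reps_unique[of p q] pp qq qp assms(3) by blast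
  moreover have "(q / p) / q \<notin> Zsqrt2" using pp qq by simp
  ultimately show False using PP_dvd_mult[OF assms(2) pp(1) qp] pp qq by simp
qed

definition RepsQ :: "real set \<Rightarrow> real set" where
  "RepsQ Q = {a \<in> Reps. \<forall>q\<in>Q. a / q \<notin> Zsqrt2}"

text \<open>Multiplication by p, renormalised by a unit, maps the ideals prime to Q bijectively onto
  those that are also divisible by p, since no element of Q divides p. The weight is multiplicative
  and ignores units.\<close>

lemma infsum_RepsQ_dvd:
  assumes p: "p \<in> PP" "p \<notin> Q" and Q: "Q \<subseteq> PP"
  shows "(\<Sum>\<^sub>\<infinity>a\<in>{a \<in> RepsQ Q. a / p \<in> Zsqrt2}. wt a) = wt p * (\<Sum>\<^sub>\<infinity>a\<in>RepsQ Q. wt a)"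
proof -
  note pp = PP_D[OF p(1)]
  define l where "l = fund_unit"
  have l: "l > 1" "l \<in> Zsqrt2" "1 / l \<in> Zsqrt2" "l \<noteq> 0" using fund_unit_gt_1 by (auto simp: l_def)
  have wtl: "wt (1 / l) = 1" using l nrm_divide[of 1 l] nrm_fund_unit by (simp add: wt_def l_def)
  \<comment> \<open>Since p * a lies between 1 and fund_unit^2, at most one division by the unit
    brings it back to \<open>Reps\<close>; g reverses this.\<close>
  define f where "f a = (if p * a < l then p * a else p * a * (1 / l))" for a
  define g where "g b = (if b / p \<ge> 1 then b / p else b / p * l)" for b
  have wtf: "wt (f a) = wt p * wt a" if "a \<in> RepsQ Q" for a
  proof -
    have "a \<in> Zsqrt2" using that by (auto simp: RepsQ_def Reps_def)
    then show ?thesis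
      using wt_mult[of "p * a" "1 / l"] wt_mult[of p a] pp(1) l(3) wtl by (simp add: f_def)
  qed
  have ul: "x * l \<in> Zsqrt2 \<longleftrightarrow> x \<in> Zsqrt2" "x * (1 / l) \<in> Zsqrt2 \<longleftrightarrow> x \<in> Zsqrt2" for x
  proof -
    have "x * l * (1 / l) = x" "x * (1 / l) * l = x" using l(4) by simp_all
    then show "x * l \<in> Zsqrt2 \<longleftrightarrow> x \<in> Zsqrt2" "x * (1 / l) \<in> Zsqrt2 \<longleftrightarrow> x \<in> Zsqrt2"
      using l(2,3) Zsqrt2_mult by metis+
  qed
  have fq: "f a / c \<in> Zsqrt2 \<longleftrightarrow> p * a / c \<in> Zsqrt2" for a c
    using ul(2)[of "p * a / c"] by (simp add: f_def mult.commute)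
  have gq: "g b / c \<in> Zsqrt2 \<longleftrightarrow> b / p / c \<in> Zsqrt2" for b c
    using ul(1)[of "b / p / c"] by (simp add: g_def mult.commute)
  have "bij_betw f (RepsQ Q) {a \<in> RepsQ Q. a / p \<in> Zsqrt2}"
  proof (rule bij_betw_byWitness[where f' = g])
    show "\<forall>a\<in>RepsQ Q. g (f a) = a"
    proof
      fix a assume "a \<in> RepsQ Q"
      then have "1 \<le> a" "a < l" by (auto simp: RepsQ_def Reps_def l_def)
      then show "g (f a) = a" using pp l by (auto simp: f_def g_def field_simps)
    qed
    show "\<forall>b\<in>{a \<in> RepsQ Q. a / p \<in> Zsqrt2}. f (g b) = b"
    proof
      fix b assume "b \<in> {a \<in> RepsQ Q. a / p \<in> Zsqrt2}"
      then have "1 \<le> b" "b < l" by (auto simp: RepsQ_def Reps_def l_def)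
      then show "f (g b) = b" using pp l by (auto simp: f_def g_def)
    qed
    show "f ` RepsQ Q \<subseteq> {a \<in> RepsQ Q. a / p \<in> Zsqrt2}"
    proof
      fix b assume "b \<in> f ` RepsQ Q"
      then obtain a where a: "a \<in> RepsQ Q" "b = f a" by blast
      then have aR: "a \<in> Zsqrt2" "1 \<le> a" "a < l" by (auto simp: RepsQ_def Reps_def l_def)
      have pa: "1 \<le> p * a" "p * a < l * l"
        using pp aR l mult_mono[of 1 p 1 a] mult_strict_mono[of p l a l] by (auto simp: l_def)
      have "1 \<le> f a" "f a < l" using pa l by (auto simp: f_def field_simps)
      moreover have "f a \<in> Zsqrt2" using fq[of a 1] pp aR by simp
      moreover have "f a / q \<notin> Zsqrt2" if q: "q \<in> Q" for q
      proof -
        have "q \<in> PP" "p \<noteq> q" using p Q q by auto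
        then show ?thesis
          using a(1) q PP_not_dvd[of q p] PP_dvd_mult[of q p a] aR pp p(1) unfolding fq by (auto simp: RepsQ_def)
      qed
      moreover have "f a / p \<in> Zsqrt2" unfolding fq using pp aR by simp
      ultimately show "b \<in> {a \<in> RepsQ Q. a / p \<in> Zsqrt2}" using a(2) by (simp add: RepsQ_def Reps_def l_def)
    qed
    show "g ` {a \<in> RepsQ Q. a / p \<in> Zsqrt2} \<subseteq> RepsQ Q"
    proof
      fix c assume "c \<in> g ` {a \<in> RepsQ Q. a / p \<in> Zsqrt2}"
      then obtain b where b: "b \<in> RepsQ Q" "b / p \<in> Zsqrt2" "c = g b" by blast
      then have bR: "1 \<le> b" "b < l" by (auto simp: RepsQ_def Reps_def l_def)
      have "l * 1 \<le> l * b" using bR l by (intro mult_left_mono) auto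
      then have "p < l * b" using pp unfolding l_def by linarith
      then have "1 < l * b / p" using pp by simp
      then have "1 \<le> g b" by (auto simp: g_def field_simps)
      moreover have "b / p < l" using bR pp l mult_strict_mono'[of b l 1 p] by (auto simp: field_simps)
      then have "g b < l" using l mult_strict_right_mono[of "b / p" 1 l] by (auto simp: g_def)
      moreover have "g b \<in> Zsqrt2" using gq[of b 1] b by simp
      moreover have "g b / q \<notin> Zsqrt2" if q: "q \<in> Q" for q
      proof
        assume "g b / q \<in> Zsqrt2"
        then have "p * (b / p / q) \<in> Zsqrt2" using pp unfolding gq by (intro Zsqrt2_mult)
        then show False using b(1) q pp by (auto simp: RepsQ_def)
      qed
      ultimately show "c \<in> RepsQ Q" using b(3) by (simp add: RepsQ_def Reps_def l_def)
    qed
  qed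
  then have "(\<Sum>\<^sub>\<infinity>a\<in>{a \<in> RepsQ Q. a / p \<in> Zsqrt2}. wt a) = (\<Sum>\<^sub>\<infinity>a\<in>RepsQ Q. wt (f a))"
    by (rule infsum_reindex_bij_betw[symmetric])
  also have "\<dots> = (\<Sum>\<^sub>\<infinity>a\<in>RepsQ Q. wt p * wt a)" by (rule infsum_cong) (rule wtf)
  also have "\<dots> = wt p * (\<Sum>\<^sub>\<infinity>a\<in>RepsQ Q. wt a)" by (rule infsum_cmult_right')
  finally show ?thesis .
qed

text \<open>Including a further prime p removes the fraction \<open>wt p\<close> of the sum sifted
  so far.\<close>

lemma infsum_RepsQ:
  assumes "finite Q" "Q \<subseteq> PP"
  shows "(\<Sum>\<^sub>\<infinity>a\<in>RepsQ Q. wt a) = (\<Prod>q\<in>Q. 1 - wt q) * dedekind_zeta RZ 2"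
  using assms
proof (induction Q)
  case empty
  then show ?case by (simp add: RepsQ_def dedekind_zeta_Reps)
next
  case (insert p Q)
  have sub: "{a \<in> RepsQ Q. a / p \<in> Zsqrt2} \<subseteq> RepsQ Q" "RepsQ Q \<subseteq> Reps" by (auto simp: RepsQ_def)
  have "RepsQ (insert p Q) = RepsQ Q - {a \<in> RepsQ Q. a / p \<in> Zsqrt2}" by (auto simp: RepsQ_def)
  then have "(\<Sum>\<^sub>\<infinity>a\<in>RepsQ (insert p Q). wt a)
      = (\<Sum>\<^sub>\<infinity>a\<in>RepsQ Q. wt a) - (\<Sum>\<^sub>\<infinity>a\<in>{a \<in> RepsQ Q. a / p \<in> Zsqrt2}. wt a)"
    using sub by (simp only:) (intro infsum_Diff wt_summable_subset; blast)
  also have "\<dots> = (1 - wt p) * (\<Sum>\<^sub>\<infinity>a\<in>RepsQ Q. wt a)"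
    using insert by (simp add: infsum_RepsQ_dvd algebra_simps)
  finally show ?case using insert by simp
qed

text \<open>All ideals of large norm are included, not only primes, because this quantity has to
  dominate two errors: the excess of a sifted zeta series over 1, and the number of points divisible
  by a large prime.\<close>

definition tail :: "real \<Rightarrow> real" where
  "tail X = (\<Sum>\<^sub>\<infinity>a\<in>{a \<in> Reps. \<bar>nrm a\<bar> > X}. wt a)"

lemma tail_nonneg: "tail X \<ge> 0"
  unfolding tail_def by (rule infsum_nonneg) simp

lemma tail_tendsto_0: "(tail \<longlongrightarrow> 0) at_top"
proof (rule tendstoI)
  fix e :: real assume e: "e > 0"
  define Z where "Z = (\<Sum>\<^sub>\<infinity>a\<in>Reps. wt a)"
  have "(wt has_sum Z) Reps" using wt_summable by (simp add: Z_def)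
  then have "eventually (\<lambda>F. dist (sum wt F) Z < e) (finite_subsets_at_top Reps)"
    using e unfolding has_sum_def by (rule tendstoD)
  then obtain F where F: "finite F" "F \<subseteq> Reps" "dist (sum wt F) Z < e"
    unfolding eventually_finite_subsets_at_top by blast
  define X0 where "X0 = Max (insert 0 ((\<lambda>a. \<bar>nrm a\<bar>) ` F))"
  have X0: "\<bar>nrm a\<bar> \<le> X0" if "a \<in> F" for a using F(1) that by (simp add: X0_def)
  show "eventually (\<lambda>X. dist (tail X) 0 < e) at_top"
    using eventually_ge_at_top[of X0]
  proof eventually_elim
    case (elim X)
    let ?T = "{a \<in> Reps. \<bar>nrm a\<bar> > X}"
    have disj: "F \<inter> ?T = {}" using X0 elim by force
    have "sum wt F + tail X = infsum wt (F \<union> ?T)"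
      unfolding tail_def using F disj by (subst infsum_Un_disjoint) (auto intro: wt_summable_subset)
    also have "\<dots> \<le> Z" unfolding Z_def using F by (intro infsum_mono_neutral wt_summable_subset wt_summable) auto
    finally show ?case using F(3) tail_nonneg[of X] by (simp add: dist_real_def)
  qed
qed

definition PPX :: "real \<Rightarrow> real set" where
  "PPX X = {p \<in> PP. \<bar>nrm p\<bar> \<le> X}"

lemma abs_cj_le_nrm: "p \<in> PP \<Longrightarrow> \<bar>cj p\<bar> \<le> \<bar>nrm p\<bar>"
  using PP_D[of p] mult_right_mono[of 1 "\<bar>p\<bar>" "\<bar>cj p\<bar>"] by (simp add: nrm_cj abs_mult)

lemma cmod_sigma8_of_real: "x \<in> Qsqrt2 \<Longrightarrow> cmod (sigma8 (of_real x)) = \<bar>cj x\<bar>"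
  by (simp add: sigma8_of_real)

lemma finite_PPX: "finite (PPX X)"
proof (rule finite_subset[OF _ finite_PP_bounded[of X]])
  show "PPX X \<subseteq> {p \<in> PP. cmod (sigma8 (of_real p)) \<le> X}"
    using abs_cj_le_nrm PP_D(7) by (fastforce simp: PPX_def cmod_sigma8_of_real)
qed

lemma PPX_product_bounds:
  assumes "X \<ge> 1"
  shows "1 \<le> (\<Prod>q\<in>PPX X. 1 - wt q) * dedekind_zeta RZ 2"
    and "(\<Prod>q\<in>PPX X. 1 - wt q) * dedekind_zeta RZ 2 \<le> 1 + tail X"
proof -
  have eq: "(\<Prod>q\<in>PPX X. 1 - wt q) * dedekind_zeta RZ 2 = (\<Sum>\<^sub>\<infinity>a\<in>RepsQ (PPX X). wt a)"
    using infsum_RepsQ[OF finite_PPX] by (simp add: PPX_def)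
  have one: "1 \<in> RepsQ (PPX X)"
    using fund_unit_gt_1 PP_D(6) by (auto simp: RepsQ_def Reps_def PPX_def)
  have sub: "RepsQ (PPX X) \<subseteq> {1} \<union> {a \<in> Reps. \<bar>nrm a\<bar> > X}"
  proof
    fix a assume a: "a \<in> RepsQ (PPX X)"
    then have aR: "a \<in> Reps" "a \<in> Zsqrt2" "a \<noteq> 0" by (auto simp: RepsQ_def Reps_def)
    have False if "a \<noteq> 1" "\<bar>nrm a\<bar> \<le> X"
    proof -
      \<comment> \<open>Only 1 is both normalised and a unit, so a has a prime divisor, and its norm
        is at most that of a.\<close>
      have "1 / a \<notin> Zsqrt2" using Reps_unique[of a 1] that aR fund_unit_gt_1 by (auto simp: Reps_def)
      then obtain p where p: "p \<in> PP" "a / p \<in> Zsqrt2" using PP_divisor_exists[of a] aR by blast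
      have "nrm a = nrm (a / p) * nrm p" using nrm_mult[of "a / p" p] p PP_D[OF p(1)] by simp
      moreover have "\<bar>nrm (a / p)\<bar> \<ge> 1" using p PP_D[OF p(1)] aR by (intro nrm_ge_1) auto
      ultimately have "\<bar>nrm p\<bar> \<le> \<bar>nrm a\<bar>"
        using mult_right_mono[of 1 "\<bar>nrm (a / p)\<bar>" "\<bar>nrm p\<bar>"] by (simp add: abs_mult)
      then have "p \<in> PPX X" using p that by (simp add: PPX_def)
      then show False using a p by (auto simp: RepsQ_def)
    qed
    then show "a \<in> {1} \<union> {a \<in> Reps. \<bar>nrm a\<bar> > X}" using aR by force
  qed
  have R1: "1 \<in> Reps" using fund_unit_gt_1 by (simp add: Reps_def)
  have "infsum wt {1} \<le> infsum wt (RepsQ (PPX X))"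
    using one by (intro infsum_mono_neutral wt_summable_subset) (auto simp: RepsQ_def)
  then show "1 \<le> (\<Prod>q\<in>PPX X. 1 - wt q) * dedekind_zeta RZ 2" unfolding eq by simp
  have "infsum wt (RepsQ (PPX X)) \<le> infsum wt ({1} \<union> {a \<in> Reps. \<bar>nrm a\<bar> > X})"
    using sub R1 by (intro infsum_mono_neutral wt_summable_subset) (auto simp: RepsQ_def)
  also have "\<dots> = 1 + tail X"
    unfolding tail_def using R1 assms by (subst infsum_Un_disjoint) (auto intro: wt_summable_subset)
  finally show "(\<Prod>q\<in>PPX X. 1 - wt q) * dedekind_zeta RZ 2 \<le> 1 + tail X" unfolding eq .
qed

section \<open>Densities of sifted cut-and-project sets\<close>

lemma frontier_scaleR_image:
  fixes S :: "'a::euclidean_space set"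
  assumes "c \<noteq> 0"
  shows "frontier ((\<lambda>x. c *\<^sub>R x) ` S) = (\<lambda>x. c *\<^sub>R x) ` frontier S"
proof -
  have lin: "linear (\<lambda>x :: 'a. c *\<^sub>R x)" and inj: "inj (\<lambda>x :: 'a. c *\<^sub>R x)"
    using assms by (auto simp: inj_def linear_iff scaleR_add_right)
  show ?thesis
    unfolding frontier_def closure_injective_linear_image[OF lin inj, symmetric]
      interior_injective_linear_image[OF lin inj] image_set_diff[OF inj] ..
qed

lemma measure_scaleR_image:
  fixes S :: "'a::euclidean_space set"
  shows "measure lebesgue ((\<lambda>x. c *\<^sub>R x) ` S) = \<bar>c\<bar> ^ DIM('a) * measure lebesgue S"
  using measure_lebesgue_affine[of c 0 S] by simp

lemma jordan_measurable_scaleR: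
  fixes S :: "'a::euclidean_space set"
  assumes "jordan_measurable S" "c \<noteq> 0"
  shows "jordan_measurable ((\<lambda>x. c *\<^sub>R x) ` S)"
proof -
  have "emeasure lebesgue (frontier S) = 0"
    using assms by (simp add: jordan_measurable_def negligible_iff_emeasure0)
  then have "emeasure lebesgue ((\<lambda>x. c *\<^sub>R x) ` frontier S) = 0"
    using emeasure_lebesgue_affine[of c 0 "frontier S"] by simp
  then have "negligible (frontier ((\<lambda>x. c *\<^sub>R x) ` S))"
    unfolding frontier_scaleR_image[OF assms(2), symmetric] by (simp add: negligible_iff_emeasure0)
  moreover have "bounded ((\<lambda>x. c *\<^sub>R x) ` S)" using assms by (simp add: jordan_measurable_def bounded_scaling)
  ultimately show ?thesis by (simp add: jordan_measurable_def)
qed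

lemma jordan_measurable_Int:
  assumes "jordan_measurable S" "jordan_measurable T"
  shows "jordan_measurable (S \<inter> T)"
proof -
  have "negligible (frontier (S \<inter> T))"
    using assms negligible_Un negligible_subset[OF _ frontier_Int_subset] by (auto simp: jordan_measurable_def)
  then show ?thesis using assms by (auto simp: jordan_measurable_def intro: bounded_Int)
qed

text \<open>The identities zeta^2 = sqrt 2 * zeta - 1 and zeta^3 = zeta - sqrt 2 exhibit 1, zeta as
  a basis over Z[sqrt 2]. Divisibility of a point by a real scalar thus becomes divisibility of two
  coordinates.\<close>

lemma Zzeta8_decompose:
  assumes "x \<in> Zzeta8"
  obtains u v where "u \<in> Zsqrt2" "v \<in> Zsqrt2" "x = of_real u + of_real v * zeta8"
proof -
  obtain a b c d where x: "x = z8 ((b, d), (a, c))" using assms by (rule z8E)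
  have "x = of_real (of_int (a - c) + of_int (- d) * sqrt 2) + of_real (of_int (b + d) + of_int c * sqrt 2) * zeta8"
    unfolding x z8_def zeta8_eq
    by (simp add: q8_eq complex_eq_iff of_rat_add of_rat_diff algebra_simps add_divide_distrib diff_divide_distrib)
  then show ?thesis using that Zsqrt2I by blast
qed

text \<open>For arbitrary real u and v, the imaginary part determines v and then the real part
  determines u.\<close>

lemma Zzeta8_components:
  assumes "of_real u + of_real v * zeta8 \<in> Zzeta8"
  shows "u \<in> Zsqrt2" "v \<in> Zsqrt2"
proof -
  obtain a b c d where x: "of_real u + of_real v * zeta8 = z8 ((b, d), (a, c))" using assms by (rule z8E)
  define h where "h = sqrt 2 / 2"
  have h: "h * sqrt 2 = 1" "h \<noteq> 0" "sqrt 2 = 2 * h" by (simp_all add: h_def)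
  have re: "u + v * h = of_int a + (of_int b - of_int d) * h" and im: "v * h = of_int c + (of_int b + of_int d) * h"
    using arg_cong[OF x, of Re] arg_cong[OF x, of Im] unfolding z8_def zeta8_eq
    by (simp_all only: q8_eq complex.sel case_prod_conv) (simp_all add: of_rat_add of_rat_diff h_def)
  have "v = v * h * sqrt 2" using h by simp
  also have "\<dots> = of_int (b + d) * (h * sqrt 2) + of_int c * sqrt 2"
    unfolding im by (simp add: algebra_simps)
  finally have v: "v = of_int (b + d) + of_int c * sqrt 2" unfolding h(1) by simp
  show "v \<in> Zsqrt2" unfolding v by (rule Zsqrt2I)
  have u: "u = of_int (a - c) + of_int (- d) * sqrt 2" using re im unfolding h(3) by (simp add: algebra_simps)
  show "u \<in> Zsqrt2" unfolding u by (rule Zsqrt2I)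
qed

lemma Zzeta8_divide_iff:
  "(of_real u + of_real v * zeta8) /\<^sub>R a \<in> Zzeta8 \<longleftrightarrow> u / a \<in> Zsqrt2 \<and> v / a \<in> Zsqrt2"
proof -
  have e: "(of_real u + of_real v * zeta8) /\<^sub>R a = of_real (u / a) + of_real (v / a) * zeta8"
    by (simp add: scaleR_conv_of_real divide_inverse algebra_simps)
  have z: "zeta8 \<in> Zzeta8" using z8_in[of "((1, 0), (0, 0))"] by (simp add: z8_def q8_def)
  show ?thesis unfolding e
  proof
    assume "u / a \<in> Zsqrt2 \<and> v / a \<in> Zsqrt2"
    then show "of_real (u / a) + of_real (v / a) * zeta8 \<in> Zzeta8"
      by (intro z8_add_closed z8_mult_closed of_real_Zzeta8 z) auto
  qed (rule conjI; erule Zzeta8_components)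
qed

lemma Zzeta8_comaximal_iff:
  assumes "comaximal a b" "a \<in> Zsqrt2" "b \<in> Zsqrt2" "a \<noteq> 0" "b \<noteq> 0" "x \<in> Zzeta8"
  shows "x /\<^sub>R (a * b) \<in> Zzeta8 \<longleftrightarrow> x /\<^sub>R a \<in> Zzeta8 \<and> x /\<^sub>R b \<in> Zzeta8"
proof -
  obtain u v where x: "u \<in> Zsqrt2" "v \<in> Zsqrt2" "x = of_real u + of_real v * zeta8"
    using assms(6) by (rule Zzeta8_decompose)
  have "w / (a * b) \<in> Zsqrt2 \<longleftrightarrow> w / a \<in> Zsqrt2 \<and> w / b \<in> Zsqrt2" for w
  proof
    assume "w / (a * b) \<in> Zsqrt2"
    then have "b * (w / (a * b)) \<in> Zsqrt2" "a * (w / (a * b)) \<in> Zsqrt2" using assms by (simp_all only: Zsqrt2_mult)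
    then show "w / a \<in> Zsqrt2 \<and> w / b \<in> Zsqrt2" using assms by simp
  qed (use comaximal_dvd_mult assms in blast)
  then show ?thesis unfolding x Zzeta8_divide_iff by blast
qed

section \<open>Densities under divisibility conditions\<close>

lemma finite_window:
  assumes "jordan_measurable D" "jordan_measurable V" "T > 0"
  shows "finite {x \<in> Zzeta8. x /\<^sub>R T \<in> D \<and> sigma8 x \<in> V}"
proof -
  have "{x \<in> Zzeta8. x /\<^sub>R T \<in> D \<and> sigma8 x \<in> V} = {x \<in> Zzeta8. (inverse T *\<^sub>R x, 1 *\<^sub>R sigma8 x) \<in> D \<times> V}"
    by auto
  then show ?thesis
    using balanced_lattice_count(1)[OF jordan_measurable_Times(1)[OF assms(1,2)], of "inverse T" 1] assms(3) by simp
qed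

text \<open>The substitution x = a y replaces D by D / a and V by V / sigma(a). Each planar area
  scales quadratically, so the volume is divided by (a * sigma(a))^2.\<close>

lemma density_multiples:
  assumes D: "jordan_measurable D" and V: "jordan_measurable V" and a: "a \<in> Zsqrt2" "a \<noteq> 0"
  shows "((\<lambda>T::real. real (card {x \<in> Zzeta8. x /\<^sub>R T \<in> D \<and> sigma8 x \<in> V \<and> x /\<^sub>R a \<in> Zzeta8}) / T\<^sup>2)
      \<longlongrightarrow> measure lebesgue D * measure lebesgue V / 4 / (nrm a)\<^sup>2) at_top"
proof -
  have cja: "cj a \<noteq> 0" using a cj_eq_0[of a] by simp
  define D' where "D' = (\<lambda>x. inverse a *\<^sub>R x) ` D"
  define V' where "V' = (\<lambda>x. inverse (cj a) *\<^sub>R x) ` V"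
  have inD: "x \<in> D' \<longleftrightarrow> a *\<^sub>R x \<in> D" for x
    using a by (force simp: D'_def)
  have inV: "x \<in> V' \<longleftrightarrow> cj a *\<^sub>R x \<in> V" for x
    using cja by (force simp: V'_def)
  have J: "jordan_measurable D'" "jordan_measurable V'"
    unfolding D'_def V'_def using D V a cja by (auto intro: jordan_measurable_scaleR)
  have "measure lebesgue D' * measure lebesgue V' / 4 = measure lebesgue D * measure lebesgue V / 4 / (nrm a)\<^sup>2"
    unfolding D'_def V'_def measure_scaleR_image nrm_cj using a cja
    by (simp add: power2_eq_square field_simps)
  moreover have "card {x \<in> Zzeta8. x /\<^sub>R T \<in> D \<and> sigma8 x \<in> V \<and> x /\<^sub>R a \<in> Zzeta8}
      = card {y \<in> Zzeta8. y /\<^sub>R T \<in> D' \<and> sigma8 y \<in> V'}" for T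
  proof (rule bij_betw_same_card[of "\<lambda>x. x /\<^sub>R a"], rule bij_betw_byWitness[where f' = "\<lambda>y. a *\<^sub>R y"])
    let ?X = "{x \<in> Zzeta8. x /\<^sub>R T \<in> D \<and> sigma8 x \<in> V \<and> x /\<^sub>R a \<in> Zzeta8}"
    let ?Y = "{y \<in> Zzeta8. y /\<^sub>R T \<in> D' \<and> sigma8 y \<in> V'}"
    have s: "sigma8 (a *\<^sub>R y) = cj a *\<^sub>R sigma8 y" if "y \<in> Zzeta8" for y
      using that a by (intro sigma8_scaleR) (auto simp: Zzeta8_Qzeta8)
    show "(\<lambda>x. x /\<^sub>R a) ` ?X \<subseteq> ?Y"
    proof
      fix y assume "y \<in> (\<lambda>x. x /\<^sub>R a) ` ?X"
      then obtain x where x: "x \<in> ?X" "y = x /\<^sub>R a" by blast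
      then have xy: "x = a *\<^sub>R y" "a *\<^sub>R (y /\<^sub>R T) = x /\<^sub>R T" using a by simp_all
      have y: "y \<in> Zzeta8" using x by simp
      have "a *\<^sub>R (y /\<^sub>R T) \<in> D" unfolding xy(2) using x(1) by simp
      moreover have "cj a *\<^sub>R sigma8 y \<in> V" unfolding s[OF y, symmetric] xy(1)[symmetric] using x(1) by simp
      ultimately show "y \<in> ?Y" using y unfolding inD[symmetric] inV[symmetric] by blast
    qed
    show "(\<lambda>y. a *\<^sub>R y) ` ?Y \<subseteq> ?X"
      using a s scaleR_Zzeta8 by (auto simp: inD inV mult.commute)
  qed (use a in auto)
  ultimately show ?thesis using cut_and_project_density[OF J] by (simp add: mult.commute)
qed

text \<open>Inserting p subtracts the points divisible by a and by p, which by coprimality are the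
  multiples of a * p. The induction therefore varies a; the product a * p is again indivisible by
  the primes already in Q.\<close>

lemma density_sieve:
  assumes D: "jordan_measurable D" and V: "jordan_measurable V"
  assumes "finite Q" "Q \<subseteq> PP" "a \<in> Zsqrt2" "a \<noteq> 0" "\<And>q. q \<in> Q \<Longrightarrow> a / q \<notin> Zsqrt2"
  shows "((\<lambda>T::real. real (card {x \<in> Zzeta8. x /\<^sub>R T \<in> D \<and> sigma8 x \<in> V \<and> x /\<^sub>R a \<in> Zzeta8 \<and>
        (\<forall>q\<in>Q. x /\<^sub>R q \<notin> Zzeta8)}) / T\<^sup>2)
      \<longlongrightarrow> measure lebesgue D * measure lebesgue V / 4 * wt a * (\<Prod>q\<in>Q. 1 - wt q)) at_top"
  using assms(3-)
proof (induction Q arbitrary: a)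
  case empty
  then show ?case using density_multiples[OF D V, of a] by (simp add: wt_def)
next
  case (insert p Q)
  define S where "S a Q T = {x \<in> Zzeta8. x /\<^sub>R T \<in> D \<and> sigma8 x \<in> V \<and> x /\<^sub>R a \<in> Zzeta8 \<and>
        (\<forall>q\<in>Q. x /\<^sub>R q \<notin> Zzeta8)}" for a Q T
  have p: "p \<in> PP" "p \<notin> Q" and Q: "Q \<subseteq> PP" using insert by auto
  note pp = PP_D[OF p(1)]
  have co: "comaximal a p" using PP_comaximal[OF p(1), of a] insert.prems comaximal_sym by blast
  have eq: "S a (insert p Q) T = S a Q T - S (a * p) Q T" for T
    using Zzeta8_comaximal_iff[OF co insert.prems(2) pp(1) insert.prems(3) pp(4)] unfolding S_def by blast
  have sub: "S (a * p) Q T \<subseteq> S a Q T" for T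
    using Zzeta8_comaximal_iff[OF co insert.prems(2) pp(1) insert.prems(3) pp(4)] unfolding S_def by blast
  have fin: "finite (S a Q T)" if "T > 0" for T
    by (rule finite_subset[OF _ finite_window[OF D V that]]) (auto simp: S_def)
  have l1: "((\<lambda>T. real (card (S a Q T)) / T\<^sup>2) \<longlongrightarrow> measure lebesgue D * measure lebesgue V / 4 * wt a * (\<Prod>q\<in>Q. 1 - wt q)) at_top"
    unfolding S_def using insert by (intro insert.IH) auto
  have l2: "((\<lambda>T. real (card (S (a * p) Q T)) / T\<^sup>2) \<longlongrightarrow> measure lebesgue D * measure lebesgue V / 4 * wt (a * p) * (\<Prod>q\<in>Q. 1 - wt q)) at_top"
    unfolding S_def
  proof (rule insert.IH)
    fix q assume q: "q \<in> Q"
    then have "q \<in> PP" "q \<noteq> p" "a / q \<notin> Zsqrt2" using p Q insert.prems by auto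
    then show "a * p / q \<notin> Zsqrt2" using PP_dvd_mult[of q a p] PP_not_dvd[of q p] insert.prems(2) pp(1) p(1) by blast
  qed (use insert pp in auto)
  have "((\<lambda>T. real (card (S a Q T)) / T\<^sup>2 - real (card (S (a * p) Q T)) / T\<^sup>2) \<longlongrightarrow>
      measure lebesgue D * measure lebesgue V / 4 * wt a * (\<Prod>q\<in>Q. 1 - wt q)
      - measure lebesgue D * measure lebesgue V / 4 * wt (a * p) * (\<Prod>q\<in>Q. 1 - wt q)) at_top"
    by (intro tendsto_diff l1 l2)
  also have "measure lebesgue D * measure lebesgue V / 4 * wt a * (\<Prod>q\<in>Q. 1 - wt q)
      - measure lebesgue D * measure lebesgue V / 4 * wt (a * p) * (\<Prod>q\<in>Q. 1 - wt q)
      = measure lebesgue D * measure lebesgue V / 4 * wt a * (\<Prod>q\<in>insert p Q. 1 - wt q)"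
    using insert.hyps insert.prems(2) pp(1) by (simp add: wt_mult algebra_simps)
  finally show ?case
  proof (rule Lim_transform_eventually)
    show "\<forall>\<^sub>F T in at_top. real (card (S a Q T)) / T\<^sup>2 - real (card (S (a * p) Q T)) / T\<^sup>2 =
        real (card {x \<in> Zzeta8. x /\<^sub>R T \<in> D \<and> sigma8 x \<in> V \<and> x /\<^sub>R a \<in> Zzeta8 \<and>
        (\<forall>q\<in>insert p Q. x /\<^sub>R q \<notin> Zzeta8)}) / T\<^sup>2"
      using eventually_gt_at_top[of 0]
    proof eventually_elim
      case (elim T)
      have "real (card (S a (insert p Q) T)) = real (card (S a Q T)) - real (card (S (a * p) Q T))"
        unfolding eq using sub[of T] fin[OF elim] card_mono[OF fin[OF elim] sub]
        by (simp add: card_Diff_subset finite_subset of_nat_diff)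
      then show ?case by (simp add: S_def diff_divide_distrib)
    qed
  qed
qed

text \<open>B is arbitrary in the induction: a new condition c subtracts the same count with B cut
  down to the points satisfying c, and this yields the subsets that contain c, with opposite
  sign.\<close>

lemma inclusion_exclusion_none:
  assumes "finite M" "finite B"
  shows "real (card {x \<in> B. \<forall>c\<in>M. \<not> F c x}) = (\<Sum>M0\<in>Pow M. (-1) ^ card M0 * real (card {x \<in> B. \<forall>c\<in>M0. F c x}))"
  using assms
proof (induction M arbitrary: B)
  case empty
  then show ?case by simp
next
  case (insert c M)
  have inj: "inj_on (insert c) (Pow M)" using insert.hyps(2) by (auto simp: inj_on_def)
  have disj: "Pow M \<inter> insert c ` Pow M = {}" using insert.hyps(2) by auto
  have "{x \<in> B. \<forall>c\<in>insert c M. \<not> F c x} = {x \<in> B. \<forall>c\<in>M. \<not> F c x} - {x \<in> {x \<in> B. F c x}. \<forall>c\<in>M. \<not> F c x}"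
    by auto
  moreover have "{x \<in> {x \<in> B. F c x}. \<forall>c\<in>M. \<not> F c x} \<subseteq> {x \<in> B. \<forall>c\<in>M. \<not> F c x}" by auto
  moreover from this have "card {x \<in> {x \<in> B. F c x}. \<forall>c\<in>M. \<not> F c x} \<le> card {x \<in> B. \<forall>c\<in>M. \<not> F c x}"
    using insert.prems by (intro card_mono) auto
  ultimately have "real (card {x \<in> B. \<forall>c\<in>insert c M. \<not> F c x})
      = real (card {x \<in> B. \<forall>c\<in>M. \<not> F c x}) - real (card {x \<in> {x \<in> B. F c x}. \<forall>c\<in>M. \<not> F c x})"
    using insert.prems by (simp add: card_Diff_subset of_nat_diff)
  also have "real (card {x \<in> B. \<forall>c\<in>M. \<not> F c x}) = (\<Sum>M0\<in>Pow M. (-1) ^ card M0 * real (card {x \<in> B. \<forall>c\<in>M0. F c x}))"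
    by (rule insert.IH) (rule insert.prems)
  also have "real (card {x \<in> {x \<in> B. F c x}. \<forall>c\<in>M. \<not> F c x})
      = (\<Sum>M0\<in>Pow M. (-1) ^ card M0 * real (card {x \<in> {x \<in> B. F c x}. \<forall>c\<in>M0. F c x}))"
    using insert.prems by (intro insert.IH) auto
  also have "\<dots> = - (\<Sum>M0\<in>Pow M. (-1) ^ card (insert c M0) * real (card {x \<in> B. \<forall>c\<in>insert c M0. F c x}))"
    unfolding sum_negf[symmetric]
  proof (rule sum.cong)
    fix M0 assume "M0 \<in> Pow M"
    then have "card (insert c M0) = Suc (card M0)"
      using insert.hyps finite_subset by (subst card_insert_disjoint) auto
    moreover have "{x \<in> {x \<in> B. F c x}. \<forall>c\<in>M0. F c x} = {x \<in> B. \<forall>c\<in>insert c M0. F c x}" by auto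
    ultimately show "(-1) ^ card M0 * real (card {x \<in> {x \<in> B. F c x}. \<forall>c\<in>M0. F c x})
        = - ((-1) ^ card (insert c M0) * real (card {x \<in> B. \<forall>c\<in>insert c M0. F c x}))" by simp
  qed simp
  finally show ?case
    using insert.hyps by (simp add: Pow_insert sum.union_disjoint disj sum.reindex[OF inj])
qed

lemma PP_dvd_prod:
  assumes "q \<in> PP" "finite A" "\<And>i. i \<in> A \<Longrightarrow> f i \<in> Zsqrt2" "prod f A / q \<in> Zsqrt2"
  shows "\<exists>i\<in>A. f i / q \<in> Zsqrt2"
  using assms(2-)
proof (induction A)
  case empty
  then show ?case using PP_D[OF assms(1)] by simp
next
  case (insert i A)
  then have "f i / q \<in> Zsqrt2 \<or> prod f A / q \<in> Zsqrt2"
    using PP_dvd_mult[OF assms(1), of "f i" "prod f A"] by simp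
  then show ?case using insert by auto
qed

lemma PP_dvd_power:
  assumes "q \<in> PP" "x \<in> Zsqrt2" "x ^ n / q \<in> Zsqrt2"
  shows "x / q \<in> Zsqrt2"
  using PP_dvd_prod[OF assms(1), of "{..<n}" "\<lambda>_. x"] assms by auto

text \<open>If x = p y, then |sigma(p)| = |N(p)| / p > |N(p)| / fund_unit confines y to a region
  whose two radii have a product of order T / |N(p)|. The crude bound then gives a multiple of T^2 *
  wt p, which is summable over p.\<close>

lemma tail_crude_bound:
  assumes D: "bounded D" and W: "bounded W"
  obtains C where "C \<ge> 0" "\<And>X T. T > 0 \<Longrightarrow>
    finite {x \<in> Zzeta8. x /\<^sub>R T \<in> D \<and> sigma8 x \<in> W \<and> (\<exists>p\<in>PP. \<bar>nrm p\<bar> > X \<and> x /\<^sub>R p \<in> Zzeta8)} \<and>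
    real (card {x \<in> Zzeta8. x /\<^sub>R T \<in> D \<and> sigma8 x \<in> W \<and> (\<exists>p\<in>PP. \<bar>nrm p\<bar> > X \<and> x /\<^sub>R p \<in> Zzeta8)})
      \<le> 1 + C * T\<^sup>2 * tail X"
proof -
  obtain R1 where R1: "\<And>x. x \<in> D \<Longrightarrow> cmod x \<le> R1" using D by (auto simp: bounded_iff)
  obtain R2 where R2: "\<And>x. x \<in> W \<Longrightarrow> cmod x \<le> R2" using W by (auto simp: bounded_iff)
  define R where "R = max 1 (max R1 R2)"
  have R: "R > 0" "\<And>x. x \<in> D \<Longrightarrow> cmod x \<le> R" "\<And>x. x \<in> W \<Longrightarrow> cmod x \<le> R"
    using R1 R2 by (force simp: R_def)+
  obtain C where C: "C > 0" and bnd: "\<And>A B. A > 0 \<Longrightarrow> B > 0 \<Longrightarrow>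
      finite {x \<in> Zzeta8. x \<noteq> 0 \<and> cmod x \<le> A \<and> cmod (sigma8 x) \<le> B} \<and>
      real (card {x \<in> Zzeta8. x \<noteq> 0 \<and> cmod x \<le> A \<and> cmod (sigma8 x) \<le> B}) \<le> C * (A * B)\<^sup>2"
    and small: "\<And>A B. A > 0 \<Longrightarrow> B > 0 \<Longrightarrow> A * B < 1 \<Longrightarrow>
      {x \<in> Zzeta8. x \<noteq> 0 \<and> cmod x \<le> A \<and> cmod (sigma8 x) \<le> B} = {}"
    by (rule Zzeta8_crude_bound) blast
  define l where "l = fund_unit"
  have l: "l > 1" using fund_unit_gt_1 by (simp add: l_def)
  define C' where "C' = C * (R * (R * l))\<^sup>2"
  have main: "finite {x \<in> Zzeta8. x /\<^sub>R T \<in> D \<and> sigma8 x \<in> W \<and> (\<exists>p\<in>PP. \<bar>nrm p\<bar> > X \<and> x /\<^sub>R p \<in> Zzeta8)} \<and>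
    real (card {x \<in> Zzeta8. x /\<^sub>R T \<in> D \<and> sigma8 x \<in> W \<and> (\<exists>p\<in>PP. \<bar>nrm p\<bar> > X \<and> x /\<^sub>R p \<in> Zzeta8)})
      \<le> 1 + C' * T\<^sup>2 * tail X" if T: "T > 0" for X T
  proof -
    define S where "S = {x \<in> Zzeta8. x /\<^sub>R T \<in> D \<and> sigma8 x \<in> W \<and> (\<exists>p\<in>PP. \<bar>nrm p\<bar> > X \<and> x /\<^sub>R p \<in> Zzeta8)}"
    define Y where "Y n = {y \<in> Zzeta8. y \<noteq> 0 \<and> cmod y \<le> T * R \<and> cmod (sigma8 y) \<le> R * l / n}" for n
    \<comment> \<open>Beyond this norm the product of the two radii is below 1 and no nonzero y
      exists, so finitely many primes suffice.\<close>
    define I where "I = {p \<in> PPX (T * R * (R * l)). \<bar>nrm p\<bar> > X}"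
    have finI: "finite I" using finite_PPX by (simp add: I_def)
    have npos: "\<bar>nrm p\<bar> > 0" if "p \<in> PP" for p using nrm_ge_1[of p] PP_D[OF that] by simp
    have Y: "finite (Y \<bar>nrm p\<bar>)" "real (card (Y \<bar>nrm p\<bar>)) \<le> C' * T\<^sup>2 * wt p" if p: "p \<in> PP" for p
    proof -
      have B: "T * R > 0" "R * l / \<bar>nrm p\<bar> > 0" using T R l npos[OF p] by simp_all
      have "C * (T * R * (R * l / \<bar>nrm p\<bar>))\<^sup>2 = C' * T\<^sup>2 * wt p"
        by (simp add: C'_def wt_def power_mult_distrib power_divide)
      then show "finite (Y \<bar>nrm p\<bar>)" "real (card (Y \<bar>nrm p\<bar>)) \<le> C' * T\<^sup>2 * wt p"
        using bnd[OF B] by (simp_all add: Y_def)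
    qed
    \<comment> \<open>The origin is a multiple of every prime; it accounts for the 1 in the
      bound.\<close>
    have "S \<subseteq> insert 0 (\<Union>p\<in>I. (\<lambda>y. p *\<^sub>R y) ` Y \<bar>nrm p\<bar>)"
    proof
      fix x assume x: "x \<in> S"
      show "x \<in> insert 0 (\<Union>p\<in>I. (\<lambda>y. p *\<^sub>R y) ` Y \<bar>nrm p\<bar>)"
      proof (cases "x = 0")
        case False
        obtain p where p: "p \<in> PP" "\<bar>nrm p\<bar> > X" "x /\<^sub>R p \<in> Zzeta8" using x by (auto simp: S_def)
        note pp = PP_D[OF p(1)]
        define y where "y = x /\<^sub>R p"
        have xy: "x = p *\<^sub>R y" using pp by (simp add: y_def)
        have y: "y \<in> Zzeta8" "y \<noteq> 0" using p False pp by (simp_all add: y_def)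
        have "cmod (x /\<^sub>R T) \<le> R" using x R(2) unfolding S_def by blast
        then have "cmod x \<le> T * R" using T by (simp add: field_simps)
        moreover have "cmod y \<le> cmod x" unfolding xy using pp mult_right_mono[of 1 p "cmod y"] by simp
        ultimately have cy: "cmod y \<le> T * R" by simp
        have "sigma8 x = cj p *\<^sub>R sigma8 y" unfolding xy using pp y by (intro sigma8_scaleR) (auto simp: Zzeta8_Qzeta8)
        moreover have "cmod (sigma8 x) \<le> R" using x R(3) by (simp add: S_def)
        ultimately have c1: "\<bar>cj p\<bar> * cmod (sigma8 y) \<le> R" by simp
        have "\<bar>nrm p\<bar> * cmod (sigma8 y) = p * (\<bar>cj p\<bar> * cmod (sigma8 y))" using pp by (simp add: nrm_cj abs_mult)
        also have "\<dots> \<le> l * R" using pp c1 l R by (intro mult_mono) (auto simp: l_def)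
        finally have "cmod (sigma8 y) \<le> R * l / \<bar>nrm p\<bar>" using npos[OF p(1)] by (simp add: field_simps)
        then have yY: "y \<in> Y \<bar>nrm p\<bar>" using y cy by (simp add: Y_def)
        have "\<not> T * R * (R * l / \<bar>nrm p\<bar>) < 1"
          using small[of "T * R" "R * l / \<bar>nrm p\<bar>"] yY T R l npos[OF p(1)] unfolding Y_def by auto
        then have "\<bar>nrm p\<bar> \<le> T * R * (R * l)" using npos[OF p(1)] by (simp add: field_simps)
        then have "p \<in> I" using p by (simp add: I_def PPX_def)
        then show ?thesis using xy yY by blast
      qed simp
    qed
    moreover have finU: "finite (\<Union>p\<in>I. (\<lambda>y. p *\<^sub>R y) ` Y \<bar>nrm p\<bar>)"
      using finI Y(1) by (auto simp: I_def PPX_def)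
    ultimately have "finite S" and "card S \<le> card (insert 0 (\<Union>p\<in>I. (\<lambda>y. p *\<^sub>R y) ` Y \<bar>nrm p\<bar>))"
      by (auto intro: finite_subset card_mono)
    moreover have "card (insert 0 (\<Union>p\<in>I. (\<lambda>y. p *\<^sub>R y) ` Y \<bar>nrm p\<bar>)) \<le> Suc (card (\<Union>p\<in>I. (\<lambda>y. p *\<^sub>R y) ` Y \<bar>nrm p\<bar>))"
      using finU by (simp add: card_insert_if)
    moreover have "card (\<Union>p\<in>I. (\<lambda>y. p *\<^sub>R y) ` Y \<bar>nrm p\<bar>) \<le> (\<Sum>p\<in>I. card ((\<lambda>y. p *\<^sub>R y) ` Y \<bar>nrm p\<bar>))"
      by (rule card_UN_le[OF finI])
    moreover have "(\<Sum>p\<in>I. card ((\<lambda>y. p *\<^sub>R y) ` Y \<bar>nrm p\<bar>)) \<le> (\<Sum>p\<in>I. card (Y \<bar>nrm p\<bar>))"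
      using Y(1) by (intro sum_mono card_image_le) (auto simp: I_def PPX_def)
    ultimately have "card S \<le> Suc (\<Sum>p\<in>I. card (Y \<bar>nrm p\<bar>))" by linarith
    then have "real (card S) \<le> real (Suc (\<Sum>p\<in>I. card (Y \<bar>nrm p\<bar>)))" by (rule of_nat_mono)
    then have "real (card S) \<le> 1 + (\<Sum>p\<in>I. real (card (Y \<bar>nrm p\<bar>)))" by simp
    also have "\<dots> \<le> 1 + (\<Sum>p\<in>I. C' * T\<^sup>2 * wt p)"
      using Y(2) by (intro add_left_mono sum_mono) (auto simp: I_def PPX_def)
    also have "(\<Sum>p\<in>I. C' * T\<^sup>2 * wt p) = C' * T\<^sup>2 * (\<Sum>p\<in>I. wt p)" by (simp add: sum_distrib_left)
    also have "\<dots> \<le> C' * T\<^sup>2 * tail X"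
    proof (rule mult_left_mono)
      have "infsum wt I \<le> tail X"
        unfolding tail_def using finI PP_D(5)
        by (intro infsum_mono_neutral wt_summable_subset) (auto simp: I_def PPX_def)
      then show "(\<Sum>p\<in>I. wt p) \<le> tail X" using finI by simp
      show "0 \<le> C' * T\<^sup>2" using C by (simp add: C'_def)
    qed
    finally show ?thesis using \<open>finite S\<close> by (simp add: S_def)
  qed
  show ?thesis by (rule that[of C']) (use main C in \<open>auto simp: C'_def\<close>)
qed

section \<open>Visible points\<close>

text \<open>From X * b = a * Y with a and b coprime it follows that a divides X. So any explicit
  fraction for c controls its numerators.\<close>

lemma is_numerator_divides:
  assumes a: "is_numerator c a" and c: "c = X / Y" "X \<in> Zsqrt2" "Y \<in> Zsqrt2" "X \<noteq> 0" "Y \<noteq> 0"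
  shows "a \<noteq> 0" "a \<in> Zsqrt2" "X / a \<in> Zsqrt2"
proof -
  obtain b where b: "a \<in> Zsqrt2" "b \<in> Zsqrt2" "b \<noteq> 0" "c = a / b" "comaximal a b"
    using a comaximal_if_relatively_prime unfolding is_numerator_def by blast
  show a0: "a \<noteq> 0" using b c by auto
  show "a \<in> Zsqrt2" by fact
  obtain r s where rs: "r \<in> Zsqrt2" "s \<in> Zsqrt2" "r * a + s * b = 1" using b(5) by (auto simp: comaximal_def)
  have Xb: "X * b / a = Y" using b c a0 by (simp add: field_simps)
  have "X / a = (r * a + s * b) * X / a" using rs by simp
  also have "\<dots> = r * X + s * (X * b / a)" using a0 by (simp add: field_simps)
  also have "\<dots> \<in> Zsqrt2" unfolding Xb using rs c by simp
  finally show "X / a \<in> Zsqrt2" .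
qed

text \<open>If r * a + s * b = 1, then x / a = r x + s (x / c); conversely x / c = b (x /
  a).\<close>

lemma divide_by_numerator_iff:
  assumes a: "is_numerator c a" and c: "c \<noteq> 0" and x: "x \<in> Zzeta8"
  shows "x /\<^sub>R c \<in> Zzeta8 \<longleftrightarrow> x /\<^sub>R a \<in> Zzeta8"
proof -
  obtain b where b: "a \<in> Zsqrt2" "b \<in> Zsqrt2" "b \<noteq> 0" "c = a / b" "comaximal a b"
    using a comaximal_if_relatively_prime unfolding is_numerator_def by blast
  have a0: "a \<noteq> 0" using b c by auto
  obtain r s where rs: "r \<in> Zsqrt2" "s \<in> Zsqrt2" "r * a + s * b = 1" using b(5) by (auto simp: comaximal_def)
  have "inverse c = b * inverse a" using a0 b by (simp add: divide_inverse)
  then have e: "x /\<^sub>R c = b *\<^sub>R (x /\<^sub>R a)" by simp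
  have "x /\<^sub>R a = (r * a + s * b) *\<^sub>R (x /\<^sub>R a)" using rs by simp
  also have "\<dots> = (r + s * (b * inverse a)) *\<^sub>R x" using a0 by (simp add: distrib_right)
  also have "\<dots> = r *\<^sub>R x + s *\<^sub>R (x /\<^sub>R c)" unfolding e by (simp add: scaleR_add_left)
  finally have "x /\<^sub>R a = r *\<^sub>R x + s *\<^sub>R (x /\<^sub>R c)" .
  then show ?thesis using e rs b x scaleR_Zzeta8 z8_add_closed by metis
qed

text \<open>The universal property of the least common multiple is applied to the two
  Z[sqrt 2]-coordinates of x. The set of numerators contains all associates, which impose the same
  condition.\<close>

lemma divide_by_lcm_iff:
  assumes L: "is_lcm_of RZ L {a. \<exists>c\<in>M0. is_numerator c a}" "L \<noteq> 0"
    and M0: "\<And>c. c \<in> M0 \<Longrightarrow> c \<noteq> 0 \<and> (\<exists>a. is_numerator c a)"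
    and num: "\<And>c a. c \<in> M0 \<Longrightarrow> is_numerator c a \<Longrightarrow> a \<noteq> 0"
    and x: "x \<in> Zzeta8"
  shows "(\<forall>c\<in>M0. x /\<^sub>R c \<in> Zzeta8) \<longleftrightarrow> x /\<^sub>R L \<in> Zzeta8"
proof -
  define A where "A = {a. \<exists>c\<in>M0. is_numerator c a}"
  have A: "a \<noteq> 0 \<and> a \<in> Zsqrt2" if "a \<in> A" for a using that num by (auto simp: A_def is_numerator_def)
  obtain u v where uv: "u \<in> Zsqrt2" "v \<in> Zsqrt2" "x = of_real u + of_real v * zeta8"
    using x by (rule Zzeta8_decompose)
  have lcm: "w / L \<in> Zsqrt2 \<longleftrightarrow> (\<forall>a\<in>A. w / a \<in> Zsqrt2)" if w: "w \<in> Zsqrt2" for w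
  proof
    assume wL: "w / L \<in> Zsqrt2"
    show "\<forall>a\<in>A. w / a \<in> Zsqrt2"
    proof
      fix a assume a: "a \<in> A"
      then have "L / a \<in> Zsqrt2" using L(1) A[OF a] divides_RZ[of a L] by (auto simp: is_lcm_of_def A_def)
      then have "(w / L) * (L / a) \<in> Zsqrt2" using wL by (intro Zsqrt2_mult)
      then show "w / a \<in> Zsqrt2" using L(2) by simp
    qed
  next
    assume wa: "\<forall>a\<in>A. w / a \<in> Zsqrt2"
    have "\<forall>a\<in>A. a divides\<^bsub>RZ\<^esub> w"
    proof
      fix a assume a: "a \<in> A"
      then have "w / a \<in> Zsqrt2" "a \<noteq> 0" using wa A by auto
      then show "a divides\<^bsub>RZ\<^esub> w" by (simp add: divides_RZ)
    qed
    then have "L divides\<^bsub>RZ\<^esub> w" using L(1) w unfolding is_lcm_of_def A_def RZ_simps by blast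
    then show "w / L \<in> Zsqrt2" using L(2) by (simp add: divides_RZ)
  qed
  have "(\<forall>c\<in>M0. x /\<^sub>R c \<in> Zzeta8) \<longleftrightarrow> (\<forall>a\<in>A. x /\<^sub>R a \<in> Zzeta8)"
    using M0 divide_by_numerator_iff[OF _ _ x] unfolding A_def by blast
  also have "\<dots> \<longleftrightarrow> x /\<^sub>R L \<in> Zzeta8"
    unfolding uv(3) Zzeta8_divide_iff lcm[OF uv(1)] lcm[OF uv(2)] by blast
  finally show ?thesis .
qed

lemma sigma8_divide:
  assumes "c \<in> Qsqrt2" "x \<in> Zzeta8" "c \<noteq> 0"
  shows "sigma8 (x /\<^sub>R c) \<in> W \<longleftrightarrow> sigma8 x \<in> (\<lambda>w. sigma8 (of_real c) * w) ` W"
proof -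
  have c: "cj c \<noteq> 0" using assms cj_eq_0 by simp
  have s: "sigma8 x = cj c *\<^sub>R sigma8 (x /\<^sub>R c)"
    using sigma8_scaleR[of "inverse c" x] assms c cj_mult[of c "inverse c"] by (simp add: Zzeta8_Qzeta8)
  have inj: "cj c *\<^sub>R v = cj c *\<^sub>R w \<longleftrightarrow> v = w" for v w :: complex using c by simp
  show ?thesis
    unfolding sigma8_of_real[OF assms(1)] scaleR_conv_of_real[symmetric] s by (auto simp: inj c)
qed

lemma jordan_measurable_win_inter:
  assumes "jordan_measurable W" "finite M0" "\<And>c. c \<in> M0 \<Longrightarrow> c \<in> Qsqrt2 \<and> c \<noteq> 0"
  shows "jordan_measurable (win_inter W M0)"
  using assms(2,3)
proof (induction M0)
  case empty
  then show ?case using assms(1) by (simp add: win_inter_def)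
next
  case (insert c M0)
  have "win_inter W (insert c M0) = win_inter W M0 \<inter> (\<lambda>w. cj c *\<^sub>R w) ` W"
    using sigma8_of_real[of c] insert.prems[of c] by (auto simp: win_inter_def scaleR_conv_of_real)
  moreover have "cj c \<noteq> 0" using insert.prems[of c] cj_eq_0 by simp
  ultimately show ?case
    using insert by (auto intro!: jordan_measurable_Int jordan_measurable_scaleR assms(1))
qed

text \<open>The term C * e X does not depend on T, so X can be fixed first and T sent to infinity
  afterwards. The term 1 / T^2 makes room for the origin, counted once in
  \<open>tail_crude_bound\<close>.\<close>

lemma tendsto_by_truncation:
  fixes f g e :: "real \<Rightarrow> real" and F :: "real \<Rightarrow> real \<Rightarrow> real"
  assumes lim: "\<And>X. X \<ge> N \<Longrightarrow> (F X \<longlongrightarrow> g X) at_top"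
    and g: "(g \<longlongrightarrow> l) at_top" and e: "(e \<longlongrightarrow> 0) at_top"
    and bound: "\<And>X T. X \<ge> N \<Longrightarrow> T > 0 \<Longrightarrow> \<bar>f T - F X T\<bar> \<le> 1 / T\<^sup>2 + C * e X"
  shows "(f \<longlongrightarrow> l) at_top"
proof (rule tendstoI)
  fix \<epsilon> :: real assume \<epsilon>: "\<epsilon> > 0"
  have "((\<lambda>X. C * e X) \<longlongrightarrow> C * 0) at_top" by (intro tendsto_intros e)
  then have "eventually (\<lambda>X. C * e X < \<epsilon> / 4) at_top" by (rule order_tendstoD) (use \<epsilon> in simp)
  moreover have "eventually (\<lambda>X. dist (g X) l < \<epsilon> / 4) at_top" using g \<epsilon> by (intro tendstoD) auto
  moreover have "eventually (\<lambda>X. X \<ge> N) at_top" by (rule eventually_ge_at_top)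
  ultimately have "eventually (\<lambda>X. C * e X < \<epsilon> / 4 \<and> dist (g X) l < \<epsilon> / 4 \<and> X \<ge> N) at_top"
    by eventually_elim simp
  then obtain X where X: "C * e X < \<epsilon> / 4" "dist (g X) l < \<epsilon> / 4" "X \<ge> N"
    by (auto simp: eventually_at_top_linorder)
  have "eventually (\<lambda>T. dist (F X T) (g X) < \<epsilon> / 4) at_top" using lim[OF X(3)] \<epsilon> by (intro tendstoD) auto
  moreover have "((\<lambda>T::real. (inverse T)\<^sup>2) \<longlongrightarrow> 0\<^sup>2) at_top"
    by (intro tendsto_intros tendsto_inverse_0_at_top filterlim_ident)
  then have "((\<lambda>T::real. 1 / T\<^sup>2) \<longlongrightarrow> 0) at_top" by (simp add: inverse_eq_divide power_divide)
  then have "eventually (\<lambda>T::real. 1 / T\<^sup>2 < \<epsilon> / 4) at_top" by (rule order_tendstoD) (use \<epsilon> in simp)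
  ultimately show "eventually (\<lambda>T. dist (f T) l < \<epsilon>) at_top"
    using eventually_gt_at_top[of 0]
  proof eventually_elim
    case (elim T)
    then show ?case using bound[OF X(3) elim(3)] X unfolding dist_real_def by linarith
  qed
qed

theorem theorem4p12:
  fixes W :: "complex set" and r :: real and P M :: "real set"
    and k0 K :: int and m :: "real \<Rightarrow> int" and L :: "real set \<Rightarrow> real"
  assumes "jordan_measurable W" and "star_shaped_origin W" and "0 \<in> interior W"
    and "r \<ge> 1" and "uminus ` W \<subseteq> (\<lambda>w. r *\<^sub>R w) ` W"
    and "P = {p \<in> PP. cmod (sigma8 (of_real p)) \<le> r}"
    and "k0 \<le> 0" and "\<And>p. p \<in> P \<Longrightarrow> m p \<ge> 1"
    and "M = ({p powi m p |p. p \<in> P} \<union>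
              {fund_unit powi k * (\<Prod>p\<in>P. p powi e p) |k e.
                 k0 \<le> k \<and> k \<le> K \<and> (\<forall>p\<in>P. - m p < e p \<and> e p < m p)}) \<inter> {1<..}"
    and "occlusion_quotients ((PP - P) \<union> M) (A_win W)"
    and "L {} = 1"
    and "\<And>M0. M0 \<subseteq> M \<Longrightarrow> is_lcm_of (induced_ring Zsqrt2) (L M0) {a. \<exists>c\<in>M0. is_numerator c a}"
  shows "has_density (visible (A_win W))
    (inverse (4 * dedekind_zeta (induced_ring Zsqrt2) 2 * (\<Prod>p\<in>P. 1 - 1 / (nrm p)\<^sup>2)) *
     (\<Sum>M0\<in>Pow M. (-1) ^ card M0 * measure lebesgue (win_inter W M0) / (nrm (L M0))\<^sup>2))"
proof -
  note jW = assms(1) and star = assms(2) and refl = assms(5) and P_def = assms(6) and occ = assms(10) and lcm = assms(12)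
  have fP: "finite P" unfolding P_def by (rule finite_PP_bounded)
  have PPP: "p \<in> PP" and PZ: "p \<in> Zsqrt2" and P0: "p \<noteq> 0" if "p \<in> P" for p
    using that PP_D[of p] by (auto simp: P_def)
  have mpos: "m p \<ge> 1" if "p \<in> P" for p using assms(8) that .
  \<comment> \<open>A common multiple of all numerators of elements of M, built from primes of P
    only. Every \<open>L M0\<close> divides it, hence is nonzero and prime to all sieved
    primes.\<close>
  define G where "G = (\<Prod>p\<in>P. p ^ nat (m p))"
  have G: "G \<in> Zsqrt2" "G \<noteq> 0" using PZ P0 fP by (auto simp: G_def)
  have fund0: "fund_unit \<noteq> 0" using fund_unit_gt_1 by simp
  have Mform: "\<exists>X Y. X \<in> Zsqrt2 \<and> Y \<in> Zsqrt2 \<and> X \<noteq> 0 \<and> Y \<noteq> 0 \<and> c = X / Y \<and> G / X \<in> Zsqrt2"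
    if "c \<in> M" for c
  proof -
    consider p where "p \<in> P" "c = p powi m p"
      | k e where "c = fund_unit powi k * (\<Prod>p\<in>P. p powi e p)" "\<forall>p\<in>P. - m p < e p \<and> e p < m p"
      using \<open>c \<in> M\<close> unfolding assms(9) by blast
    then show ?thesis
    proof cases
      case 1
      have c: "c = p ^ nat (m p)" using mpos[OF 1(1)] 1(2) by (simp add: power_int_def)
      have "G = c * (\<Prod>p\<in>P - {p}. p ^ nat (m p))"
        unfolding G_def c using fP 1(1) by (rule prod.remove)
      moreover have "(\<Prod>p\<in>P - {p}. p ^ nat (m p)) \<in> Zsqrt2" by (intro Zsqrt2_prod Zsqrt2_power PZ) auto
      ultimately show ?thesis using c PZ[OF 1(1)] P0[OF 1(1)] by (intro exI[of _ c] exI[of _ 1]) simp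
    next
      case 2
      define X Y where "X = fund_unit powi k * (\<Prod>p\<in>P. p ^ nat (e p))" and "Y = (\<Prod>p\<in>P. p ^ nat (- e p))"
      \<comment> \<open>\<open>nat\<close> sends negative exponents to 0, so at least one of the two
        powers is 1.\<close>
      have pw: "p powi e p = p ^ nat (e p) / p ^ nat (- e p)" for p
        by (auto simp: power_int_def inverse_eq_divide power_one_over)
      have "c = X / Y" unfolding 2(1) X_def Y_def pw by (simp add: prod_dividef)
      moreover have "X \<in> Zsqrt2" "Y \<in> Zsqrt2" using PZ by (simp_all add: X_def Y_def)
      moreover have "X \<noteq> 0" "Y \<noteq> 0" using P0 fP fund0 by (auto simp: X_def Y_def)
      moreover have "G / X \<in> Zsqrt2"
      proof -
        have "G = (\<Prod>p\<in>P. p ^ nat (e p) * p ^ (nat (m p) - nat (e p)))"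
          unfolding G_def
        proof (rule prod.cong)
          fix p assume "p \<in> P"
          then have "nat (e p) \<le> nat (m p)" using 2(2) by fastforce
          then show "p ^ nat (m p) = p ^ nat (e p) * p ^ (nat (m p) - nat (e p))"
            by (simp flip: power_add)
        qed simp
        then have "G / X = fund_unit powi (- k) * (\<Prod>p\<in>P. p ^ (nat (m p) - nat (e p)))"
          using P0 fP fund0 by (simp add: X_def prod.distrib power_int_minus field_simps)
        then show ?thesis using PZ by simp
      qed
      ultimately show ?thesis by blast
    qed
  qed
  have M1: "c > 1" if "c \<in> M" for c using that unfolding assms(9) by simp
  have MQ: "c \<in> Qsqrt2" "c \<noteq> 0" if "c \<in> M" for c
    using Mform[OF that] M1[OF that] by auto
  have numex: "\<exists>a. is_numerator c a" if "c \<in> M" for c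
    using Mform[OF that] numerator_exists by metis
  have num: "a \<noteq> 0 \<and> a \<in> Zsqrt2 \<and> G / a \<in> Zsqrt2" if ca: "c \<in> M" "is_numerator c a" for c a
  proof -
    obtain X Y where XY: "X \<in> Zsqrt2" "Y \<in> Zsqrt2" "X \<noteq> 0" "Y \<noteq> 0" "c = X / Y" "G / X \<in> Zsqrt2"
      using Mform[OF ca(1)] by blast
    note d = is_numerator_divides[OF ca(2) XY(5,1,2,3,4)]
    have "(G / X) * (X / a) \<in> Zsqrt2" using XY(6) d(3) by (rule Zsqrt2_mult)
    then show ?thesis using d XY by simp
  qed
  have fM: "finite M"
  proof -
    \<comment> \<open>Only the values of e on P matter, so exponent functions may be restricted to
      P, which leaves finitely many.\<close>
    define E where "E = (\<Pi>\<^sub>E p\<in>P. {- m p<..<m p})"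
    have "M \<subseteq> (\<lambda>p. p powi m p) ` P \<union> (\<lambda>(k, e). fund_unit powi k * (\<Prod>p\<in>P. p powi e p)) ` ({k0..K} \<times> E)"
    proof
      fix c assume "c \<in> M"
      then consider p where "p \<in> P" "c = p powi m p"
        | k e where "c = fund_unit powi k * (\<Prod>p\<in>P. p powi e p)" "k0 \<le> k" "k \<le> K"
          "\<forall>p\<in>P. - m p < e p \<and> e p < m p"
        unfolding assms(9) by blast
      then show "c \<in> (\<lambda>p. p powi m p) ` P \<union> (\<lambda>(k, e). fund_unit powi k * (\<Prod>p\<in>P. p powi e p)) ` ({k0..K} \<times> E)"
      proof cases
        case 2
        have "restrict e P \<in> E" using 2(4) by (auto simp: E_def)
        moreover have "c = fund_unit powi k * (\<Prod>p\<in>P. p powi restrict e P p)"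
          unfolding 2(1) by (intro arg_cong2[where f = "(*)"] prod.cong) auto
        ultimately show ?thesis using 2(2,3) by (intro UnI2 image_eqI[of _ _ "(k, restrict e P)"]) auto
      qed blast
    qed
    moreover have "finite E" unfolding E_def using fP by (intro finite_PiE) auto
    ultimately show ?thesis using fP by (auto intro: finite_subset)
  qed
  have L: "L M0 \<noteq> 0" "L M0 \<in> Zsqrt2" "\<And>q. q \<in> PP - P \<Longrightarrow> L M0 / q \<notin> Zsqrt2" if M0: "M0 \<subseteq> M" for M0
  proof -
    have "L M0 divides\<^bsub>RZ\<^esub> G"
      using lcm[OF M0] G num M0 divides_RZ unfolding is_lcm_of_def RZ_simps by blast
    moreover from this show L0: "L M0 \<noteq> 0" using G(2) by (auto simp: factor_def RZ_simps)
    ultimately have GL: "G / L M0 \<in> Zsqrt2" by (simp add: divides_RZ)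
    show "L M0 \<in> Zsqrt2" using lcm[OF M0] by (simp add: is_lcm_of_def RZ_simps)
    show "L M0 / q \<notin> Zsqrt2" if q: "q \<in> PP - P" for q
    proof
      assume "L M0 / q \<in> Zsqrt2"
      then have "(G / L M0) * (L M0 / q) \<in> Zsqrt2" using GL by (intro Zsqrt2_mult)
      then have "G / q \<in> Zsqrt2" using L0 by simp
      then obtain p where p: "p \<in> P" "p ^ nat (m p) / q \<in> Zsqrt2"
        using PP_dvd_prod[of q P "\<lambda>p. p ^ nat (m p)"] q fP PZ by (auto simp: G_def)
      then have "p / q \<in> Zsqrt2" using PP_dvd_power[of q p] q PZ by blast
      then show False using PP_not_dvd[of q p] q p(1) PPP by blast
    qed
  qed
  define F where "F c x \<longleftrightarrow> x /\<^sub>R c \<in> Zzeta8 \<and> sigma8 (x /\<^sub>R c) \<in> W" for c x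
  define V where "V = visible (A_win W)"
  have divW: "sigma8 (x /\<^sub>R q) \<in> W" if x: "x \<in> Zzeta8" "sigma8 x \<in> W" and q: "q \<in> PP - P" for x q
  proof -
    have qq: "q \<in> Qsqrt2" "q \<noteq> 0" using q PP_D by auto
    have big: "\<bar>cj q\<bar> > r" using q by (auto simp: P_def cmod_sigma8_of_real PP_D(7))
    have cjq: "cj (inverse q) = inverse (cj q)" using cj_divide[of 1 q] qq by (simp add: inverse_eq_divide)
    have s: "sigma8 (x /\<^sub>R q) = inverse (cj q) *\<^sub>R sigma8 x"
      using sigma8_scaleR[of "inverse q" x] x qq by (simp add: Zzeta8_Qzeta8 cjq)
    have sW: "t *\<^sub>R w \<in> W" if "w \<in> W" "0 \<le> t" "t \<le> 1" for t w
      using star that by (auto simp: star_shaped_origin_def)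
    show ?thesis
    proof (cases "cj q > 0")
      case True
      then show ?thesis unfolding s using x big assms(4) by (intro sW) (auto simp: field_simps)
    next
      case False
      \<comment> \<open>For a conjugate that is not positive, the reflection hypothesis expresses
        -sigma(x) as r w, and the factor r / |cj q| < 1 keeps w inside the star-shaped
        window.\<close>
      obtain w where w: "w \<in> W" "- sigma8 x = r *\<^sub>R w" using refl x by blast
      have "inverse (cj q) *\<^sub>R sigma8 x = (- inverse (cj q)) *\<^sub>R (- sigma8 x)" by simp
      also have "\<dots> = (r / \<bar>cj q\<bar>) *\<^sub>R w" using False by (simp add: w(2) divide_inverse)
      finally have "inverse (cj q) *\<^sub>R sigma8 x = (r / \<bar>cj q\<bar>) *\<^sub>R w" .
      then show ?thesis unfolding s using w big assms(4) by (simp add: sW)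
    qed
  qed
  have V: "x \<in> V \<longleftrightarrow> x \<in> Zzeta8 \<and> sigma8 x \<in> W \<and> (\<forall>q\<in>PP - P. x /\<^sub>R q \<notin> Zzeta8) \<and> (\<forall>c\<in>M. \<not> F c x)" for x
  proof -
    have A: "y \<in> A_win W \<longleftrightarrow> y \<in> Zzeta8 \<and> sigma8 y \<in> W" for y by (simp add: A_win_def)
    \<comment> \<open>Every c > 1 with x / c in the set hides x; the converse is the hypothesis on
      occlusion quotients.\<close>
    have vis: "x \<in> V \<longleftrightarrow> (\<forall>c\<in>(PP - P) \<union> M. x /\<^sub>R c \<notin> A_win W)" if x: "x \<in> A_win W"
    proof
      assume "x \<in> V"
      then have t: "t *\<^sub>R x \<notin> A_win W" if t01: "0 < t" "t < 1" for t using t01 by (auto simp: V_def visible_def)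
      show "\<forall>c\<in>(PP - P) \<union> M. x /\<^sub>R c \<notin> A_win W"
      proof
        fix c assume "c \<in> (PP - P) \<union> M"
        then have "c > 1" using occ by (auto simp: occlusion_quotients_def)
        then show "x /\<^sub>R c \<notin> A_win W" by (intro t) (auto simp: field_simps)
      qed
    next
      assume "\<forall>c\<in>(PP - P) \<union> M. x /\<^sub>R c \<notin> A_win W"
      then show "x \<in> V" using occ x unfolding occlusion_quotients_def V_def by blast
    qed
    have VA: "V \<subseteq> A_win W" by (auto simp: V_def visible_def)
    show ?thesis
    proof (cases "x \<in> A_win W")
      case True
      then have x: "x \<in> Zzeta8" "sigma8 x \<in> W" by (simp_all add: A)
      then have "x /\<^sub>R q \<in> A_win W \<longleftrightarrow> x /\<^sub>R q \<in> Zzeta8" if "q \<in> PP - P" for q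
        using divW[OF x that] by (simp add: A)
      then show ?thesis unfolding vis[OF True] ball_Un using x by (simp add: F_def A)
    qed (use VA A in auto)
  qed
  define Q where "Q X = PPX X - P" for X
  have Q: "finite (Q X)" "Q X \<subseteq> PP" "Q X \<subseteq> PP - P" for X using finite_PPX by (auto simp: Q_def PPX_def)
  \<comment> \<open>For p in P the absolute norm p * |cj p| is at most fund_unit * r, so from X1 on
    the truncated set of primes contains P.\<close>
  define X1 where "X1 = max 1 (fund_unit * r)"
  have PX: "P \<subseteq> PPX X" if "X \<ge> X1" for X
  proof
    fix p assume p: "p \<in> P"
    then have "\<bar>cj p\<bar> \<le> r" using PP_D(7)[of p] by (auto simp: P_def cmod_sigma8_of_real)
    then have "p * \<bar>cj p\<bar> \<le> fund_unit * r" using PP_D(2,3)[OF PPP[OF p]] by (intro mult_mono) auto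
    then show "p \<in> PPX X" using that PP_D(2)[OF PPP[OF p]] PPP[OF p] by (simp add: PPX_def nrm_cj abs_mult X1_def)
  qed
  define \<zeta> where "\<zeta> = dedekind_zeta (induced_ring Zsqrt2) 2"
  define PiP where "PiP = (\<Prod>p\<in>P. 1 - wt p)"
  define S where "S = (\<Sum>M0\<in>Pow M. (-1) ^ card M0 * measure lebesgue (win_inter W M0) * wt (L M0))"
  have PiP: "PiP > 0" unfolding PiP_def using PPP wt_PP_less_1 by (intro prod_pos) simp
  have zprod: "((\<lambda>X. (\<Prod>q\<in>PPX X. 1 - wt q) * \<zeta>) \<longlongrightarrow> 1) at_top"
  proof (rule tendsto_sandwich[where f = "\<lambda>_. 1" and h = "\<lambda>X. 1 + tail X"])
    show "\<forall>\<^sub>F X in at_top. 1 \<le> (\<Prod>q\<in>PPX X. 1 - wt q) * \<zeta>"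
      using eventually_ge_at_top[of 1] by eventually_elim (simp add: \<zeta>_def PPX_product_bounds)
    show "\<forall>\<^sub>F X in at_top. (\<Prod>q\<in>PPX X. 1 - wt q) * \<zeta> \<le> 1 + tail X"
      using eventually_ge_at_top[of 1] by eventually_elim (simp add: \<zeta>_def PPX_product_bounds)
    show "((\<lambda>X. 1 + tail X) \<longlongrightarrow> 1) at_top" using tendsto_add[OF tendsto_const tail_tendsto_0, of 1] by simp
  qed simp
  have \<zeta>0: "\<zeta> \<noteq> 0" using PPX_product_bounds(1)[of 1] by (auto simp: \<zeta>_def)
  \<comment> \<open>By the previous limit the product over all primes of norm at most X tends to 1 /
    \<zeta>; cancelling the factors of P leaves the sieved primes.\<close>
  have Qlim: "((\<lambda>X. \<Prod>q\<in>Q X. 1 - wt q) \<longlongrightarrow> 1 / (\<zeta> * PiP)) at_top"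
  proof (rule Lim_transform_eventually)
    show "((\<lambda>X. (\<Prod>q\<in>PPX X. 1 - wt q) * \<zeta> / (\<zeta> * PiP)) \<longlongrightarrow> 1 / (\<zeta> * PiP)) at_top"
      using zprod \<zeta>0 PiP by (intro tendsto_intros) auto
    show "\<forall>\<^sub>F X in at_top. (\<Prod>q\<in>PPX X. 1 - wt q) * \<zeta> / (\<zeta> * PiP) = (\<Prod>q\<in>Q X. 1 - wt q)"
      using eventually_ge_at_top[of X1]
    proof eventually_elim
      case (elim X)
      have "(\<Prod>q\<in>PPX X. 1 - wt q) = (\<Prod>q\<in>Q X. 1 - wt q) * PiP"
        unfolding Q_def PiP_def by (rule prod.subset_diff[OF PX[OF elim] finite_PPX])
      then show ?case using \<zeta>0 PiP by simp
    qed
  qed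
  have main: "((\<lambda>T. real (card (V \<inter> (\<lambda>x. T *\<^sub>R x) ` D)) / T\<^sup>2) \<longlongrightarrow> measure lebesgue D / 4 * S * (1 / (\<zeta> * PiP))) at_top"
    if D: "jordan_measurable D" for D
  proof -
    define B where "B X T = {x \<in> Zzeta8. x /\<^sub>R T \<in> D \<and> sigma8 x \<in> W \<and> (\<forall>q\<in>Q X. x /\<^sub>R q \<notin> Zzeta8)}" for X T
    define VX where "VX X T = {x \<in> B X T. \<forall>c\<in>M. \<not> F c x}" for X T
    have fB: "finite (B X T)" if "T > 0" for X T
      by (rule finite_subset[OF _ finite_window[OF D jW that]]) (auto simp: B_def)
    obtain C where C: "C \<ge> 0" and tailC: "\<And>X T. T > 0 \<Longrightarrow>
        finite {x \<in> Zzeta8. x /\<^sub>R T \<in> D \<and> sigma8 x \<in> W \<and> (\<exists>p\<in>PP. \<bar>nrm p\<bar> > X \<and> x /\<^sub>R p \<in> Zzeta8)} \<and>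
        real (card {x \<in> Zzeta8. x /\<^sub>R T \<in> D \<and> sigma8 x \<in> W \<and> (\<exists>p\<in>PP. \<bar>nrm p\<bar> > X \<and> x /\<^sub>R p \<in> Zzeta8)})
        \<le> 1 + C * T\<^sup>2 * tail X"
      by (rule tail_crude_bound[of D W]) (use D jW in \<open>auto simp: jordan_measurable_def\<close>)
    show ?thesis
    proof (rule tendsto_by_truncation[where N = X1 and F = "\<lambda>X T. real (card (VX X T)) / T\<^sup>2"
          and g = "\<lambda>X. measure lebesgue D / 4 * S * (\<Prod>q\<in>Q X. 1 - wt q)" and e = tail and C = C])
      show "((\<lambda>X. measure lebesgue D / 4 * S * (\<Prod>q\<in>Q X. 1 - wt q)) \<longlongrightarrow> measure lebesgue D / 4 * S * (1 / (\<zeta> * PiP))) at_top"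
        by (intro tendsto_mult tendsto_const Qlim)
      show "(tail \<longlongrightarrow> 0) at_top" by (rule tail_tendsto_0)
    next
      fix X :: real assume "X1 \<le> X"
      define t where "t M0 T = {x \<in> Zzeta8. x /\<^sub>R T \<in> D \<and> sigma8 x \<in> win_inter W M0 \<and> x /\<^sub>R L M0 \<in> Zzeta8 \<and>
        (\<forall>q\<in>Q X. x /\<^sub>R q \<notin> Zzeta8)}" for M0 T
      have teq: "{x \<in> B X T. \<forall>c\<in>M0. F c x} = t M0 T" if M0: "M0 \<subseteq> M" for M0 T
      proof -
        have "(sigma8 x \<in> W \<and> (\<forall>c\<in>M0. F c x)) \<longleftrightarrow> (sigma8 x \<in> win_inter W M0 \<and> x /\<^sub>R L M0 \<in> Zzeta8)"
          if x: "x \<in> Zzeta8" for x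
        proof -
          have "(\<forall>c\<in>M0. x /\<^sub>R c \<in> Zzeta8) \<longleftrightarrow> x /\<^sub>R L M0 \<in> Zzeta8"
            using M0 MQ numex num by (intro divide_by_lcm_iff[OF lcm[OF M0] L(1)[OF M0] _ _ x]) blast+
          moreover have "sigma8 (x /\<^sub>R c) \<in> W \<longleftrightarrow> sigma8 x \<in> (\<lambda>w. sigma8 (of_real c) * w) ` W" if "c \<in> M0" for c
            using M0 MQ that x by (intro sigma8_divide) auto
          ultimately show ?thesis by (auto simp: F_def win_inter_def)
        qed
        then show ?thesis unfolding B_def t_def by blast
      qed
      have "((\<lambda>T. \<Sum>M0\<in>Pow M. (-1) ^ card M0 * (real (card (t M0 T)) / T\<^sup>2)) \<longlongrightarrow>
          (\<Sum>M0\<in>Pow M. (-1) ^ card M0 * (measure lebesgue D * measure lebesgue (win_inter W M0) / 4 * wt (L M0) * (\<Prod>q\<in>Q X. 1 - wt q)))) at_top"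
      proof (intro tendsto_sum tendsto_mult tendsto_const)
        fix M0 assume "M0 \<in> Pow M"
        then have M0: "M0 \<subseteq> M" by simp
        have "jordan_measurable (win_inter W M0)"
          using M0 MQ fM finite_subset by (intro jordan_measurable_win_inter jW) blast+
        then show "((\<lambda>T. real (card (t M0 T)) / T\<^sup>2) \<longlongrightarrow>
            measure lebesgue D * measure lebesgue (win_inter W M0) / 4 * wt (L M0) * (\<Prod>q\<in>Q X. 1 - wt q)) at_top"
          unfolding t_def using Q L[OF M0] by (intro density_sieve D) blast+
      qed
      also have "(\<Sum>M0\<in>Pow M. (-1) ^ card M0 * (measure lebesgue D * measure lebesgue (win_inter W M0) / 4 * wt (L M0) * (\<Prod>q\<in>Q X. 1 - wt q)))
          = measure lebesgue D / 4 * S * (\<Prod>q\<in>Q X. 1 - wt q)"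
        unfolding S_def sum_distrib_left sum_distrib_right by (intro sum.cong) (simp_all add: mult_ac)
      finally show "((\<lambda>T. real (card (VX X T)) / T\<^sup>2) \<longlongrightarrow> measure lebesgue D / 4 * S * (\<Prod>q\<in>Q X. 1 - wt q)) at_top"
      proof (rule Lim_transform_eventually)
        show "\<forall>\<^sub>F T in at_top. (\<Sum>M0\<in>Pow M. (-1) ^ card M0 * (real (card (t M0 T)) / T\<^sup>2)) = real (card (VX X T)) / T\<^sup>2"
          using eventually_gt_at_top[of 0]
        proof eventually_elim
          case (elim T)
          have "real (card (VX X T)) = (\<Sum>M0\<in>Pow M. (-1) ^ card M0 * real (card {x \<in> B X T. \<forall>c\<in>M0. F c x}))"
            unfolding VX_def by (rule inclusion_exclusion_none[OF fM fB[OF elim]])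
          also have "\<dots> = (\<Sum>M0\<in>Pow M. (-1) ^ card M0 * real (card (t M0 T)))"
            by (intro sum.cong) (auto simp: teq)
          finally show ?case by (simp add: sum_divide_distrib)
        qed
      qed
    next
      fix X T :: real assume X: "X1 \<le> X" and T: "T > 0"
      have img: "x \<in> (\<lambda>x. T *\<^sub>R x) ` D \<longleftrightarrow> x /\<^sub>R T \<in> D" for x
        using T by (force simp: image_iff)
      let ?tail = "{x \<in> Zzeta8. x /\<^sub>R T \<in> D \<and> sigma8 x \<in> W \<and> (\<exists>p\<in>PP. \<bar>nrm p\<bar> > X \<and> x /\<^sub>R p \<in> Zzeta8)}"
      let ?V = "V \<inter> (\<lambda>x. T *\<^sub>R x) ` D"
      \<comment> \<open>Truncation imposes fewer conditions, so it can only add points, and each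
        added point is divisible by a prime of norm above X.\<close>
      have sub: "?V \<subseteq> VX X T" using Q(3)[of X] unfolding VX_def B_def V subset_iff Int_iff img mem_Collect_eq by blast
      have diff: "VX X T - ?V \<subseteq> ?tail"
      proof
        fix x assume x: "x \<in> VX X T - ?V"
        then have "x \<notin> V" by (auto simp: VX_def B_def img)
        then obtain q where q: "q \<in> PP - P" "x /\<^sub>R q \<in> Zzeta8" using x V by (auto simp: VX_def B_def)
        then have "q \<notin> PPX X" using x by (auto simp: VX_def B_def Q_def)
        then have "q \<in> PP" "\<bar>nrm q\<bar> > X" using q by (auto simp: PPX_def)
        then show "x \<in> ?tail" using x q(2) by (auto simp: VX_def B_def)
      qed
      have fVX: "finite (VX X T)" using fB[OF T] by (simp add: VX_def)
      have "real (card (VX X T)) - real (card ?V) = real (card (VX X T - ?V))"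
        using sub fVX by (simp add: card_Diff_subset finite_subset card_mono of_nat_diff)
      also have "\<dots> \<le> real (card ?tail)" using diff tailC[OF T, of X] by (simp add: card_mono)
      also have "\<dots> \<le> 1 + C * T\<^sup>2 * tail X" using tailC[OF T] by blast
      finally have "real (card (VX X T)) - real (card ?V) \<le> 1 + C * T\<^sup>2 * tail X" .
      moreover have "real (card ?V) \<le> real (card (VX X T))" using sub fVX by (simp add: card_mono)
      ultimately have "\<bar>real (card ?V) - real (card (VX X T))\<bar> \<le> 1 + C * T\<^sup>2 * tail X" by linarith
      then have "\<bar>real (card ?V) - real (card (VX X T))\<bar> / T\<^sup>2 \<le> (1 + C * T\<^sup>2 * tail X) / T\<^sup>2"
        by (rule divide_right_mono) simp
      then show "\<bar>real (card ?V) / T\<^sup>2 - real (card (VX X T)) / T\<^sup>2\<bar> \<le> 1 / T\<^sup>2 + C * tail X"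
        using T by (simp add: add_divide_distrib flip: diff_divide_distrib)
    qed
  qed
  have const: "inverse (4 * \<zeta> * (\<Prod>p\<in>P. 1 - 1 / (nrm p)\<^sup>2)) *
     (\<Sum>M0\<in>Pow M. (-1) ^ card M0 * measure lebesgue (win_inter W M0) / (nrm (L M0))\<^sup>2) = S / (4 * \<zeta> * PiP)"
  proof -
    have "(\<Sum>M0\<in>Pow M. (-1) ^ card M0 * measure lebesgue (win_inter W M0) / (nrm (L M0))\<^sup>2) = S"
      by (simp add: S_def wt_def)
    moreover have "(\<Prod>p\<in>P. 1 - 1 / (nrm p)\<^sup>2) = PiP" by (simp add: PiP_def wt_def)
    ultimately show ?thesis by (simp only: divide_inverse mult.commute)
  qed
  show ?thesis
    unfolding has_density_def \<zeta>_def[symmetric] const V_def[symmetric]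
  proof (intro allI impI)
    fix D :: "complex set" assume D: "jordan_measurable D \<and> 0 < measure lebesgue D"
    have "((\<lambda>T. real (card (V \<inter> (\<lambda>x. T *\<^sub>R x) ` D)) / T\<^sup>2 / measure lebesgue D) \<longlongrightarrow>
        measure lebesgue D / 4 * S * (1 / (\<zeta> * PiP)) / measure lebesgue D) at_top"
      using D by (intro tendsto_divide main tendsto_const) auto
    moreover have "measure lebesgue D / 4 * S * (1 / (\<zeta> * PiP)) / measure lebesgue D = S / (4 * \<zeta> * PiP)"
      using D by simp
    \<comment> \<open>The plane has dimension 2, so dilation by T multiplies areas by T^2.\<close>
    moreover have "real (card (V \<inter> (\<lambda>x. T *\<^sub>R x) ` D)) / T\<^sup>2 / measure lebesgue D
        = real (card (V \<inter> (\<lambda>x. T *\<^sub>R x) ` D)) / measure lebesgue ((\<lambda>x. T *\<^sub>R x) ` D)" for T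
      by (simp add: measure_scaleR_image)
    ultimately show "((\<lambda>T. real (card (V \<inter> (\<lambda>x. T *\<^sub>R x) ` D)) / measure lebesgue ((\<lambda>x. T *\<^sub>R x) ` D))
        \<longlongrightarrow> S / (4 * \<zeta> * PiP)) at_top" by (simp only:)
  qed
qed

end
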